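(* Let $k$ be an algebraically closed field of characteristic $0$. For any integer $n\geqslant 1$, every Cremona group (over $k$) of rank $\geqslant 3n-1$ contains the group $\mathrm{Aut}(F_n)$ and, for $n\geqslant 3$, the braid group $B_n$.
   Context: The Cremona group of rank $r$ over $k$ is the group of birational self-maps of the $r$-dimensional affine (equivalently, projective) space over $k$; equivalently, the group of $k$-automorphisms of the field $k(x_1,\dots,x_r)$ of rational functions in $r$ variables. $F_n$ is the free group of rank $n$, $\mathrm{Aut}(F_n)$ its automorphism group, and $B_n$ the braid group on $n$ strands. "A group $A$ contains a group $B$" means that there exists a group monomorphism $B\hookrightarrow A$. *)

theory Defs
  imports
    "HOL-Algebra.Bij"
    "HOL-Algebra.Ring"
    "HOL-Library.Poly_Mapping"
    "HOL-Computational_Algebra.Polynomial"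
    "HOL-Computational_Algebra.Fraction_Field"
begin

section \<open>Groups given by generators and relations\<close>

text \<open>
  A letter \<open>(x, True)\<close> stands for the generator \<open>x\<close> and \<open>(x, False)\<close> for its formal inverse.
  A set \<open>R\<close> of pairs of words encodes the relations \<open>u = v\<close> for \<open>(u, v) \<in> R\<close>.
\<close>

type_synonym 'a word = "('a \<times> bool) list"

definition words :: "'a set \<Rightarrow> 'a word set"
  where "words X = lists (X \<times> UNIV)"

inductive_set word_rel :: "'a set \<Rightarrow> ('a word \<times> 'a word) set \<Rightarrow> ('a word \<times> 'a word) set"
  for X :: "'a set" and R :: "('a word \<times> 'a word) set"
where
  refl: "w \<in> words X \<Longrightarrow> (w, w) \<in> word_rel X R"
| sym: "(u, v) \<in> word_rel X R \<Longrightarrow> (v, u) \<in> word_rel X R"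
| trans: "(u, v) \<in> word_rel X R \<Longrightarrow> (v, w) \<in> word_rel X R \<Longrightarrow> (u, w) \<in> word_rel X R"
| append: "(u, v) \<in> word_rel X R \<Longrightarrow> (u', v') \<in> word_rel X R \<Longrightarrow> (u @ u', v @ v') \<in> word_rel X R"
| cancel: "x \<in> X \<Longrightarrow> ([(x, b), (x, \<not> b)], []) \<in> word_rel X R"
| relator: "(u, v) \<in> R \<Longrightarrow> u \<in> words X \<Longrightarrow> v \<in> words X \<Longrightarrow> (u, v) \<in> word_rel X R"

definition presented_group :: "'a set \<Rightarrow> ('a word \<times> 'a word) set \<Rightarrow> 'a word set monoid"
  where "presented_group X R =
    \<lparr>carrier = words X // word_rel X R,
     monoid.mult = (\<lambda>A B. \<Union>u\<in>A. \<Union>v\<in>B. word_rel X R `` {u @ v}),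
     one = word_rel X R `` {[]}\<rparr>"

lemma word_rel_words: "(u, v) \<in> word_rel X R \<Longrightarrow> u \<in> words X \<and> v \<in> words X"
  by (induction rule: word_rel.induct) (auto simp: words_def)

lemma equiv_word_rel: "equiv (words X) (word_rel X R)"
  by (auto simp: equiv_def refl_on_def sym_def trans_def dest: word_rel_words
      intro: word_rel.refl word_rel.sym word_rel.trans)

lemma presented_group_mult:
  assumes "u \<in> words X" "v \<in> words X"
  shows "monoid.mult (presented_group X R) (word_rel X R `` {u}) (word_rel X R `` {v})
    = word_rel X R `` {u @ v}"
proof -
  have "word_rel X R `` {a @ b} = word_rel X R `` {u @ v}"
    if "(u, a) \<in> word_rel X R" "(v, b) \<in> word_rel X R" for a b
    using word_rel.append[OF that] equiv_class_eq[OF equiv_word_rel] by blast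
  then have "(\<Union>a\<in>word_rel X R `` {u}. \<Union>b\<in>word_rel X R `` {v}. word_rel X R `` {a @ b}) =
      (\<Union>a\<in>word_rel X R `` {u}. \<Union>b\<in>word_rel X R `` {v}. word_rel X R `` {u @ v})"
    by simp
  also have "\<dots> = word_rel X R `` {u @ v}"
    using assms[THEN word_rel.refl, of R] by blast
  finally show ?thesis
    by (simp add: presented_group_def)
qed

lemma words_append: "u \<in> words X \<Longrightarrow> v \<in> words X \<Longrightarrow> u @ v \<in> words X"
  by (auto simp: words_def)

lemma words_Nil: "[] \<in> words X"
  by (auto simp: words_def)

lemma word_rel_inverse:
  "w \<in> words X \<Longrightarrow>
    \<exists>v \<in> words X. (v @ w, []) \<in> word_rel X R"
proof (induction w)
  case Nil
  then show ?case by (auto intro!: bexI[of _ "[]"] word_rel.refl simp: words_def)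
next
  case (Cons l w)
  obtain x b where l: "l = (x, b)" by (cases l)
  have x: "x \<in> X" and w: "w \<in> words X" using Cons.prems by (auto simp: l words_def)
  from Cons.IH[OF w] obtain v where v: "v \<in> words X" "(v @ w, []) \<in> word_rel X R" by blast
  have c: "([(x, \<not> b), (x, b)], []) \<in> word_rel X R"
    using word_rel.cancel[OF x, of "\<not> b"] by simp
  have "([(x, \<not> b), (x, b)] @ w, [] @ w) \<in> word_rel X R"
    by (rule word_rel.append[OF c word_rel.refl[OF w]])
  from word_rel.append[OF word_rel.refl[OF v(1)] this]
  have "((v @ [(x, \<not> b)]) @ l # w, v @ w) \<in> word_rel X R" by (simp add: l)
  from word_rel.trans[OF this v(2)] show ?case
    using v(1) x by (intro bexI[of _ "v @ [(x, \<not> b)]"]) (auto simp: words_def)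
qed

lemma group_presented_group: "group (presented_group X R)"
proof (rule groupI)
  have car: "carrier (presented_group X R) = (\<lambda>u. word_rel X R `` {u}) ` words X"
    by (auto simp: presented_group_def quotient_def)
  have one: "one (presented_group X R) = word_rel X R `` {[]}"
    by (simp add: presented_group_def)
  show "one (presented_group X R) \<in> carrier (presented_group X R)"
    by (auto simp: car one words_Nil)
  fix a assume "a \<in> carrier (presented_group X R)"
  then obtain u where u: "u \<in> words X" "a = word_rel X R `` {u}" by (auto simp: car)
  show "monoid.mult (presented_group X R) (one (presented_group X R)) a = a"
    by (simp add: one u presented_group_mult words_Nil)
  obtain v where v: "v \<in> words X" "(v @ u, []) \<in> word_rel X R"
    using word_rel_inverse[OF u(1)] by blast
  have "word_rel X R `` {v @ u} = word_rel X R `` {[]}"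
    using equiv_class_eq[OF equiv_word_rel v(2)] .
  then show "\<exists>b\<in>carrier (presented_group X R).
      monoid.mult (presented_group X R) b a = one (presented_group X R)"
    using v(1) u by (intro bexI[of _ "word_rel X R `` {v}"]) (simp_all add: car one presented_group_mult)
  fix b assume "b \<in> carrier (presented_group X R)"
  then obtain w where w: "w \<in> words X" "b = word_rel X R `` {w}" by (auto simp: car)
  show "monoid.mult (presented_group X R) a b \<in> carrier (presented_group X R)"
    using u w by (auto simp: presented_group_mult car words_append)
  fix c assume "c \<in> carrier (presented_group X R)"
  then obtain z where z: "z \<in> words X" "c = word_rel X R `` {z}" by (auto simp: car)
  show "monoid.mult (presented_group X R) (monoid.mult (presented_group X R) a b) c =
      monoid.mult (presented_group X R) a (monoid.mult (presented_group X R) b c)"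
    using u w z by (simp add: presented_group_mult words_append)
qed

definition free_group :: "nat \<Rightarrow> nat word set monoid"
  where "free_group n = presented_group {..<n} {}"

text \<open>
  Artin's presentation, with generators \<open>\<sigma>\<^sub>0, \<dots>, \<sigma>\<^sub>n\<^sub>-\<^sub>2\<close>.
\<close>

definition braid_relations :: "nat \<Rightarrow> (nat word \<times> nat word) set"
  where "braid_relations n =
    {([(i, True), (j, True)], [(j, True), (i, True)]) | i j. i + 2 \<le> j \<and> j < n - 1} \<union>
    {([(i, True), (i + 1, True), (i, True)], [(i + 1, True), (i, True), (i + 1, True)]) | i.
      i + 1 < n - 1}"

definition braid_group :: "nat \<Rightarrow> nat word set monoid"
  where "braid_group n = presented_group {..<n - 1} (braid_relations n)"


section \<open>Rational functions and Cremona groups\<close>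

text \<open>
  \<open>'k rat_fun\<close> is the field of rational functions in countably many variables
  \<open>x\<^sub>0, x\<^sub>1, \<dots>\<close>; monomials are finitely supported exponent vectors.  The field
  \<open>k(x\<^sub>0, \<dots>, x\<^sub>r\<^sub>-\<^sub>1)\<close> is the subfield of quotients of polynomials in the first \<open>r\<close> variables,
  which keeps \<open>r\<close> an ordinary natural number.
\<close>

type_synonym 'k mpoly = "(nat \<Rightarrow>\<^sub>0 nat) \<Rightarrow>\<^sub>0 'k"

type_synonym 'k rat_fun = "'k mpoly fract"

definition polys :: "nat \<Rightarrow> 'k::field mpoly set"
  where "polys r = {p. \<forall>m \<in> Poly_Mapping.keys p. Poly_Mapping.keys m \<subseteq> {..<r}}"

definition rat_funs :: "nat \<Rightarrow> 'k::field rat_fun set"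
  where "rat_funs r = {Fract p q | p q. p \<in> polys r \<and> q \<in> polys r \<and> q \<noteq> 0}"

definition rat_const :: "'k::field \<Rightarrow> 'k rat_fun"
  where "rat_const c = Fract (Poly_Mapping.single 0 c) 1"

definition rat_fun_field :: "nat \<Rightarrow> 'k::field rat_fun ring"
  where "rat_fun_field r =
    \<lparr>carrier = rat_funs r, monoid.mult = (*), one = 1, zero = 0, add = (+)\<rparr>"

text \<open>
  \<open>Bij\<close> makes automorphisms extensional, so that each automorphism of
  \<open>k(x\<^sub>0, \<dots>, x\<^sub>r\<^sub>-\<^sub>1)\<close> is represented by exactly one function on \<open>'k rat_fun\<close>.
\<close>

definition cremona_auts :: "nat \<Rightarrow> ('k::field rat_fun \<Rightarrow> 'k rat_fun) set"
  where "cremona_auts r =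
    {f \<in> ring_hom (rat_fun_field r) (rat_fun_field r) \<inter> Bij (rat_funs r).
      \<forall>c. f (rat_const c) = rat_const c}"

definition cremona_group :: "nat \<Rightarrow> ('k::field rat_fun \<Rightarrow> 'k rat_fun) monoid"
  where "cremona_group r = BijGroup (rat_funs r) \<lparr>carrier := cremona_auts r\<rparr>"

lemma mult_polys: "p \<in> polys r \<Longrightarrow> q \<in> polys r \<Longrightarrow> p * q \<in> polys r"
proof -
  assume a: "p \<in> polys r" "q \<in> polys r"
  have "Poly_Mapping.keys m \<subseteq> {..<r}" if m: "m \<in> Poly_Mapping.keys (p * q)" for m
  proof -
    obtain s t where st: "m = s + t" "s \<in> Poly_Mapping.keys p" "t \<in> Poly_Mapping.keys q"
      using keys_mult[of p q] m by auto
    show ?thesis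
      using a st Poly_Mapping.keys_add[of s t] unfolding polys_def by fast
  qed
  then show ?thesis by (simp add: polys_def)
qed

lemma add_polys: "p \<in> polys r \<Longrightarrow> q \<in> polys r \<Longrightarrow> p + q \<in> polys r"
  using Poly_Mapping.keys_add[of p q] unfolding polys_def by blast

lemma uminus_polys: "p \<in> polys r \<Longrightarrow> - p \<in> polys r"
  unfolding polys_def by simp

lemma single_polys: "Poly_Mapping.single 0 c \<in> polys r"
  by (simp add: polys_def)

lemma zero_polys: "0 \<in> polys r"
  by (simp add: polys_def)

lemma one_polys: "1 \<in> polys r"
  using single_polys[of 1 r] by simp

lemma Fract_rat_funs:
  "p \<in> polys r \<Longrightarrow> q \<in> polys r \<Longrightarrow> q \<noteq> 0 \<Longrightarrow> Fract p q \<in> rat_funs r"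
  unfolding rat_funs_def by blast

lemma rat_funs_closed:
  assumes "f \<in> rat_funs r" "g \<in> rat_funs r"
  shows "f * g \<in> rat_funs r" "f + g \<in> rat_funs r" "- f \<in> rat_funs r" "inverse f \<in> rat_funs r"
proof -
  obtain p q p' q' where *: "f = Fract p q" "g = Fract p' q'" "p \<in> polys r" "q \<in> polys r"
    "p' \<in> polys r" "q' \<in> polys r" "q \<noteq> 0" "q' \<noteq> 0"
    using assms unfolding rat_funs_def by blast
  have "f * g = Fract (p * p') (q * q')" using * by simp
  then show "f * g \<in> rat_funs r"
    using * by (simp add: Fract_rat_funs mult_polys)
  have "f + g = Fract (p * q' + p' * q) (q * q')" using * by simp
  moreover have "p * q' + p' * q \<in> polys r" "q * q' \<in> polys r" "q * q' \<noteq> 0"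
    using * by (simp_all add: mult_polys add_polys)
  ultimately show "f + g \<in> rat_funs r"
    using Fract_rat_funs by metis
  have "- f = Fract (- p) q" using * by simp
  then show "- f \<in> rat_funs r"
    using * by (simp add: Fract_rat_funs uminus_polys)
  show "inverse f \<in> rat_funs r"
  proof (cases "p = 0")
    case True
    then have "inverse f = Fract 0 1" using * by (simp add: Zero_fract_def[symmetric] eq_fract)
    then show ?thesis by (simp add: Fract_rat_funs zero_polys one_polys)
  next
    case False
    then have "inverse f = Fract q p" using * by simp
    then show ?thesis using * False by (simp add: Fract_rat_funs)
  qed
qed

lemma rat_const_rat_funs: "rat_const c \<in> rat_funs r"
  by (simp add: rat_const_def Fract_rat_funs single_polys one_polys)

lemma one_rat_funs: "1 \<in> rat_funs r"
  by (simp add: One_fract_def Fract_rat_funs one_polys)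

lemma zero_rat_funs: "0 \<in> rat_funs r"
  by (simp add: Zero_fract_def Fract_rat_funs one_polys zero_polys)

lemma field_rat_fun_field: "field (rat_fun_field r :: 'k::field rat_fun ring)"
proof -
  have "cring (rat_fun_field r :: 'k rat_fun ring)"
    unfolding rat_fun_field_def
  proof (intro cringI abelian_groupI comm_monoidI, goal_cases)
    case (6 x)
    then show ?case using rat_funs_closed(3)[of x r] by (auto intro!: bexI[of _ "- x"])
  qed (simp_all add: rat_funs_closed one_rat_funs zero_rat_funs algebra_simps)
  then interpret cring "rat_fun_field r :: 'k rat_fun ring" .
  show ?thesis
  proof (rule cring_fieldI2)
    show "\<zero>\<^bsub>rat_fun_field r\<^esub> \<noteq> (\<one>\<^bsub>rat_fun_field r\<^esub> :: 'k rat_fun)"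
      by (simp add: rat_fun_field_def)
  next
    fix a :: "'k rat_fun" assume "a \<in> carrier (rat_fun_field r)" "a \<noteq> \<zero>\<^bsub>rat_fun_field r\<^esub>"
    then show "\<exists>b\<in>carrier (rat_fun_field r). a \<otimes>\<^bsub>rat_fun_field r\<^esub> b = \<one>\<^bsub>rat_fun_field r\<^esub>"
      by (intro bexI[of _ "inverse a"]) (auto simp: rat_fun_field_def rat_funs_closed)
  qed
qed

lemma subgroup_cremona_auts:
  "subgroup (cremona_auts r) (BijGroup (rat_funs r :: 'k::field rat_fun set))"
proof (rule group.subgroupI[OF group_BijGroup])
  show "cremona_auts r \<subseteq> carrier (BijGroup (rat_funs r :: 'k rat_fun set))"
    by (auto simp: cremona_auts_def BijGroup_def)
  have "(\<lambda>x\<in>rat_funs r. x) \<in> (cremona_auts r :: ('k rat_fun \<Rightarrow> 'k rat_fun) set)"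
    by (auto simp: cremona_auts_def id_Bij ring_hom_def rat_fun_field_def rat_funs_closed
        one_rat_funs rat_const_rat_funs)
  then show "cremona_auts r \<noteq> ({} :: ('k rat_fun \<Rightarrow> 'k rat_fun) set)" by blast
next
  fix f :: "'k rat_fun \<Rightarrow> 'k rat_fun" assume f: "f \<in> cremona_auts r"
  then have B: "f \<in> Bij (rat_funs r)" by (simp add: cremona_auts_def)
  let ?g = "\<lambda>x\<in>rat_funs r. inv_into (rat_funs r) f x"
  have gB: "?g \<in> Bij (rat_funs r)" by (rule restrict_inv_into_Bij[OF B])
  have gf: "inv_into (rat_funs r) f (f x) = x" if "x \<in> rat_funs r" for x
    using B that by (simp add: Bij_def bij_betw_def)
  have ex: "\<exists>y\<in>rat_funs r. x = f y" if "x \<in> rat_funs r" for x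
    using B that by (auto simp: Bij_def bij_betw_def)
  have fm: "f x \<in> rat_funs r" if "x \<in> rat_funs r" for x
    using Bij_imp_funcset[OF B] that by blast
  have h: "f (x * y) = f x * f y" "f (x + y) = f x + f y" "f 1 = 1"
    if "x \<in> rat_funs r" "y \<in> rat_funs r" for x y
    using f that by (auto simp: cremona_auts_def ring_hom_def rat_fun_field_def)
  have "inv_into (rat_funs r) f (x * y) = inv_into (rat_funs r) f x * inv_into (rat_funs r) f y"
    "inv_into (rat_funs r) f (x + y) = inv_into (rat_funs r) f x + inv_into (rat_funs r) f y"
    if "x \<in> rat_funs r" "y \<in> rat_funs r" for x y
    using ex[OF that(1)] ex[OF that(2)] by (auto simp: h(1,2)[symmetric] gf rat_funs_closed)
  moreover have "inv_into (rat_funs r) f 1 = 1"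
    using gf[OF one_rat_funs] h(3)[OF one_rat_funs one_rat_funs] by simp
  moreover have "inv_into (rat_funs r) f (rat_const c) = rat_const c" for c
    using gf[OF rat_const_rat_funs[of c]] f by (simp add: cremona_auts_def)
  ultimately have "?g \<in> cremona_auts r"
    using gB Bij_imp_funcset[OF gB]
    by (auto simp: cremona_auts_def ring_hom_def rat_fun_field_def rat_funs_closed
        one_rat_funs rat_const_rat_funs Bij_inv_into_mem[OF B])
  then show "inv\<^bsub>BijGroup (rat_funs r)\<^esub> f \<in> cremona_auts r"
    by (simp add: inv_BijGroup[OF B])
next
  fix f g :: "'k rat_fun \<Rightarrow> 'k rat_fun"
  assume fg: "f \<in> cremona_auts r" "g \<in> cremona_auts r"
  then have B: "f \<in> Bij (rat_funs r)" "g \<in> Bij (rat_funs r)" by (auto simp: cremona_auts_def)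
  have m: "f x \<in> rat_funs r" "g x \<in> rat_funs r" if "x \<in> rat_funs r" for x
    using B[THEN Bij_imp_funcset] that by blast+
  show "f \<otimes>\<^bsub>BijGroup (rat_funs r)\<^esub> g \<in> cremona_auts r"
    using fg B m
    by (auto simp: BijGroup_def cremona_auts_def ring_hom_def rat_fun_field_def
        compose_Bij compose_eq rat_funs_closed one_rat_funs rat_const_rat_funs)
qed

lemma group_cremona_group: "group (cremona_group r :: ('k::field rat_fun \<Rightarrow> 'k rat_fun) monoid)"
  unfolding cremona_group_def
  by (rule subgroup.subgroup_is_group[OF subgroup_cremona_auts group_BijGroup])


definition contains_group :: "('a, 'c) monoid_scheme \<Rightarrow> ('b, 'd) monoid_scheme \<Rightarrow> bool"
  where "contains_group A B \<longleftrightarrow> (\<exists>f. f \<in> mon B A)"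

end

theory Submission
  imports Defs "HOL-Algebra.Generated_Groups"
begin

text \<open>
  An automorphism \<open>\<alpha>\<close> of \<open>F\<^sub>n\<close> acts on \<open>n\<close>-tuples
  \<open>(X\<^sub>0, \<dots>, X\<^sub>n\<^sub>-\<^sub>1)\<close> of matrices in \<open>SL\<^sub>2\<close> by evaluating the words \<open>\<alpha>(x\<^sub>0), \<dots>, \<alpha>(x\<^sub>n\<^sub>-\<^sub>1)\<close> at
  the tuple.  The action commutes with simultaneous conjugation, so it descends to the quotient, of
  dimension \<open>3n - 1\<close>, by the one-dimensional group \<open>U\<close> of upper unitriangular matrices.  This
  quotient is rational: write \<open>a, b, c, d\<close> for the entries of a matrix, row by row.  Conjugation by
  \<open>U\<close> fixes \<open>c\<close> and moves \<open>d\<close> by multiples of \<open>c\<close>, so a generic tuple has exactly one conjugate with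
  \<open>d\<^sub>0 = 0\<close>, and on these representatives \<open>c\<^sub>i\<close>, \<open>a\<^sub>i\<close> (for all \<open>i\<close>) and \<open>d\<^sub>i\<close> (for \<open>i \<ge> 1\<close>) are
  independent coordinates, with \<open>b\<^sub>i = (a\<^sub>i d\<^sub>i - 1) / c\<^sub>i\<close>.  In these coordinates \<open>\<alpha>\<close> becomes a
  substitution of rational functions for the variables (\<open>moved_coord\<close>), substitutions compose like
  automorphisms (\<open>has_value_moved_poly\<close>), and further variables are left fixed.

  The action on the quotient is faithful because the entry \<open>c\<close> is \<open>U\<close>-invariant: if \<open>\<alpha>\<close> acts
  trivially, then the matrix of the word \<open>\<alpha>(x\<^sub>i)\<close> has lower left entry \<open>c\<^sub>i\<close>.  At a suitable integer
  point a ping-pong argument bounds the lower left entry of a reduced word \<open>w\<close> below by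
  \<open>2\<^bsup>|w| - 1\<^esup>\<close> in absolute value (\<open>ping_pong_word\<close>), whereas \<open>c\<^sub>i\<close> takes the value \<open>1\<close> there; so
  \<open>\<alpha>(x\<^sub>i)\<close> is a single letter, and then it is \<open>x\<^sub>i\<close> (\<open>generic_entry_determines\<close>).  The same bound
  shows that the denominators in the substitutions do not vanish (\<open>generic_entry_nonzero\<close>).

  For the braid group it remains to embed \<open>B\<^sub>n\<close> into \<open>Aut(F\<^sub>n)\<close>.  Artin's representation comes from the
  Hurwitz action on tuples in an arbitrary group, where \<open>\<sigma>\<^sub>k\<close> replaces \<open>(g\<^sub>k, g\<^sub>k\<^sub>+\<^sub>1)\<close> by
  \<open>(g\<^sub>k\<^sub>+\<^sub>1, g\<^sub>k\<^sub>+\<^sub>1\<inverse> g\<^sub>k g\<^sub>k\<^sub>+\<^sub>1)\<close>; a braid that fixes the tuple of free generators fixes all tuples in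
  all groups.  That such a braid is trivial (\<open>hurwitz_faithful\<close>) is shown by induction on \<open>n\<close>.  Every
  braid is a product \<open>u v s\<^sub>j\<close>, where \<open>u\<close> is a word in the pure braids \<open>a\<^sub>i\<close> that take the last strand
  once around strand \<open>i\<close>, \<open>v\<close> is a braid on the other strands and \<open>s\<^sub>j\<close> moves the last strand to place
  \<open>j\<close> (\<open>normal_form\<close>).  Three families of tuples in \<open>\<int>\<^sup>2 \<rtimes> SL\<^sub>2(\<int>)\<close> then separate the three factors:
  \<^item> tuples \<open>(z, \<dots>, z, 1)\<close> are fixed by \<open>u\<close> and \<open>v\<close> and show that \<open>s\<^sub>j = 1\<close>;
  \<^item> tuples with last entry \<open>1\<close> are fixed by \<open>u\<close>, so \<open>v\<close> is trivial by the induction hypothesis;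
  \<^item> if the last entry is a translation, then \<open>u\<close> applies to it the inverse of the word \<open>u\<close> in the
    linear parts of the other entries, and when these are ping-pong matrices, only the empty reduced
    word fixes the first basis vector.
\<close>

section \<open>Evaluating words in groups\<close>

fun word_val :: "('g, 'm) monoid_scheme \<Rightarrow> ('a \<Rightarrow> 'g) \<Rightarrow> 'a word \<Rightarrow> 'g"
  where
    "word_val G f [] = \<one>\<^bsub>G\<^esub>"
  | "word_val G f ((x, b) # w) = (if b then f x else inv\<^bsub>G\<^esub> f x) \<otimes>\<^bsub>G\<^esub> word_val G f w"

fun word_inv :: "'a word \<Rightarrow> 'a word"
  where
    "word_inv [] = []"
  | "word_inv ((x, b) # w) = word_inv w @ [(x, \<not> b)]"

fun word_subst :: "('a \<Rightarrow> 'b word) \<Rightarrow> 'a word \<Rightarrow> 'b word"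
  where
    "word_subst s [] = []"
  | "word_subst s ((x, b) # w) = (if b then s x else word_inv (s x)) @ word_subst s w"

definition reduced :: "'a word \<Rightarrow> bool"
  where "reduced = successively (\<lambda>(x, b) (y, c). \<not> (x = y \<and> b \<noteq> c))"

definition lift_val :: "('g, 'm) monoid_scheme \<Rightarrow> ('a \<Rightarrow> 'g) \<Rightarrow> 'a word set \<Rightarrow> 'g"
  where "lift_val G f C = the_elem (word_val G f ` C)"

lemma word_inv_words: "w \<in> words X \<Longrightarrow> word_inv w \<in> words X"
  by (induction w rule: word_inv.induct) (auto simp: words_def)

lemma word_inv_append: "word_inv (u @ v) = word_inv v @ word_inv u"
  by (induction u rule: word_inv.induct) auto

lemma word_inv_inv: "word_inv (word_inv w) = w"
  by (induction w rule: word_inv.induct) (auto simp: word_inv_append)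

lemma word_subst_words:
  "w \<in> words X \<Longrightarrow> (\<And>x. x \<in> X \<Longrightarrow> s x \<in> words Y) \<Longrightarrow> word_subst s w \<in> words Y"
proof (induction s w rule: word_subst.induct)
  case (2 s x b w)
  have "x \<in> X" "w \<in> words X" using 2(2) by (auto simp: words_def)
  then show ?case using 2(1)[OF _ 2(3)] 2(3) by (auto intro!: words_append word_inv_words)
qed (simp add: words_Nil)

lemma words_Cons [simp]: "(x, b) # w \<in> words X \<longleftrightarrow> x \<in> X \<and> w \<in> words X"
  by (auto simp: words_def)

lemma words_append_iff: "u @ v \<in> words X \<longleftrightarrow> u \<in> words X \<and> v \<in> words X"
  by (auto simp: words_def)

lemma words_mono: "X \<subseteq> Y \<Longrightarrow> w \<in> words X \<Longrightarrow> w \<in> words Y"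
  by (auto simp: words_def in_lists_conv_set)

context group
begin

lemma word_val_closed:
  "w \<in> words X \<Longrightarrow> f \<in> X \<rightarrow> carrier G \<Longrightarrow> word_val G f w \<in> carrier G"
  by (induction w rule: word_inv.induct) (auto simp: Pi_iff)

lemma word_val_append:
  "u \<in> words X \<Longrightarrow> v \<in> words X \<Longrightarrow> f \<in> X \<rightarrow> carrier G \<Longrightarrow>
    word_val G f (u @ v) = word_val G f u \<otimes> word_val G f v"
proof (induction u rule: word_inv.induct)
  case (2 x b w)
  then show ?case using word_val_closed[of w X f] word_val_closed[of v X f]
    by (auto simp: m_assoc Pi_iff)
qed (simp add: word_val_closed)

lemma word_val_rel:
  assumes f: "f \<in> X \<rightarrow> carrier G"
    and R: "\<And>u v. (u, v) \<in> R \<Longrightarrow> u \<in> words X \<Longrightarrow> v \<in> words X \<Longrightarrow> word_val G f u = word_val G f v"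
    and "(u, v) \<in> word_rel X R"
  shows "word_val G f u = word_val G f v"
  using assms(3)
proof (induction rule: word_rel.induct)
  case (append u v u' v')
  then show ?case
    using word_rel_words[OF append(1)] word_rel_words[OF append(2)] f
    by (simp add: word_val_append[of _ X] append.IH)
next
  case (cancel x b)
  then have "f x \<in> carrier G" using f by auto
  then show ?case by auto
qed (use R in auto)

lemma lift_val_class:
  assumes f: "f \<in> X \<rightarrow> carrier G"
    and R: "\<And>u v. (u, v) \<in> R \<Longrightarrow> u \<in> words X \<Longrightarrow> v \<in> words X \<Longrightarrow> word_val G f u = word_val G f v"
    and w: "w \<in> words X"
  shows "lift_val G f (word_rel X R `` {w}) = word_val G f w"
proof -
  have "word_val G f v = word_val G f w" if "v \<in> word_rel X R `` {w}" for v
    using word_val_rel[OF f R] that by (metis Image_singleton_iff)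
  then have "word_val G f ` (word_rel X R `` {w}) = (\<lambda>_. word_val G f w) ` (word_rel X R `` {w})"
    by (rule image_cong[OF HOL.refl])
  also have "\<dots> = {word_val G f w}"
    using equiv_class_self[OF equiv_word_rel w] by (rule image_constant)
  finally have "word_val G f ` (word_rel X R `` {w}) = {word_val G f w}" .
  then show ?thesis by (simp add: lift_val_def)
qed

end

lemma word_val_hom:
  assumes "group G" "group H" "h \<in> hom G H" "f \<in> X \<rightarrow> carrier G" "w \<in> words X"
  shows "word_val H (\<lambda>x. h (f x)) w = h (word_val G f w)"
proof -
  interpret group_hom G H h using assms by (simp add: group_hom_def group_hom_axioms_def)
  show ?thesis using assms(5)
  proof (induction w rule: word_inv.induct)
    case (2 x b w)
    then have "f x \<in> carrier G" "word_val G f w \<in> carrier G"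
      using assms(4) by (auto intro: G.word_val_closed)
    then show ?case using 2 by auto
  qed simp
qed

lemma carrier_presented_group:
  "carrier (presented_group X R) = (\<lambda>w. word_rel X R `` {w}) ` words X"
  by (auto simp: presented_group_def quotient_def)

lemma one_presented_group: "\<one>\<^bsub>presented_group X R\<^esub> = word_rel X R `` {[]}"
  by (simp add: presented_group_def)

lemma presented_groupE:
  assumes "C \<in> carrier (presented_group X R)"
  obtains w where "w \<in> words X" "C = word_rel X R `` {w}"
  using assms by (auto simp: carrier_presented_group)

lemma class_eq_iff:
  "u \<in> words X \<Longrightarrow> v \<in> words X \<Longrightarrow>
    word_rel X R `` {u} = word_rel X R `` {v} \<longleftrightarrow> (u, v) \<in> word_rel X R"
  by (rule eq_equiv_class_iff[OF equiv_word_rel])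

lemma class_in_carrier: "w \<in> words X \<Longrightarrow> word_rel X R `` {w} \<in> carrier (presented_group X R)"
  by (auto simp: carrier_presented_group)

lemma word_inv_cancel:
  "w \<in> words X \<Longrightarrow> (w @ word_inv w, []) \<in> word_rel X R"
proof (induction w rule: word_inv.induct)
  case 1 then show ?case by (auto intro: word_rel.refl simp: words_Nil)
next
  case (2 x b w)
  then have x: "x \<in> X" and w: "w \<in> words X" by auto
  have r: "(v, v) \<in> word_rel X R" if "v \<in> words X" for v
    using that by (rule word_rel.refl)
  have "([(x,b)] @ ((w @ word_inv w) @ [(x, \<not> b)]), [(x,b)] @ ([] @ [(x, \<not> b)])) \<in> word_rel X R"
    by (intro word_rel.append 2(1) r) (use x w in \<open>auto simp: words_Nil\<close>)
  moreover have "([(x,b)] @ ([] @ [(x, \<not> b)]), []) \<in> word_rel X R"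
    using word_rel.cancel[OF x] by simp
  ultimately show ?case using word_rel.trans by fastforce
qed

lemma class_word_inv:
  assumes "w \<in> words X"
  shows "word_rel X R `` {word_inv w} = inv\<^bsub>presented_group X R\<^esub> (word_rel X R `` {w})"
proof -
  interpret group "presented_group X R" by (rule group_presented_group)
  have "word_rel X R `` {w} \<otimes>\<^bsub>presented_group X R\<^esub> word_rel X R `` {word_inv w} = \<one>\<^bsub>presented_group X R\<^esub>"
    using word_inv_cancel[OF assms, of R] assms
    by (simp add: presented_group_mult one_presented_group word_inv_words class_eq_iff words_append words_Nil)
  then show ?thesis
    using assms by (metis class_in_carrier word_inv_words inv_equality inv_comm)
qed

lemma word_val_class:
  assumes "u \<in> words Y" "\<And>y. y \<in> Y \<Longrightarrow> s y \<in> words X"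
  shows "word_val (presented_group X R) (\<lambda>y. word_rel X R `` {s y}) u
    = word_rel X R `` {word_subst s u}"
  using assms(1)
proof (induction u rule: word_inv.induct)
  case (2 x b w)
  have "s x \<in> words X" "word_subst s w \<in> words X"
    using 2(2) assms(2) by (auto intro: word_subst_words)
  then show ?case using 2
    by (auto simp: presented_group_mult word_inv_words simp flip: class_word_inv)
qed (simp add: one_presented_group)

lemma word_subst_letters: "word_subst (\<lambda>x. [(x, True)]) w = w"
  by (induction w rule: word_inv.induct) auto

lemma word_val_generators:
  assumes "w \<in> words X"
  shows "word_val (presented_group X R) (\<lambda>x. word_rel X R `` {[(x, True)]}) w = word_rel X R `` {w}"
  using word_val_class[OF assms, of "\<lambda>x. [(x, True)]" X R] by (simp add: word_subst_letters words_Nil)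

text \<open>
  A word of minimal length with the property is reduced, since cancelling an adjacent inverse pair
  would shorten it.  Uniqueness of reduced representatives is a consequence of ping-pong, not a
  prerequisite for it.
\<close>

lemma exists_reduced:
  assumes P: "P w" and w: "w \<in> words X"
    and cancel: "\<And>u x b v. P (u @ (x, b) # (x, \<not> b) # v) \<Longrightarrow> u \<in> words X \<Longrightarrow> v \<in> words X \<Longrightarrow> x \<in> X \<Longrightarrow> P (u @ v)"
  shows "\<exists>v \<in> words X. P v \<and> reduced v"
proof -
  have nr: "\<exists>u x b z. v = u @ (x, b) # (x, \<not> b) # z" if "\<not> reduced v" for v :: "'a word"
    using that
  proof (induction v rule: induct_list012)
    case (3 l m zs)
    obtain x b y c where lm: "l = (x, b)" "m = (y, c)" by (cases l, cases m) auto
    show ?case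
    proof (cases "x = y \<and> b \<noteq> c")
      case True
      then have "l # m # zs = [] @ (x, b) # (x, \<not> b) # zs" by (auto simp: lm)
      then show ?thesis by blast
    next
      case False
      then have "\<not> reduced (m # zs)" using 3(3) by (auto simp: reduced_def lm)
      with 3(2) obtain u x b z where "m # zs = u @ (x, b) # (x, \<not> b) # z" by blast
      then have "l # m # zs = (l # u) @ (x, b) # (x, \<not> b) # z" by simp
      then show ?thesis by blast
    qed
  qed (auto simp: reduced_def)
  from P w show ?thesis
  proof (induction w rule: length_induct)
    case (1 w)
    show ?case
    proof (cases "reduced w")
      case False
      then obtain u x b z where e: "w = u @ (x, b) # (x, \<not> b) # z" using nr by blast
      then have "u \<in> words X" "z \<in> words X" "x \<in> X" using 1(3) by (auto simp: words_append_iff)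
      then show ?thesis using 1(1)[rule_format, of "u @ z"] cancel 1(2) e
        by (auto simp: words_append_iff)
    qed (use 1 in auto)
  qed
qed

lemma free_class_reduced:
  assumes "C \<in> carrier (presented_group X {})"
  obtains w where "w \<in> words X" "C = word_rel X {} `` {w}" "reduced w"
proof -
  obtain w where w: "w \<in> words X" "C = word_rel X {} `` {w}" using assms by (rule presented_groupE)
  have "\<exists>v \<in> words X. C = word_rel X {} `` {v} \<and> reduced v"
  proof (rule exists_reduced[where P = "\<lambda>v. C = word_rel X {} `` {v}", OF w(2) w(1)])
    fix u x b v assume e: "C = word_rel X {} `` {u @ (x, b) # (x, \<not> b) # v}"
      and m: "u \<in> words X" "v \<in> words X" "x \<in> X"
    have "(u @ [(x, b), (x, \<not> b)] @ v, u @ [] @ v) \<in> word_rel X {}"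
      by (intro word_rel.append word_rel.refl word_rel.cancel m)
    then show "C = word_rel X {} `` {u @ v}" using e m
      by (auto simp: class_eq_iff words_append_iff)
  qed
  then show ?thesis using that by blast
qed

lemma (in group) lift_val_hom:
  assumes f: "f \<in> X \<rightarrow> carrier G"
    and R: "\<And>u v. (u, v) \<in> R \<Longrightarrow> u \<in> words X \<Longrightarrow> v \<in> words X \<Longrightarrow> word_val G f u = word_val G f v"
  shows "lift_val G f \<in> hom (presented_group X R) G"
proof (rule homI)
  note lift = lift_val_class[OF f R]
  fix C D assume "C \<in> carrier (presented_group X R)" "D \<in> carrier (presented_group X R)"
  then obtain u v where *: "u \<in> words X" "C = word_rel X R `` {u}"
    "v \<in> words X" "D = word_rel X R `` {v}"
    by (metis presented_groupE)
  show "lift_val G f C \<in> carrier G"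
    using lift[OF _ _ _ *(1)] word_val_closed[OF *(1) f] by (simp add: *(2))
  show "lift_val G f (C \<otimes>\<^bsub>presented_group X R\<^esub> D) = lift_val G f C \<otimes> lift_val G f D"
    using lift[OF _ _ _ *(1)] lift[OF _ _ _ *(3)] lift[OF _ _ _ words_append[OF *(1,3)]]
    by (simp add: *(2,4) presented_group_mult[OF *(1,3)] word_val_append[OF *(1,3) f])
qed

section \<open>Words in \<open>SL\<^sub>2\<close>\<close>

datatype 'a mat2 = Mat2 (e11: 'a) (e12: 'a) (e21: 'a) (e22: 'a)

definition mat2_det :: "'a::comm_ring_1 mat2 \<Rightarrow> 'a"
  where "mat2_det M = e11 M * e22 M - e12 M * e21 M"

definition mat2_mult :: "'a::comm_ring_1 mat2 \<Rightarrow> 'a mat2 \<Rightarrow> 'a mat2"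
  where "mat2_mult M N =
    Mat2 (e11 M * e11 N + e12 M * e21 N) (e11 M * e12 N + e12 M * e22 N)
      (e21 M * e11 N + e22 M * e21 N) (e21 M * e12 N + e22 M * e22 N)"

definition SL2 :: "'a::comm_ring_1 mat2 monoid"
  where "SL2 = \<lparr>carrier = {M. mat2_det M = 1}, monoid.mult = mat2_mult, one = Mat2 1 0 0 1\<rparr>"

definition mat2_adj :: "'a::comm_ring_1 mat2 \<Rightarrow> 'a mat2"
  where "mat2_adj M = Mat2 (e22 M) (- e12 M) (- e21 M) (e11 M)"

lemma SL2_simps [simp]:
  "M \<in> carrier SL2 \<longleftrightarrow> mat2_det M = 1"
  "monoid.mult SL2 = mat2_mult"
  "one SL2 = Mat2 1 0 0 1"
  by (simp_all add: SL2_def)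

lemma mat2_adj_mult:
  assumes "mat2_det M = 1"
  shows "mat2_mult (mat2_adj M) M = Mat2 1 0 0 1"
  using assms by (simp add: mat2_mult_def mat2_adj_def mat2_det_def algebra_simps)

lemma mat2_det_mult: "mat2_det (mat2_mult M N) = mat2_det M * mat2_det N"
  by (simp add: mat2_mult_def mat2_det_def algebra_simps)

lemma mat2_det_adj: "mat2_det (mat2_adj M) = mat2_det M"
  by (simp add: mat2_adj_def mat2_det_def algebra_simps)

lemma group_SL2: "group SL2"
proof (rule groupI)
  show "\<one>\<^bsub>SL2\<^esub> \<in> carrier SL2" by (simp add: mat2_det_def)
  fix M :: "'a mat2" assume M: "M \<in> carrier SL2"
  then show "\<one>\<^bsub>SL2\<^esub> \<otimes>\<^bsub>SL2\<^esub> M = M" by (simp add: mat2_mult_def)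
  show "\<exists>N\<in>carrier SL2. N \<otimes>\<^bsub>SL2\<^esub> M = \<one>\<^bsub>SL2\<^esub>"
    using M by (intro bexI[of _ "mat2_adj M"]) (auto simp: mat2_det_adj mat2_adj_mult)
qed (simp_all add: mat2_det_mult, simp add: mat2_mult_def algebra_simps)

interpretation SL2: group "SL2 :: 'a::comm_ring_1 mat2 monoid"
  by (rule group_SL2)

lemma inv_SL2: "mat2_det M = 1 \<Longrightarrow> inv\<^bsub>SL2\<^esub> M = mat2_adj M"
  by (rule SL2.inv_equality) (simp_all add: mat2_adj_mult mat2_det_adj)

text \<open>
  Conjugation by the upper unitriangular matrix with entry \<open>t\<close>, written out.
\<close>

definition shear :: "'a::comm_ring_1 \<Rightarrow> 'a mat2 \<Rightarrow> 'a mat2"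
  where "shear t M = Mat2 (e11 M + t * e21 M)
    (e12 M + t * (e22 M - e11 M) - t * t * e21 M) (e21 M) (e22 M - t * e21 M)"

lemma shear_mult: "shear t (mat2_mult M N) = mat2_mult (shear t M) (shear t N)"
  by (simp add: shear_def mat2_mult_def algebra_simps)

lemma shear_shear: "shear s (shear t M) = shear (s + t) M"
  by (simp add: shear_def algebra_simps)

lemma shear_zero: "shear 0 M = M"
  by (simp add: shear_def)

lemma mat2_det_shear: "mat2_det (shear t M) = mat2_det M"
  by (simp add: shear_def mat2_det_def algebra_simps)

lemma e21_shear: "e21 (shear t M) = e21 M"
  by (simp add: shear_def)

lemma word_val_shear:
  assumes "w \<in> words X" "\<And>x. x \<in> X \<Longrightarrow> mat2_det (f x) = 1"
  shows "word_val SL2 (\<lambda>x. shear t (f x)) w = shear t (word_val SL2 f w)"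
  using assms(1)
proof (induction w rule: word_inv.induct)
  case (2 x b w)
  then have "mat2_det (f x) = 1" using assms(2) by auto
  moreover have "mat2_adj (shear t M) = shear t (mat2_adj M)" for M
    by (simp add: mat2_adj_def shear_def algebra_simps)
  ultimately show ?case using 2 by (simp add: inv_SL2 mat2_det_shear shear_mult)
qed (simp add: shear_def)

text \<open>
  Acting on the projective line, \<open>ping_pong i\<close> is \<open>z \<mapsto> (6i + 3) - 1 / (z - 6i)\<close> and its inverse is
  \<open>z \<mapsto> 6i - 1 / (z - (6i + 3))\<close>.  Each letter therefore has a centre that attracts (its value at
  infinity), and its pole is the centre of the inverse letter.  The centres of distinct letters are at
  distance at least \<open>3\<close>.  The lower right entry of \<open>ping_pong 0\<close> is \<open>0\<close>, so that the tuple of these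
  matrices is one of the chosen representatives modulo conjugation.
\<close>

definition ping_pong :: "nat \<Rightarrow> int mat2"
  where "ping_pong i = Mat2 (6 * int i + 3) (- 6 * int i * (6 * int i + 3) - 1) 1 (- 6 * int i)"

definition attractor :: "nat \<times> bool \<Rightarrow> int"
  where "attractor = (\<lambda>(i, b). 6 * int i + (if b then 3 else 0))"

lemma det_ping_pong: "mat2_det (ping_pong i) = 1"
  by (simp add: mat2_det_def ping_pong_def algebra_simps)

lemma ping_pong_entries:
  "e11 (ping_pong i) = 6 * int i + 3" "e12 (ping_pong i) = - 6 * int i * (6 * int i + 3) - 1"
  "e21 (ping_pong i) = 1" "e22 (ping_pong i) = - 6 * int i"
  by (simp_all add: ping_pong_def)

text \<open>
  A fraction \<open>p / q\<close> within distance \<open>1\<close> of the centre of \<open>m\<close> is at distance at least \<open>2\<close> from the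
  pole of any letter that does not cancel \<open>m\<close>.  Applying that letter hence at least doubles the
  denominator and lands within distance \<open>1\<close> of the letter's own centre.
\<close>

lemma ping_pong_step:
  fixes p q :: int
  assumes "\<bar>p - attractor m * q\<bar> \<le> \<bar>q\<bar>" "m \<noteq> (i, \<not> b)"
    and "p' = e11 M * p + e12 M * q" "q' = e21 M * p + e22 M * q"
    and "M = (if b then ping_pong i else mat2_adj (ping_pong i))"
  shows "\<bar>p' - attractor (i, b) * q'\<bar> \<le> \<bar>q'\<bar>" "2 * \<bar>q\<bar> \<le> \<bar>q'\<bar>"
proof -
  define t where "t = attractor (i, \<not> b)"
  define s where "s = attractor m"
  \<comment> \<open>The pole of the letter is the centre of its inverse, which differs from \<open>m\<close>.\<close>
  have st: "\<bar>s - t\<bar> \<ge> 3"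
    using assms(2) by (cases m) (auto simp: attractor_def s_def t_def split: if_splits; presburger)
  have q': "\<bar>q'\<bar> = \<bar>p - t * q\<bar>"
    unfolding assms(3-5)
    by (cases b) (simp_all add: ping_pong_def mat2_adj_def attractor_def t_def algebra_simps)
  have "p' - attractor (i, b) * q' = (if b then - q else q)"
    unfolding assms(3-5)
    by (cases b) (simp_all add: ping_pong_def mat2_adj_def attractor_def algebra_simps)
  then have "\<bar>p' - attractor (i, b) * q'\<bar> = \<bar>q\<bar>" by simp
  moreover have "3 * \<bar>q\<bar> \<le> \<bar>s - t\<bar> * \<bar>q\<bar>" using st by (rule mult_right_mono) simp
  moreover have "\<bar>s - t\<bar> * \<bar>q\<bar> = \<bar>s * q - t * q\<bar>" by (simp add: abs_mult[symmetric] algebra_simps)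
  ultimately show "\<bar>p' - attractor (i, b) * q'\<bar> \<le> \<bar>q'\<bar>" "2 * \<bar>q\<bar> \<le> \<bar>q'\<bar>"
    using assms(1) q' unfolding s_def[symmetric] by linarith+
qed

text \<open>
  The first column of the matrix of a word is the image of infinity, in homogeneous coordinates.
\<close>

lemma ping_pong_word:
  assumes "reduced (l # w)"
  defines "M \<equiv> word_val SL2 ping_pong (l # w)"
  shows "\<bar>e11 M - attractor l * e21 M\<bar> \<le> \<bar>e21 M\<bar> \<and> 2 ^ length w \<le> \<bar>e21 M\<bar>"
  using assms(1) unfolding M_def
proof (induction w arbitrary: l)
  case Nil
  then show ?case
    by (cases l) (auto simp: inv_SL2 det_ping_pong ping_pong_entries mat2_adj_def mat2_mult_def attractor_def)
next
  case (Cons m w)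
  obtain i b where l: "l = (i, b)" by (cases l)
  have m: "m \<noteq> (i, \<not> b)" and r: "reduced (m # w)"
    using Cons.prems by (auto simp: l reduced_def)
  define N where "N = word_val SL2 ping_pong (m # w)"
  define L where "L = (if b then ping_pong i else mat2_adj (ping_pong i))"
  have "word_val SL2 ping_pong (l # m # w) = mat2_mult L N"
    by (simp add: l L_def N_def inv_SL2 det_ping_pong)
  then have e: "e11 (word_val SL2 ping_pong (l # m # w)) = e11 L * e11 N + e12 L * e21 N"
    "e21 (word_val SL2 ping_pong (l # m # w)) = e21 L * e11 N + e22 L * e21 N"
    by (simp_all add: mat2_mult_def)
  have IH: "\<bar>e11 N - attractor m * e21 N\<bar> \<le> \<bar>e21 N\<bar>" "2 ^ length w \<le> \<bar>e21 N\<bar>"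
    using Cons.IH[OF r] by (simp_all add: N_def)
  from ping_pong_step[OF IH(1) m e L_def] IH(2) show ?case by (auto simp: l)
qed

lemma ping_pong_entry:
  assumes "reduced w" "w \<noteq> []"
  shows "e21 (word_val SL2 ping_pong w) \<noteq> 0"
proof -
  obtain l v where w: "w = l # v" using assms(2) by (cases w) auto
  have "(2::int) ^ length v > 0" by simp
  then show ?thesis using ping_pong_word[of l v] assms(1) w by fastforce
qed

lemma ping_pong_entry_one:
  assumes "reduced w" "e21 (word_val SL2 ping_pong w) = 1"
  shows "\<exists>i. w = [(i, True)]"
proof -
  obtain l v where w: "w = l # v" using assms(2) by (cases w) auto
  have "(2::int) ^ length v \<le> 1" using ping_pong_word[of l v] assms w by fastforce
  then have "v = []" using one_less_power[of "2::int" "length v"] by (cases v) auto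
  then show ?thesis using w assms(2)
    by (cases l) (auto simp: inv_SL2 det_ping_pong mat2_mult_def mat2_adj_def ping_pong_entries split: if_splits)
qed

section \<open>Evaluating polynomials and rational functions\<close>

definition mpoly_var :: "nat \<Rightarrow> 'k::field mpoly"
  where "mpoly_var i = Poly_Mapping.single (Poly_Mapping.single i 1) 1"

definition rat_var :: "nat \<Rightarrow> 'k::field rat_fun"
  where "rat_var i = Fract (mpoly_var i) 1"

definition monom_eval :: "(nat \<Rightarrow> 'f::comm_ring_1) \<Rightarrow> (nat \<Rightarrow>\<^sub>0 nat) \<Rightarrow> 'f"
  where "monom_eval s m = (\<Prod>i\<in>Poly_Mapping.keys m. s i ^ Poly_Mapping.lookup m i)"

definition mpoly_eval :: "('k::field \<Rightarrow> 'f::comm_ring_1) \<Rightarrow> (nat \<Rightarrow> 'f) \<Rightarrow> 'k mpoly \<Rightarrow> 'f"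
  where "mpoly_eval h s p = (\<Sum>m\<in>Poly_Mapping.keys p. h (Poly_Mapping.lookup p m) * monom_eval s m)"

lemma poly_mapping_update_add:
  "k \<notin> Poly_Mapping.keys f \<Longrightarrow> Poly_Mapping.update k v f = f + Poly_Mapping.single k v"
  by (rule poly_mapping_eqI) (auto simp: lookup_update lookup_add lookup_single in_keys_iff when_def)

lemma poly_mapping_add_induct [case_names zero add]:
  assumes "P 0"
    and "\<And>f k v. k \<notin> Poly_Mapping.keys f \<Longrightarrow> P f \<Longrightarrow> P (f + Poly_Mapping.single k v)"
  shows "P (f :: 'a \<Rightarrow>\<^sub>0 'b::comm_monoid_add)"
  by (induction f rule: update_induct) (use assms in \<open>auto simp: poly_mapping_update_add\<close>)

text \<open>
  Polynomials are generated as a ring by the constants and the variables.  This lets identities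
  between substitution homomorphisms be checked on variables.
\<close>

lemma mpoly_induct [case_names const var add mult]:
  fixes p :: "'k::field mpoly"
  assumes const: "\<And>c. P (Poly_Mapping.single 0 c)" and var: "\<And>i. P (mpoly_var i)"
    and add: "\<And>p q. P p \<Longrightarrow> P q \<Longrightarrow> P (p + q)" and mult: "\<And>p q. P p \<Longrightarrow> P q \<Longrightarrow> P (p * q)"
  shows "P p"
proof -
  have pow: "P (Poly_Mapping.single (Poly_Mapping.single i e) 1)" for i e
  proof (induction e)
    case 0
    then show ?case using const[of 1] by simp
  next
    case (Suc e)
    have "Poly_Mapping.single (Poly_Mapping.single i (Suc e)) (1::'k) =
        mpoly_var i * Poly_Mapping.single (Poly_Mapping.single i e) 1"
      by (simp add: mpoly_var_def mult_single flip: single_add)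
    then show ?case using mult[OF var Suc] by metis
  qed
  have mon: "P (Poly_Mapping.single m 1)" for m
  proof (induction m rule: poly_mapping_add_induct)
    case zero
    then show ?case using const[of 1] by simp
  next
    case (add m i e)
    then show ?case using mult[OF add(2) pow[of i e]] by (simp add: mult_single)
  qed
  show ?thesis
  proof (induction p rule: poly_mapping_add_induct)
    case zero
    then show ?case using const[of 0] by simp
  next
    case (add p m c)
    have "P (Poly_Mapping.single m c)" using mult[OF const[of c] mon[of m]] by (simp add: mult_single)
    then show ?case using assms(3) add by blast
  qed
qed

lemma monom_eval_supset:
  "finite A \<Longrightarrow> Poly_Mapping.keys m \<subseteq> A \<Longrightarrow> monom_eval s m = (\<Prod>i\<in>A. s i ^ Poly_Mapping.lookup m i)"
  unfolding monom_eval_def by (rule prod.mono_neutral_left) (auto simp: in_keys_iff)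

lemma monom_eval_add: "monom_eval s (m + m') = monom_eval s m * monom_eval s m'"
proof -
  define A where "A = Poly_Mapping.keys m \<union> Poly_Mapping.keys m'"
  have A: "finite A" "Poly_Mapping.keys (m + m') \<subseteq> A"
    using Poly_Mapping.keys_add[of m m'] by (auto simp: A_def)
  show ?thesis using A
    by (simp add: monom_eval_supset[OF A] monom_eval_supset[of A m] monom_eval_supset[of A m']
        lookup_add power_add prod.distrib A_def)
qed

locale mpoly_evaluation =
  fixes h :: "'k::field \<Rightarrow> 'f::comm_ring_1" and s :: "nat \<Rightarrow> 'f"
  assumes h_add: "h (a + b) = h a + h b" and h_mult: "h (a * b) = h a * h b" and h_one: "h 1 = 1"
begin

lemma h_zero: "h 0 = 0"
  using h_add[of 0 0] by simp

lemma eval_supset: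
  "finite A \<Longrightarrow> Poly_Mapping.keys p \<subseteq> A \<Longrightarrow>
    mpoly_eval h s p = (\<Sum>m\<in>A. h (Poly_Mapping.lookup p m) * monom_eval s m)"
  unfolding mpoly_eval_def by (rule sum.mono_neutral_left) (auto simp: in_keys_iff h_zero)

lemma eval_add: "mpoly_eval h s (p + q) = mpoly_eval h s p + mpoly_eval h s q"
proof -
  define A where "A = Poly_Mapping.keys p \<union> Poly_Mapping.keys q"
  have A: "finite A" "Poly_Mapping.keys (p + q) \<subseteq> A"
    using Poly_Mapping.keys_add[of p q] by (auto simp: A_def)
  then show ?thesis
    using eval_supset[OF A] eval_supset[of A p] eval_supset[of A q]
    by (simp add: A_def lookup_add h_add ring_distribs sum.distrib)
qed

lemma eval_single: "mpoly_eval h s (Poly_Mapping.single m c) = h c * monom_eval s m"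
  by (simp add: mpoly_eval_def h_zero)

lemma eval_zero: "mpoly_eval h s 0 = 0"
  by (simp add: mpoly_eval_def)

lemma eval_mult: "mpoly_eval h s (p * q) = mpoly_eval h s p * mpoly_eval h s q"
proof (induction p rule: poly_mapping_add_induct)
  case (add p m c)
  have "mpoly_eval h s (Poly_Mapping.single m c * q) = h c * monom_eval s m * mpoly_eval h s q"
    by (induction q rule: poly_mapping_add_induct)
      (simp_all add: eval_add eval_zero eval_single ring_distribs mult_single h_mult monom_eval_add ac_simps)
  then show ?case using add by (simp add: ring_distribs eval_add eval_single)
qed (simp add: eval_zero)

lemma eval_const: "mpoly_eval h s (Poly_Mapping.single 0 c) = h c"
  by (simp add: eval_single monom_eval_def)

lemma eval_var: "mpoly_eval h s (mpoly_var i) = s i"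
  by (simp add: eval_single mpoly_var_def monom_eval_def h_one)

lemma eval_one: "mpoly_eval h s 1 = 1"
  using eval_const[of 1] by (simp add: h_one)

end

text \<open>
  A ring homomorphism \<open>\<psi>\<close> from polynomials to a field extends to those fractions that have a
  representation whose denominator does not lie in its kernel.  The extension is a relation because
  nothing is assumed about the kernel: \<open>\<psi>\<close> is evaluation at a point in one use, and in the other a
  substitution whose injectivity is established by means of this extension.
\<close>

definition has_value :: "('k::field mpoly \<Rightarrow> 'f::field) \<Rightarrow> 'k rat_fun \<Rightarrow> 'f \<Rightarrow> bool"
  where "has_value \<psi> f y \<longleftrightarrow> (\<exists>p q. f = Fract p q \<and> q \<noteq> 0 \<and> \<psi> q \<noteq> 0 \<and> y = \<psi> p / \<psi> q)"

locale mpoly_hom =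
  fixes \<psi> :: "'k::field mpoly \<Rightarrow> 'f::field"
  assumes hom_add: "\<psi> (p + q) = \<psi> p + \<psi> q" and hom_mult: "\<psi> (p * q) = \<psi> p * \<psi> q"
    and hom_one: "\<psi> 1 = 1"
begin

lemma hom_zero: "\<psi> 0 = 0"
  by (metis add_cancel_right_right hom_add add_0)

lemma hom_uminus: "\<psi> (- p) = - \<psi> p"
  using hom_add[of p "- p"] by (simp add: hom_zero eq_neg_iff_add_eq_0 add.commute)

lemma has_value_poly: "has_value \<psi> (Fract p 1) (\<psi> p)"
  unfolding has_value_def by (intro exI[of _ p] exI[of _ 1]) (simp add: hom_one)

lemma has_value_unique:
  assumes "has_value \<psi> f y" "has_value \<psi> f z" shows "y = z"
proof -
  obtain p q p' q' where *: "f = Fract p q" "f = Fract p' q'" "q \<noteq> 0" "q' \<noteq> 0"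
    "\<psi> q \<noteq> 0" "\<psi> q' \<noteq> 0" "y = \<psi> p / \<psi> q" "z = \<psi> p' / \<psi> q'"
    using assms unfolding has_value_def by blast
  then have "p * q' = p' * q" by (simp add: eq_fract)
  then have "\<psi> p * \<psi> q' = \<psi> p' * \<psi> q" by (simp flip: hom_mult)
  then show ?thesis using * by (simp add: frac_eq_eq)
qed

lemma
  assumes "has_value \<psi> f y" "has_value \<psi> g z"
  shows has_value_add: "has_value \<psi> (f + g) (y + z)"
    and has_value_mult: "has_value \<psi> (f * g) (y * z)"
    and has_value_divide: "z \<noteq> 0 \<Longrightarrow> has_value \<psi> (f / g) (y / z)"
proof -
  obtain p q p' q' where *: "f = Fract p q" "g = Fract p' q'" "q \<noteq> 0" "q' \<noteq> 0"
    "\<psi> q \<noteq> 0" "\<psi> q' \<noteq> 0" "y = \<psi> p / \<psi> q" "z = \<psi> p' / \<psi> q'"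
    using assms unfolding has_value_def by blast
  show "has_value \<psi> (f + g) (y + z)"
    unfolding has_value_def using *
    by (intro exI[of _ "p * q' + p' * q"] exI[of _ "q * q'"]) (simp add: hom_mult hom_add field_simps)
  show "has_value \<psi> (f * g) (y * z)"
    unfolding has_value_def using *
    by (intro exI[of _ "p * p'"] exI[of _ "q * q'"]) (simp add: hom_mult)
  assume "z \<noteq> 0"
  then have "\<psi> p' \<noteq> 0" using * by auto
  moreover from this have "p' \<noteq> 0" using hom_zero by auto
  ultimately show "has_value \<psi> (f / g) (y / z)"
    unfolding has_value_def using *
    by (intro exI[of _ "p * q'"] exI[of _ "q * p'"]) (simp add: hom_mult)
qed

lemma has_value_uminus:
  assumes "has_value \<psi> f y"
  shows "has_value \<psi> (- f) (- y)"
proof -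
  obtain p q where "f = Fract p q" "q \<noteq> 0" "\<psi> q \<noteq> 0" "y = \<psi> p / \<psi> q"
    using assms unfolding has_value_def by blast
  then show ?thesis
    unfolding has_value_def by (intro exI[of _ "- p"] exI[of _ q]) (simp add: hom_uminus)
qed

lemma has_value_diff:
  "has_value \<psi> f y \<Longrightarrow> has_value \<psi> g z \<Longrightarrow> has_value \<psi> (f - g) (y - z)"
  using has_value_add[of f y "- g" "- z"] has_value_uminus[of g z] by simp

lemma has_value_zero: "has_value \<psi> 0 0" and has_value_one: "has_value \<psi> 1 1"
  using has_value_poly[of 0] has_value_poly[of 1]
  by (simp_all add: hom_zero hom_one Zero_fract_def One_fract_def)

text \<open>
  Entries of words in matrices of determinant \<open>1\<close> are polynomials in the entries of the letters, so
  they are defined wherever those are.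
\<close>

lemma has_value_word:
  assumes "w \<in> words X" "\<And>x. x \<in> X \<Longrightarrow> mat2_det (A x) = 1" "\<And>x. x \<in> X \<Longrightarrow> mat2_det (B x) = 1"
    and AB: "\<And>x. x \<in> X \<Longrightarrow> rel_mat2 (has_value \<psi>) (A x) (B x)"
  shows "rel_mat2 (has_value \<psi>) (word_val SL2 A w) (word_val SL2 B w)"
  using assms(1)
proof (induction w rule: word_inv.induct)
  case (2 x b w)
  have mul: "rel_mat2 (has_value \<psi>) (mat2_mult M N) (mat2_mult M' N')"
    if "rel_mat2 (has_value \<psi>) M M'" "rel_mat2 (has_value \<psi>) N N'" for M M' N N'
    using that by (auto simp: mat2.rel_sel mat2_mult_def has_value_add has_value_mult)
  have adj: "rel_mat2 (has_value \<psi>) (mat2_adj M) (mat2_adj M')"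
    if "rel_mat2 (has_value \<psi>) M M'" for M M'
    using that by (auto simp: mat2.rel_sel mat2_adj_def has_value_uminus)
  show ?case using 2 assms(2-4) by (auto simp: inv_SL2 intro!: mul adj)
qed (simp add: has_value_zero has_value_one)

end

section \<open>Generic matrices\<close>

lemma rat_var_eq_iff: "rat_var i = (rat_var j :: 'k::field rat_fun) \<longleftrightarrow> i = j"
proof
  assume "rat_var i = (rat_var j :: 'k rat_fun)"
  then have "mpoly_var i = (mpoly_var j :: 'k mpoly)" by (simp add: rat_var_def eq_fract)
  then have "Poly_Mapping.keys (mpoly_var i :: 'k mpoly) = Poly_Mapping.keys (mpoly_var j :: 'k mpoly)"
    by simp
  then have "Poly_Mapping.single i (1::nat) = Poly_Mapping.single j 1" by (simp add: mpoly_var_def)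
  then have "Poly_Mapping.keys (Poly_Mapping.single i (1::nat)) = Poly_Mapping.keys (Poly_Mapping.single j (1::nat))"
    by simp
  then show "i = j" by simp
qed simp

lemma rat_var_nonzero: "rat_var i \<noteq> (0 :: 'k::field rat_fun)"
proof
  assume "rat_var i = (0 :: 'k rat_fun)"
  then have "mpoly_var i = (0 :: 'k mpoly)" by (simp add: rat_var_def Zero_fract_def eq_fract)
  then have "Poly_Mapping.keys (mpoly_var i :: 'k mpoly) = {}" by simp
  then show False by (simp add: mpoly_var_def)
qed

lemma rat_var_rat_funs: "i < r \<Longrightarrow> rat_var i \<in> rat_funs r"
  by (auto simp: rat_var_def mpoly_var_def polys_def intro!: Fract_rat_funs one_polys)

lemma rat_const_hom:
  "rat_const (a + b) = rat_const a + rat_const b" "rat_const (a * b) = rat_const a * rat_const b"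
  "rat_const 1 = 1"
  by (simp_all add: rat_const_def single_add mult_single One_fract_def)

interpretation rat_eval: mpoly_evaluation rat_const s for s :: "nat \<Rightarrow> 'k::field rat_fun"
  by unfold_locales (rule rat_const_hom)+

interpretation rat_eval_hom: mpoly_hom "mpoly_eval rat_const s" for s :: "nat \<Rightarrow> 'k::field rat_fun"
  by unfold_locales (rule rat_eval.eval_add rat_eval.eval_mult rat_eval.eval_one)+

text \<open>
  The variables are laid out as \<open>c\<^sub>0, a\<^sub>0, d\<^sub>1, c\<^sub>1, a\<^sub>1, d\<^sub>2, c\<^sub>2, a\<^sub>2, \<dots>\<close>.  With \<open>d\<^sub>0\<close> replaced by
  \<open>0\<close>, the first \<open>n\<close> matrices use exactly the variables with index below \<open>3n - 1\<close>.
\<close>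

definition generic_mat :: "nat \<Rightarrow> 'k::field rat_fun mat2"
  where "generic_mat i = (let a = rat_var (3 * i + 1); c = rat_var (3 * i);
      d = (if i = 0 then 0 else rat_var (3 * i - 1))
    in Mat2 a ((a * d - 1) / c) c d)"

lemma det_generic_mat: "mat2_det (generic_mat i) = 1"
  by (simp add: mat2_det_def generic_mat_def Let_def rat_var_nonzero)

lemma generic_mat_SL2: "generic_mat \<in> X \<rightarrow> carrier SL2"
  by (simp add: det_generic_mat)

definition generic_val :: "nat word set \<Rightarrow> 'k::field rat_fun mat2"
  where "generic_val = lift_val SL2 generic_mat"

abbreviation free_class :: "nat \<Rightarrow> nat word \<Rightarrow> nat word set"
  where "free_class n w \<equiv> word_rel {..<n} {} `` {w}"

abbreviation free_gen :: "nat \<Rightarrow> nat \<Rightarrow> nat word set"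
  where "free_gen n i \<equiv> free_class n [(i, True)]"

lemma group_free_group: "group (free_group n)"
  unfolding free_group_def by (rule group_presented_group)

lemma free_gen_carrier: "i < n \<Longrightarrow> free_gen n i \<in> carrier (free_group n)"
  by (simp add: free_group_def class_in_carrier words_Nil)

lemma generic_val_class: "w \<in> words {..<n} \<Longrightarrow> generic_val (free_class n w) = word_val SL2 generic_mat w"
  unfolding generic_val_def by (rule SL2.lift_val_class) (auto simp: det_generic_mat)

lemma generic_val_gen: "i < n \<Longrightarrow> generic_val (free_gen n i) = generic_mat i"
  by (simp add: generic_val_class words_Nil mat2_mult_def)

lemma generic_val_hom: "generic_val \<in> hom (free_group n) SL2"
  unfolding generic_val_def free_group_def
  by (rule SL2.lift_val_hom[OF generic_mat_SL2]) simp

lemma det_generic_val: "C \<in> carrier (free_group n) \<Longrightarrow> mat2_det (generic_val C) = 1"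
  using generic_val_hom[of n] by (auto simp: hom_def)

text \<open>
  The point at which the generic matrices become the ping-pong matrices.
\<close>

definition ping_pong_point :: "nat \<Rightarrow> 'k::field_char_0"
  where "ping_pong_point j = of_int (if j mod 3 = 0 then 1 else if j mod 3 = 1
    then 6 * int (j div 3) + 3 else - 6 * int (j div 3 + 1))"

interpretation point_eval: mpoly_evaluation "\<lambda>c. c" s for s :: "nat \<Rightarrow> 'k::field"
  by unfold_locales simp_all

interpretation point_eval_hom: mpoly_hom "mpoly_eval (\<lambda>c. c) s" for s :: "nat \<Rightarrow> 'k::field"
  by unfold_locales (rule point_eval.eval_add point_eval.eval_mult point_eval.eval_one)+

lemma has_value_point_var: "has_value (mpoly_eval (\<lambda>c. c) s) (rat_var i) (s i)"
  using point_eval_hom.has_value_poly[of s "mpoly_var i"] by (simp add: rat_var_def point_eval.eval_var)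

lemma has_value_generic_mat_point:
  "rel_mat2 (has_value (mpoly_eval (\<lambda>c. c) (ping_pong_point :: nat \<Rightarrow> 'k::field_char_0)))
    (generic_mat i) (map_mat2 of_int (ping_pong i))"
proof -
  let ?hv = "has_value (mpoly_eval (\<lambda>c. c) (ping_pong_point :: nat \<Rightarrow> 'k))"
  let ?d = "if i = 0 then 0 else rat_var (3 * i - 1) :: 'k rat_fun"
  have "(3 * i + 1) div 3 = i" "(3 * i + 1) mod 3 = 1" by presburger+
  then have "ping_pong_point (3 * i + 1) = (of_int (6 * int i + 3) :: 'k)"
    by (simp add: ping_pong_point_def)
  then have a: "?hv (rat_var (3 * i + 1)) (of_int (6 * int i + 3))"
    using has_value_point_var[of ping_pong_point "3 * i + 1"] by metis
  have c: "?hv (rat_var (3 * i)) 1"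
    using has_value_point_var[of ping_pong_point "3 * i"] by (simp add: ping_pong_point_def)
  have d: "?hv ?d (of_int (- 6 * int i))"
  proof (cases i)
    case (Suc j)
    then have "3 * i - 1 = 3 * j + 2" by simp
    moreover have "(3 * j + 2) div 3 = j" "(3 * j + 2) mod 3 = 2" by presburger+
    then have "ping_pong_point (3 * j + 2) = (of_int (- 6 * int i) :: 'k)"
      by (simp add: ping_pong_point_def Suc)
    ultimately show ?thesis
      using has_value_point_var[of ping_pong_point "3 * i - 1"] Suc by (metis nat.distinct(1))
  qed (simp add: point_eval_hom.has_value_zero)
  have "?hv ((rat_var (3 * i + 1) * ?d - 1) / rat_var (3 * i))
      ((of_int (6 * int i + 3) * of_int (- 6 * int i) - 1) / 1)"
    by (intro point_eval_hom.has_value_divide point_eval_hom.has_value_diff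
        point_eval_hom.has_value_mult point_eval_hom.has_value_one a c d) simp
  then show ?thesis using a c d
    by (simp add: generic_mat_def Let_def ping_pong_def mult.commute split del: if_split)
qed

lemma word_val_of_int:
  assumes "\<And>i. mat2_det (A i) = 1"
  shows "word_val SL2 (\<lambda>i. map_mat2 of_int (A i)) w =
    (map_mat2 of_int (word_val SL2 A w) :: 'k::comm_ring_1 mat2)"
proof -
  have d: "mat2_det (map_mat2 of_int (A i) :: 'k mat2) = 1" for i
    using assms[of i] by (metis mat2.map_sel mat2_det_def of_int_1 of_int_diff of_int_mult)
  show ?thesis
    by (induction w rule: word_inv.induct)
      (simp_all add: inv_SL2[OF d] inv_SL2[OF assms] mat2_mult_def mat2_adj_def mat2.map_sel)
qed

lemma has_value_generic_word_point:
  "has_value (mpoly_eval (\<lambda>c. c) (ping_pong_point :: nat \<Rightarrow> 'k::field_char_0))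
    (e21 (word_val SL2 generic_mat w)) (of_int (e21 (word_val SL2 ping_pong w)))"
proof -
  have d: "mat2_det (map_mat2 of_int (ping_pong i)) = (1::'k)" for i
    using det_ping_pong[of i] by (metis mat2.map_sel mat2_det_def of_int_1 of_int_diff of_int_mult)
  have "w \<in> words UNIV" by (auto simp: words_def)
  from point_eval_hom.has_value_word[OF this det_generic_mat d has_value_generic_mat_point]
  show ?thesis by (simp add: word_val_of_int det_ping_pong mat2.rel_sel mat2.map_sel)
qed

text \<open>
  A reduced word for \<open>C\<close> has a nonzero integer value at the ping-pong point, and characteristic \<open>0\<close>
  keeps this value nonzero in the field.
\<close>

lemma generic_entry_nonzero:
  assumes "C \<in> carrier (free_group n)" "C \<noteq> \<one>\<^bsub>free_group n\<^esub>"
  shows "e21 (generic_val C :: 'k::field_char_0 rat_fun mat2) \<noteq> 0"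
proof
  assume z: "e21 (generic_val C :: 'k rat_fun mat2) = 0"
  obtain w where w: "w \<in> words {..<n}" "C = free_class n w" "reduced w"
    using assms(1) unfolding free_group_def by (rule free_class_reduced)
  have "w \<noteq> []" using assms(2) w by (auto simp: free_group_def one_presented_group)
  then have "(of_int (e21 (word_val SL2 ping_pong w)) :: 'k) \<noteq> 0" using ping_pong_entry w by simp
  moreover have "(of_int (e21 (word_val SL2 ping_pong w)) :: 'k) = 0"
    using has_value_generic_word_point[of w] z w
      point_eval_hom.has_value_zero point_eval_hom.has_value_unique
    by (metis generic_val_class)
  ultimately show False by simp
qed

text \<open>
  At the integer point the entry is \<open>1\<close>, which forces a word of length one with positive exponent;
  which generator it is can be read off from the variable itself.
\<close>

lemma generic_entry_determines:
  assumes "C \<in> carrier (free_group n)"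
    and e: "e21 (generic_val C :: 'k::field_char_0 rat_fun mat2) = rat_var (3 * i)"
  shows "C = free_gen n i"
proof -
  obtain w where w: "w \<in> words {..<n}" "C = free_class n w" "reduced w"
    using assms(1) unfolding free_group_def by (rule free_class_reduced)
  have "(of_int (e21 (word_val SL2 ping_pong w)) :: 'k) = ping_pong_point (3 * i)"
    using has_value_generic_word_point[of w] e w has_value_point_var
      point_eval_hom.has_value_unique
    by (metis generic_val_class)
  then have "of_int (e21 (word_val SL2 ping_pong w)) = (of_int 1 :: 'k)"
    by (simp add: ping_pong_point_def)
  then have "e21 (word_val SL2 ping_pong w) = 1" unfolding of_int_eq_iff .
  then obtain j where j: "w = [(j, True)]" using ping_pong_entry_one w by blast
  then have "j < n" using w by simp
  then have "e21 (generic_mat j) = (rat_var (3 * i) :: 'k rat_fun)"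
    using e w j by (simp add: generic_val_gen)
  then have "j = i" by (simp add: generic_mat_def Let_def rat_var_eq_iff)
  then show ?thesis using w j by simp
qed

abbreviation free_auts :: "nat \<Rightarrow> (nat word set \<Rightarrow> nat word set) set"
  where "free_auts n \<equiv> auto (free_group n)"

section \<open>The substitution attached to an automorphism\<close>

text \<open>
  The image of the generic tuple under \<open>\<alpha>\<close>, before it is brought back to the chosen representative
  by a conjugation with parameter \<open>shear_param\<close>.
\<close>

definition moved_gen :: "nat \<Rightarrow> (nat word set \<Rightarrow> nat word set) \<Rightarrow> nat \<Rightarrow> 'k::field rat_fun mat2"
  where "moved_gen n \<alpha> i = generic_val (\<alpha> (free_gen n i))"

definition shear_param :: "nat \<Rightarrow> (nat word set \<Rightarrow> nat word set) \<Rightarrow> 'k::field rat_fun"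
  where "shear_param n \<alpha> = e22 (moved_gen n \<alpha> 0) / e21 (moved_gen n \<alpha> 0)"

text \<open>
  The coordinates of the normalised image tuple, read off in the same layout as in \<open>generic_mat\<close>; here
  \<open>j div 3 + 1\<close> occurs because \<open>d\<^sub>i\<close> is stored at \<open>3i - 1\<close>.
\<close>

definition moved_coord :: "nat \<Rightarrow> (nat word set \<Rightarrow> nat word set) \<Rightarrow> nat \<Rightarrow> 'k::field rat_fun"
  where "moved_coord n \<alpha> j =
    (let Z = \<lambda>i. shear (shear_param n \<alpha>) (moved_gen n \<alpha> i) in
     if 3 * n - 1 \<le> j then rat_var j
     else if j mod 3 = 0 then e21 (Z (j div 3))
     else if j mod 3 = 1 then e11 (Z (j div 3))
     else e22 (Z (j div 3 + 1)))"

abbreviation moved_poly :: "nat \<Rightarrow> (nat word set \<Rightarrow> nat word set) \<Rightarrow> 'k::field mpoly \<Rightarrow> 'k rat_fun"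
  where "moved_poly n \<alpha> \<equiv> mpoly_eval rat_const (moved_coord n \<alpha>)"

lemma free_auts_carrier:
  "\<alpha> \<in> free_auts n \<Longrightarrow> C \<in> carrier (free_group n) \<Longrightarrow> \<alpha> C \<in> carrier (free_group n)"
  by (auto simp: auto_def hom_def)

lemma free_auts_hom: "\<alpha> \<in> free_auts n \<Longrightarrow> group_hom (free_group n) (free_group n) \<alpha>"
  by (intro group_hom.intro group_free_group group_hom_axioms.intro) (simp add: auto_def)

lemma free_gen_nontrivial:
  assumes "i < n"
  shows "free_gen n i \<noteq> \<one>\<^bsub>free_group n\<^esub>"
proof
  assume "free_gen n i = \<one>\<^bsub>free_group n\<^esub>"
  then have "([(i, True)], []) \<in> word_rel {..<n} {}"
    using assms by (simp add: free_group_def one_presented_group class_eq_iff words_Nil)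
  then have "word_val SL2 ping_pong [(i, True)] = word_val SL2 ping_pong []"
    by (rule SL2.word_val_rel[rotated 2]) (simp_all add: det_ping_pong)
  then show False by (simp add: mat2_mult_def ping_pong_def)
qed

lemma free_auts_gen_nontrivial:
  assumes "\<alpha> \<in> free_auts n" "i < n"
  shows "\<alpha> (free_gen n i) \<noteq> \<one>\<^bsub>free_group n\<^esub>"
proof
  assume e: "\<alpha> (free_gen n i) = \<one>\<^bsub>free_group n\<^esub>"
  interpret group_hom "free_group n" "free_group n" \<alpha> by (rule free_auts_hom[OF assms(1)])
  have "inj_on \<alpha> (carrier (free_group n))"
    using assms(1) by (simp add: auto_def Bij_def bij_betw_def)
  then have "free_gen n i = \<one>\<^bsub>free_group n\<^esub>"
    using e free_gen_carrier[OF assms(2)] hom_one G.one_closed by (metis inj_onD)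
  then show False using free_gen_nontrivial[OF assms(2)] by blast
qed

lemma generic_val_aut:
  assumes "\<alpha> \<in> free_auts n" "w \<in> words {..<n}"
  shows "generic_val (\<alpha> (free_class n w)) = (word_val SL2 (moved_gen n \<alpha>) w :: 'k::field rat_fun mat2)"
proof -
  define h :: "nat word set \<Rightarrow> 'k rat_fun mat2"
    where "h = compose (carrier (free_group n)) generic_val \<alpha>"
  have g: "free_gen n \<in> {..<n} \<rightarrow> carrier (free_group n)" by (auto intro: free_gen_carrier)
  have c: "h \<in> hom (free_group n) SL2"
    unfolding h_def using group.hom_compose[OF group_free_group _ generic_val_hom] assms(1)
    by (auto simp: auto_def)
  have "word_val SL2 (moved_gen n \<alpha>) w = word_val SL2 (\<lambda>i. h (free_gen n i)) w"
    using assms(2) by (induction w rule: word_inv.induct)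
      (auto simp: moved_gen_def h_def compose_def free_gen_carrier)
  also have "\<dots> = h (word_val (free_group n) (free_gen n) w)"
    using word_val_hom[OF group_free_group group_SL2 c g assms(2)] .
  also have "word_val (free_group n) (free_gen n) w = free_class n w"
    unfolding free_group_def by (rule word_val_generators[OF assms(2)])
  also have "h (free_class n w) = generic_val (\<alpha> (free_class n w))"
    using assms(2) by (simp add: h_def compose_def free_group_def class_in_carrier)
  finally show ?thesis by simp
qed

lemma det_moved_gen: "\<alpha> \<in> free_auts n \<Longrightarrow> i < n \<Longrightarrow> mat2_det (moved_gen n \<alpha> i) = 1"
  unfolding moved_gen_def by (rule det_generic_val[of _ n]) (simp add: free_auts_carrier free_gen_carrier)

lemma moved_gen_nonzero:
  "\<alpha> \<in> free_auts n \<Longrightarrow> i < n \<Longrightarrow> e21 (moved_gen n \<alpha> i :: 'k::field_char_0 rat_fun mat2) \<noteq> 0"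
  unfolding moved_gen_def
  by (rule generic_entry_nonzero[of _ n]) (simp_all add: free_auts_carrier free_gen_carrier free_auts_gen_nontrivial)

lemma e22_sheared: 
  assumes "\<alpha> \<in> free_auts n" "0 < n"
  shows "e22 (shear (shear_param n \<alpha>) (moved_gen n \<alpha> 0 :: 'k::field_char_0 rat_fun mat2)) = 0"
  using moved_gen_nonzero[OF assms, where ?'k = 'k] by (simp add: shear_def shear_param_def)

lemma has_value_moved_var:
  "has_value (moved_poly n \<alpha>) (rat_var j) (moved_coord n \<alpha> j)"
  using rat_eval_hom.has_value_poly[of "moved_coord n \<alpha>" "mpoly_var j"] 
  by (simp add: rat_var_def rat_eval.eval_var)

text \<open>
  The substitution takes every entry of the generic tuple to the corresponding entry of the
  normalised image tuple.  For the upper right entry this follows from the determinant, as the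
  lower left entry of the image does not vanish.
\<close>

lemma has_value_generic_mat:
  assumes \<alpha>: "\<alpha> \<in> free_auts n" and i: "i < n"
  shows "rel_mat2 (has_value (moved_poly n \<alpha> :: 'k::field_char_0 mpoly \<Rightarrow> 'k rat_fun))
    (generic_mat i) (shear (shear_param n \<alpha>) (moved_gen n \<alpha> i))"
proof -
  let ?hv = "has_value (moved_poly n \<alpha> :: 'k mpoly \<Rightarrow> 'k rat_fun)"
  let ?d = "if i = 0 then 0 else rat_var (3 * i - 1) :: 'k rat_fun"
  define Z :: "nat \<Rightarrow> 'k rat_fun mat2" where "Z i = shear (shear_param n \<alpha>) (moved_gen n \<alpha> i)" for i
  have coord: "moved_coord n \<alpha> j = (if 3 * n - 1 \<le> j then rat_var j
     else if j mod 3 = 0 then e21 (Z (j div 3))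
     else if j mod 3 = 1 then e11 (Z (j div 3))
     else e22 (Z (j div 3 + 1)))" for j
    by (simp add: moved_coord_def Let_def Z_def)
  have v: "?hv (rat_var j) (moved_coord n \<alpha> j)" for j
    by (rule has_value_moved_var)
  have "(3 * i + 1) div 3 = i" "(3 * i + 1) mod 3 = 1" "3 * i + 1 < 3 * n - 1" using i by presburger+
  then have "moved_coord n \<alpha> (3 * i + 1) = e11 (Z i)" by (simp add: coord)
  then have a: "?hv (rat_var (3 * i + 1)) (e11 (Z i))"
    using v by metis
  have "3 * i < 3 * n - 1" using i by presburger
  then have "moved_coord n \<alpha> (3 * i) = e21 (Z i)" by (simp add: coord)
  then have c: "?hv (rat_var (3 * i)) (e21 (Z i))"
    using v by metis
  have d: "?hv ?d (e22 (Z i))"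
  proof (cases i)
    case 0
    then show ?thesis using e22_sheared[OF \<alpha>, where ?'k = 'k] i by (simp add: Z_def rat_eval_hom.has_value_zero)
  next
    case (Suc j)
    have "(3 * j + 2) div 3 = j" "(3 * j + 2) mod 3 = 2" "3 * j + 2 < 3 * n - 1" using i Suc by presburger+
    then have "moved_coord n \<alpha> (3 * j + 2) = e22 (Z i)" by (simp add: coord Suc)
    moreover have "?d = rat_var (3 * j + 2)" using Suc by simp
    ultimately show ?thesis
      using v[of "3 * j + 2"] by simp
  qed
  have nz: "e21 (Z i) \<noteq> 0" unfolding Z_def e21_shear by (rule moved_gen_nonzero[OF \<alpha> i])
  have "mat2_det (Z i) = 1" unfolding Z_def mat2_det_shear by (rule det_moved_gen[OF \<alpha> i])
  then have "e12 (Z i) = (e11 (Z i) * e22 (Z i) - 1) / e21 (Z i)"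
    using nz by (simp add: mat2_det_def field_simps)
  moreover have "?hv ((rat_var (3 * i + 1) * ?d - 1) / rat_var (3 * i))
      ((e11 (Z i) * e22 (Z i) - 1) / e21 (Z i))"
    by (intro rat_eval_hom.has_value_divide rat_eval_hom.has_value_diff
        rat_eval_hom.has_value_mult rat_eval_hom.has_value_one a c d nz)
  ultimately show ?thesis using a c d unfolding Z_def[symmetric]
    by (simp add: generic_mat_def Let_def mat2.rel_sel split del: if_split)
qed

text \<open>
  Consequently the substitution of \<open>\<alpha>\<close> acts on the matrix of any word \<open>w\<close> as \<open>w \<mapsto> \<alpha>(w)\<close>, up to
  one conjugation that does not depend on \<open>w\<close>.
\<close>

lemma has_value_generic_val:
  assumes \<alpha>: "\<alpha> \<in> free_auts n" and C: "C \<in> carrier (free_group n)"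
  shows "rel_mat2 (has_value (moved_poly n \<alpha> :: 'k::field_char_0 mpoly \<Rightarrow> 'k rat_fun))
    (generic_val C) (shear (shear_param n \<alpha>) (generic_val (\<alpha> C)))"
proof -
  obtain w where w: "w \<in> words {..<n}" "C = free_class n w"
    using C unfolding free_group_def by (rule presented_groupE)
  have "rel_mat2 (has_value (moved_poly n \<alpha> :: 'k mpoly \<Rightarrow> 'k rat_fun)) (word_val SL2 generic_mat w)
      (word_val SL2 (\<lambda>i. shear (shear_param n \<alpha>) (moved_gen n \<alpha> i)) w)"
    using w(1) by (rule rat_eval_hom.has_value_word)
      (simp_all add: det_generic_mat mat2_det_shear det_moved_gen[OF \<alpha>] has_value_generic_mat[OF \<alpha>])
  moreover have "word_val SL2 (\<lambda>i. shear (shear_param n \<alpha>) (moved_gen n \<alpha> i)) w =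
      (shear (shear_param n \<alpha>) (word_val SL2 (moved_gen n \<alpha>) w) :: 'k rat_fun mat2)"
    by (rule word_val_shear[OF w(1)]) (simp add: det_moved_gen[OF \<alpha>])
  ultimately show ?thesis
    using w by (simp add: generic_val_class generic_val_aut[OF \<alpha>])
qed

lemma mult_AutoGroup:
  "\<alpha> \<in> auto G \<Longrightarrow> \<beta> \<in> auto G \<Longrightarrow> \<alpha> \<otimes>\<^bsub>AutoGroup G\<^esub> \<beta> = compose (carrier G) \<alpha> \<beta>"
  by (simp add: AutoGroup_def BijGroup_def auto_def)

lemma group_AutoGroup_free: "group (AutoGroup (free_group n))"
  using group.AutoGroup[OF group_free_group] .

lemma carrier_AutoGroup: "carrier (AutoGroup G) = auto G"
  by (simp add: AutoGroup_def)

lemma moved_gen_compose: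
  "\<alpha> \<in> free_auts n \<Longrightarrow> \<beta> \<in> free_auts n \<Longrightarrow> i < n \<Longrightarrow>
    moved_gen n (\<alpha> \<otimes>\<^bsub>AutoGroup (free_group n)\<^esub> \<beta>) i = generic_val (\<alpha> (\<beta> (free_gen n i)))"
  by (simp add: mult_AutoGroup moved_gen_def compose_def free_gen_carrier)

text \<open>
  Applying the substitution of \<open>\<alpha>\<close> to the normalised image tuple of \<open>\<beta>\<close> gives a conjugate of the
  image tuple of \<open>\<alpha>\<beta>\<close> in which the lower right entry of the first matrix is still \<open>0\<close>.  There is only
  one such conjugate, so the two conjugation parameters add up to that of \<open>\<alpha>\<beta>\<close>.
\<close>

lemma has_value_sheared_compose:
  assumes \<alpha>: "\<alpha> \<in> free_auts n" and \<beta>: "\<beta> \<in> free_auts n" and i: "i < n"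
  defines "\<gamma> \<equiv> \<alpha> \<otimes>\<^bsub>AutoGroup (free_group n)\<^esub> \<beta>"
  shows "rel_mat2 (has_value (moved_poly n \<alpha> :: 'k::field_char_0 mpoly \<Rightarrow> 'k rat_fun))
    (shear (shear_param n \<beta>) (moved_gen n \<beta> i)) (shear (shear_param n \<gamma>) (moved_gen n \<gamma> i))"
proof -
  let ?hv = "has_value (moved_poly n \<alpha> :: 'k mpoly \<Rightarrow> 'k rat_fun)"
  interpret A: group "AutoGroup (free_group n)" by (rule group_AutoGroup_free)
  have \<gamma>: "\<gamma> \<in> free_auts n"
    using A.m_closed[of \<alpha> \<beta>] \<alpha> \<beta> by (simp add: \<gamma>_def carrier_AutoGroup)
  have Y: "rel_mat2 ?hv (moved_gen n \<beta> j) (shear (shear_param n \<alpha>) (moved_gen n \<gamma> j))" if "j < n" for j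
    using has_value_generic_val[OF \<alpha> free_auts_carrier[OF \<beta> free_gen_carrier[OF that]]]
      moved_gen_compose[OF \<alpha> \<beta> that, where ?'a = 'k] by (simp add: moved_gen_def \<gamma>_def)
  have n: "0 < n" using i by simp
  have nz: "e21 (moved_gen n \<gamma> 0 :: 'k rat_fun mat2) \<noteq> 0" by (rule moved_gen_nonzero[OF \<gamma> n])
  define t :: "'k rat_fun" where "t = shear_param n \<gamma> - shear_param n \<alpha>"
  have "?hv (shear_param n \<beta>)
      (e22 (shear (shear_param n \<alpha>) (moved_gen n \<gamma> 0)) / e21 (shear (shear_param n \<alpha>) (moved_gen n \<gamma> 0)))"
    unfolding shear_param_def[of n \<beta>]
    by (rule rat_eval_hom.has_value_divide) (use Y[OF n] nz in \<open>simp_all add: mat2.rel_sel e21_shear\<close>)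
  also have "e22 (shear (shear_param n \<alpha>) (moved_gen n \<gamma> 0)) / e21 (shear (shear_param n \<alpha>) (moved_gen n \<gamma> 0)) = t"
    using nz by (simp add: t_def shear_def shear_param_def[of n \<gamma>] diff_divide_distrib)
  finally have t: "?hv (shear_param n \<beta>) t" .
  have "rel_mat2 ?hv (shear (shear_param n \<beta>) (moved_gen n \<beta> i))
      (shear t (shear (shear_param n \<alpha>) (moved_gen n \<gamma> i)))"
    using Y[OF i] t
    by (simp add: mat2.rel_sel shear_def[of "shear_param n \<beta>"] shear_def[of t] rat_eval_hom.has_value_add
        rat_eval_hom.has_value_mult rat_eval_hom.has_value_diff)
  then show ?thesis by (simp add: shear_shear t_def)
qed

lemma has_value_moved_coord:
  assumes \<alpha>: "\<alpha> \<in> free_auts n" and \<beta>: "\<beta> \<in> free_auts n"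
  shows "has_value (moved_poly n \<alpha> :: 'k::field_char_0 mpoly \<Rightarrow> 'k rat_fun) (moved_coord n \<beta> j)
    (moved_coord n (\<alpha> \<otimes>\<^bsub>AutoGroup (free_group n)\<^esub> \<beta>) j)"
proof (cases "3 * n - 1 \<le> j")
  case True
  then show ?thesis using has_value_moved_var[of n \<alpha> j] by (simp add: moved_coord_def)
next
  case False
  have "j div 3 < n" "j mod 3 \<noteq> 0 \<Longrightarrow> j mod 3 \<noteq> 1 \<Longrightarrow> j div 3 + 1 < n" using False by presburger+
  then show ?thesis
    using False has_value_sheared_compose[OF \<alpha> \<beta>, where ?'k = 'k]
    by (auto simp: moved_coord_def Let_def mat2.rel_sel)
qed

lemma has_value_moved_poly:
  assumes \<alpha>: "\<alpha> \<in> free_auts n" and \<beta>: "\<beta> \<in> free_auts n"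
  shows "has_value (moved_poly n \<alpha> :: 'k::field_char_0 mpoly \<Rightarrow> 'k rat_fun) (moved_poly n \<beta> p)
    (moved_poly n (\<alpha> \<otimes>\<^bsub>AutoGroup (free_group n)\<^esub> \<beta>) p)"
proof (induction p rule: mpoly_induct)
  case (const c)
  show ?case
    using rat_eval_hom.has_value_poly[of "moved_coord n \<alpha>" "Poly_Mapping.single 0 c"]
    unfolding rat_eval.eval_const by (simp only: flip: rat_const_def)
next
  case (var i)
  show ?case by (simp add: rat_eval.eval_var has_value_moved_coord[OF \<alpha> \<beta>])
qed (simp_all add: rat_eval.eval_add rat_eval.eval_mult rat_eval_hom.has_value_add rat_eval_hom.has_value_mult)

lemma moved_coord_one: 
  assumes "0 < n"
  shows "moved_coord n \<one>\<^bsub>AutoGroup (free_group n)\<^esub> j = (rat_var j :: 'k::field rat_fun)"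
proof -
  have Y: "moved_gen n \<one>\<^bsub>AutoGroup (free_group n)\<^esub> i = (generic_mat i :: 'k rat_fun mat2)" if "i < n" for i
    using that by (simp add: moved_gen_def AutoGroup_def BijGroup_def free_gen_carrier generic_val_gen)
  have t: "shear_param n \<one>\<^bsub>AutoGroup (free_group n)\<^esub> = (0 :: 'k rat_fun)"
    by (simp add: shear_param_def Y[OF assms] generic_mat_def Let_def)
  show ?thesis
  proof (cases "3 * n - 1 \<le> j")
    case False
    have *: "j div 3 < n" "j mod 3 \<noteq> 0 \<Longrightarrow> j mod 3 \<noteq> 1 \<Longrightarrow> j div 3 + 1 < n"
      "j mod 3 = 0 \<Longrightarrow> 3 * (j div 3) = j" "j mod 3 = 1 \<Longrightarrow> 3 * (j div 3) + 1 = j"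
      "j mod 3 \<noteq> 0 \<Longrightarrow> j mod 3 \<noteq> 1 \<Longrightarrow> 3 * (j div 3 + 1) - 1 = j"
      using False by presburger+
    show ?thesis
      using False * by (auto simp: moved_coord_def t shear_zero Y generic_mat_def Let_def)
  qed (simp add: moved_coord_def)
qed

lemma moved_poly_one:
  assumes "0 < n"
  shows "moved_poly n \<one>\<^bsub>AutoGroup (free_group n)\<^esub> p = Fract (p :: 'k::field mpoly) 1"
proof (induction p rule: mpoly_induct)
  case (var i)
  show ?case by (simp add: rat_eval.eval_var moved_coord_one[OF assms] rat_var_def)
qed (simp_all add: rat_eval.eval_const rat_eval.eval_add rat_eval.eval_mult, simp add: rat_const_def)

text \<open>
  The substitution of \<open>\<alpha>\<close> is injective on polynomials because the one of \<open>\<alpha>\<inverse>\<close> takes the result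
  back to the original polynomial.  It therefore extends to all rational functions.
\<close>

lemma moved_poly_nonzero:
  assumes \<alpha>: "\<alpha> \<in> free_auts n" and n: "0 < n" and p: "p \<noteq> 0"
  shows "moved_poly n \<alpha> (p :: 'k::field_char_0 mpoly) \<noteq> 0"
proof
  assume z: "moved_poly n \<alpha> p = 0"
  interpret A: group "AutoGroup (free_group n)" by (rule group_AutoGroup_free)
  define \<beta> where "\<beta> = inv\<^bsub>AutoGroup (free_group n)\<^esub> \<alpha>"
  have \<beta>: "\<beta> \<in> free_auts n" "\<beta> \<otimes>\<^bsub>AutoGroup (free_group n)\<^esub> \<alpha> = \<one>\<^bsub>AutoGroup (free_group n)\<^esub>"
    using \<alpha> A.inv_closed A.l_inv by (auto simp: \<beta>_def carrier_AutoGroup)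
  have "has_value (moved_poly n \<beta>) (moved_poly n \<alpha> p) (Fract p 1)"
    using has_value_moved_poly[OF \<beta>(1) \<alpha>, of p] by (simp add: \<beta>(2) moved_poly_one[OF n])
  then have "Fract p 1 = 0"
    using z rat_eval_hom.has_value_zero rat_eval_hom.has_value_unique by metis
  then show False using p by (simp add: Zero_fract_def eq_fract)
qed

definition moved_fun :: "nat \<Rightarrow> (nat word set \<Rightarrow> nat word set) \<Rightarrow> 'k::field rat_fun \<Rightarrow> 'k rat_fun"
  where "moved_fun n \<alpha> f = (THE y. has_value (moved_poly n \<alpha>) f y)"

lemma moved_fun_eq: "has_value (moved_poly n \<alpha>) f y \<Longrightarrow> moved_fun n \<alpha> f = y"
  unfolding moved_fun_def by (blast intro: rat_eval_hom.has_value_unique)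

lemma has_value_moved_fun:
  assumes "\<alpha> \<in> free_auts n" "0 < n"
  shows "has_value (moved_poly n \<alpha>) f (moved_fun n \<alpha> (f :: 'k::field_char_0 rat_fun))"
proof -
  obtain p q where pq: "f = Fract p q" "q \<noteq> 0" by (cases f)
  then have "has_value (moved_poly n \<alpha>) f (moved_poly n \<alpha> p / moved_poly n \<alpha> q)"
    unfolding has_value_def using moved_poly_nonzero[OF assms] by blast
  then show ?thesis using moved_fun_eq by metis
qed

lemma moved_fun_Fract:
  assumes "\<alpha> \<in> free_auts n" "0 < n" "q \<noteq> 0"
  shows "moved_fun n \<alpha> (Fract p q :: 'k::field_char_0 rat_fun) = moved_poly n \<alpha> p / moved_poly n \<alpha> q"
  by (rule moved_fun_eq) (use moved_poly_nonzero[OF assms] assms(3) in \<open>auto simp: has_value_def\<close>)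

lemma moved_fun_compose:
  assumes "\<alpha> \<in> free_auts n" "\<beta> \<in> free_auts n" "0 < n"
  shows "moved_fun n \<alpha> (moved_fun n \<beta> f) =
    moved_fun n (\<alpha> \<otimes>\<^bsub>AutoGroup (free_group n)\<^esub> \<beta>) (f :: 'k::field_char_0 rat_fun)"
proof -
  interpret A: group "AutoGroup (free_group n)" by (rule group_AutoGroup_free)
  have \<gamma>: "\<alpha> \<otimes>\<^bsub>AutoGroup (free_group n)\<^esub> \<beta> \<in> free_auts n"
    using A.m_closed[of \<alpha> \<beta>] assms by (simp add: carrier_AutoGroup)
  obtain p q where pq: "f = Fract p q" "q \<noteq> 0" by (cases f)
  show ?thesis unfolding pq(1) moved_fun_Fract[OF assms(2,3) pq(2)] moved_fun_Fract[OF \<gamma> assms(3) pq(2)]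
    by (intro moved_fun_eq rat_eval_hom.has_value_divide has_value_moved_poly assms(1,2)
        moved_poly_nonzero[OF \<gamma> assms(3) pq(2)])
qed

lemma moved_fun_one:
  assumes "0 < n"
  shows "moved_fun n \<one>\<^bsub>AutoGroup (free_group n)\<^esub> f = (f :: 'k::field_char_0 rat_fun)"
proof -
  interpret A: group "AutoGroup (free_group n)" by (rule group_AutoGroup_free)
  obtain p q where pq: "f = Fract p q" "q \<noteq> 0" by (cases f)
  show ?thesis using moved_fun_Fract[OF _ assms pq(2), of "\<one>\<^bsub>AutoGroup (free_group n)\<^esub>" p] A.one_closed pq
    by (simp add: carrier_AutoGroup moved_poly_one[OF assms])
qed

section \<open>Embedding \<open>Aut(F\<^sub>n)\<close> into the Cremona group\<close>

lemma rat_funs_sum: "(\<And>x. x \<in> A \<Longrightarrow> f x \<in> rat_funs r) \<Longrightarrow> sum f A \<in> rat_funs r"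
  by (induction A rule: infinite_finite_induct) (auto simp: zero_rat_funs rat_funs_closed)

lemma rat_funs_prod: "(\<And>x. x \<in> A \<Longrightarrow> f x \<in> rat_funs r) \<Longrightarrow> prod f A \<in> rat_funs r"
  by (induction A rule: infinite_finite_induct) (auto simp: one_rat_funs rat_funs_closed)

lemma rat_funs_power: "f \<in> rat_funs r \<Longrightarrow> f ^ e \<in> rat_funs r"
  by (induction e) (auto simp: one_rat_funs rat_funs_closed)

lemma rat_funs_diff: "f \<in> rat_funs r \<Longrightarrow> g \<in> rat_funs r \<Longrightarrow> f - g \<in> rat_funs r"
  using rat_funs_closed(2,3)[of f r "- g"] rat_funs_closed(3)[of g r] by simp

lemma rat_funs_divide: "f \<in> rat_funs r \<Longrightarrow> g \<in> rat_funs r \<Longrightarrow> f / g \<in> rat_funs r"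
  by (simp add: divide_inverse rat_funs_closed)

lemmas rat_funs_intros = rat_funs_closed rat_funs_diff rat_funs_divide zero_rat_funs one_rat_funs
  rat_var_rat_funs

definition mat_rat_funs :: "nat \<Rightarrow> 'k::field rat_fun mat2 \<Rightarrow> bool"
  where "mat_rat_funs r M \<longleftrightarrow>
    e11 M \<in> rat_funs r \<and> e12 M \<in> rat_funs r \<and> e21 M \<in> rat_funs r \<and> e22 M \<in> rat_funs r"

lemma mpoly_eval_rat_funs:
  assumes p: "p \<in> polys r" and s: "\<And>i. i < r \<Longrightarrow> s i \<in> rat_funs r"
  shows "mpoly_eval rat_const s p \<in> rat_funs r"
  unfolding mpoly_eval_def monom_eval_def
  using p s by (intro rat_funs_sum rat_funs_closed(1) rat_const_rat_funs rat_funs_prod rat_funs_power)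
    (auto simp: polys_def)

lemma word_val_rat_funs:
  assumes "w \<in> words X" "\<And>x. x \<in> X \<Longrightarrow> mat2_det (A x) = 1" "\<And>x. x \<in> X \<Longrightarrow> mat_rat_funs r (A x)"
  shows "mat_rat_funs r (word_val SL2 A w)"
  using assms(1)
proof (induction w rule: word_inv.induct)
  case (2 x b w)
  then show ?case using assms(2,3)[of x]
    by (auto simp: inv_SL2 mat_rat_funs_def mat2_mult_def mat2_adj_def rat_funs_closed rat_funs_diff)
qed (simp add: mat_rat_funs_def zero_rat_funs one_rat_funs)

lemma moved_coord_rat_funs:
  assumes \<alpha>: "\<alpha> \<in> free_auts n" and r: "3 * n - 1 \<le> r" and j: "j < r"
  shows "moved_coord n \<alpha> j \<in> (rat_funs r :: 'k::field rat_fun set)"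
proof -
  have g: "mat_rat_funs r (generic_mat i :: 'k rat_fun mat2)" if "i < n" for i
  proof -
    have "3 * i + 1 < r" "3 * i < r" "3 * i - 1 < r" using that r by linarith+
    then show ?thesis
      by (simp add: mat_rat_funs_def generic_mat_def Let_def rat_funs_intros)
  qed
  have F: "mat_rat_funs r (generic_val C :: 'k rat_fun mat2)" if C: "C \<in> carrier (free_group n)" for C
  proof -
    obtain w where w: "w \<in> words {..<n}" "C = free_class n w"
      using C unfolding free_group_def by (rule presented_groupE)
    show ?thesis unfolding w(2) generic_val_class[OF w(1)]
      by (rule word_val_rat_funs[OF w(1) det_generic_mat]) (simp add: g)
  qed
  have Y: "mat_rat_funs r (moved_gen n \<alpha> i :: 'k rat_fun mat2)" if "i < n" for i
    unfolding moved_gen_def by (intro F free_auts_carrier[OF \<alpha>] free_gen_carrier that)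
  show ?thesis
  proof (cases "3 * n - 1 \<le> j")
    case True
    then show ?thesis using j by (simp add: moved_coord_def rat_var_rat_funs)
  next
    case False
    have b: "0 < n" "j div 3 < n" "j mod 3 \<noteq> 0 \<Longrightarrow> j mod 3 \<noteq> 1 \<Longrightarrow> j div 3 + 1 < n" using False by presburger+
    have t: "shear_param n \<alpha> \<in> (rat_funs r :: 'k rat_fun set)"
      unfolding shear_param_def using Y[OF b(1)] by (simp add: mat_rat_funs_def rat_funs_intros)
    show ?thesis using False b t Y
      by (auto simp: mat_rat_funs_def moved_coord_def Let_def shear_def rat_funs_intros)
  qed
qed

definition cremona_action :: "nat \<Rightarrow> nat \<Rightarrow> (nat word set \<Rightarrow> nat word set) \<Rightarrow> 'k::field rat_fun \<Rightarrow> 'k rat_fun"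
  where "cremona_action n r \<alpha> = restrict (moved_fun n \<alpha>) (rat_funs r)"

lemma moved_fun_rat_funs:
  assumes \<alpha>: "\<alpha> \<in> free_auts n" and n: "0 < n" and r: "3 * n - 1 \<le> r" and f: "f \<in> rat_funs r"
  shows "moved_fun n \<alpha> f \<in> (rat_funs r :: 'k::field_char_0 rat_fun set)"
proof -
  obtain p q where pq: "f = Fract p q" "p \<in> polys r" "q \<in> polys r" "q \<noteq> 0"
    using f unfolding rat_funs_def by blast
  show ?thesis unfolding pq(1) moved_fun_Fract[OF \<alpha> n pq(4)]
    by (intro rat_funs_divide mpoly_eval_rat_funs pq moved_coord_rat_funs[OF \<alpha> r])
qed

lemma cremona_action_auts:
  assumes \<alpha>: "\<alpha> \<in> free_auts n" and n: "0 < n" and r: "3 * n - 1 \<le> r"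
  shows "cremona_action n r \<alpha> \<in> (cremona_auts r :: ('k::field_char_0 rat_fun \<Rightarrow> 'k rat_fun) set)"
proof -
  interpret A: group "AutoGroup (free_group n)" by (rule group_AutoGroup_free)
  define \<beta> where "\<beta> = inv\<^bsub>AutoGroup (free_group n)\<^esub> \<alpha>"
  have \<beta>: "\<beta> \<in> free_auts n" "\<beta> \<otimes>\<^bsub>AutoGroup (free_group n)\<^esub> \<alpha> = \<one>\<^bsub>AutoGroup (free_group n)\<^esub>"
    "\<alpha> \<otimes>\<^bsub>AutoGroup (free_group n)\<^esub> \<beta> = \<one>\<^bsub>AutoGroup (free_group n)\<^esub>"
    using \<alpha> A.inv_closed A.l_inv A.r_inv by (auto simp: \<beta>_def carrier_AutoGroup)
  let ?f = "moved_fun n \<alpha> :: 'k rat_fun \<Rightarrow> 'k rat_fun" and ?g = "moved_fun n \<beta> :: 'k rat_fun \<Rightarrow> 'k rat_fun"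
  have "bij_betw ?f (rat_funs r) (rat_funs r)"
    by (rule bij_betw_byWitness[of _ ?g])
      (auto simp: moved_fun_compose[OF \<alpha> \<beta>(1) n] moved_fun_compose[OF \<beta>(1) \<alpha> n] \<beta>(2,3)
        moved_fun_one[OF n] moved_fun_rat_funs[OF \<alpha> n r] moved_fun_rat_funs[OF \<beta>(1) n r])
  then have "cremona_action n r \<alpha> \<in> Bij (rat_funs r :: 'k rat_fun set)"
    by (simp add: Bij_def cremona_action_def bij_betw_restrict_eq)
  moreover have "?f (f + g) = ?f f + ?f g" "?f (f * g) = ?f f * ?f g" for f g
    by (intro moved_fun_eq rat_eval_hom.has_value_add rat_eval_hom.has_value_mult
        has_value_moved_fun[OF \<alpha> n])+
  moreover have "?f 1 = 1" by (intro moved_fun_eq rat_eval_hom.has_value_one)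
  moreover have "?f (rat_const c) = rat_const c" for c
    using moved_fun_Fract[OF \<alpha> n, of 1 "Poly_Mapping.single 0 c"]
    by (simp add: rat_eval.eval_const rat_eval.eval_one flip: rat_const_def)
  ultimately show ?thesis
    by (auto simp: cremona_auts_def ring_hom_def rat_fun_field_def cremona_action_def
        rat_funs_closed one_rat_funs rat_const_rat_funs moved_fun_rat_funs[OF \<alpha> n r])
qed

text \<open>
  The lower left entry survives the normalisation, so \<open>\<alpha>\<close> fixing the variable \<open>c\<^sub>i\<close> means that the
  matrix of \<open>\<alpha>(x\<^sub>i)\<close> has the lower left entry of the generic matrix \<open>X\<^sub>i\<close>.
\<close>

lemma cremona_action_faithful:
  assumes \<alpha>: "\<alpha> \<in> free_auts n" and n: "0 < n" and r: "3 * n - 1 \<le> r"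
    and id: "\<And>f. f \<in> rat_funs r \<Longrightarrow> moved_fun n \<alpha> f = (f :: 'k::field_char_0 rat_fun)"
  shows "\<alpha> = \<one>\<^bsub>AutoGroup (free_group n)\<^esub>"
proof -
  have gen: "\<alpha> (free_gen n i) = free_gen n i" if i: "i < n" for i
  proof (rule generic_entry_determines[where ?'k = 'k])
    show "\<alpha> (free_gen n i) \<in> carrier (free_group n)"
      by (intro free_auts_carrier[OF \<alpha>] free_gen_carrier i)
    have "has_value (moved_poly n \<alpha> :: 'k mpoly \<Rightarrow> _) (rat_var (3 * i)) (e21 (moved_gen n \<alpha> i))"
      using has_value_generic_mat[OF \<alpha> i, where ?'k = 'k]
      by (simp add: mat2.rel_sel generic_mat_def Let_def e21_shear)
    then have "e21 (moved_gen n \<alpha> i :: 'k rat_fun mat2) = moved_fun n \<alpha> (rat_var (3 * i))"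
      by (rule moved_fun_eq[symmetric])
    also have "\<dots> = rat_var (3 * i)"
      using i r by (intro id rat_var_rat_funs) linarith
    finally show "e21 (generic_val (\<alpha> (free_gen n i)) :: 'k rat_fun mat2) = rat_var (3 * i)"
      by (simp add: moved_gen_def)
  qed
  interpret group_hom "free_group n" "free_group n" \<alpha> by (rule free_auts_hom[OF \<alpha>])
  have g: "free_gen n \<in> {..<n} \<rightarrow> carrier (free_group n)" by (auto intro: free_gen_carrier)
  have "\<alpha> C = C" if C: "C \<in> carrier (free_group n)" for C
  proof -
    obtain w where w: "w \<in> words {..<n}" "C = free_class n w"
      using C unfolding free_group_def by (rule presented_groupE)
    have Cw: "C = word_val (free_group n) (free_gen n) w"
      unfolding free_group_def using word_val_generators[OF w(1)] w(2) by simp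
    have "\<alpha> C = word_val (free_group n) (\<lambda>i. \<alpha> (free_gen n i)) w"
      using word_val_hom[OF group_free_group group_free_group homh g w(1)] Cw by simp
    also have "\<dots> = C" unfolding Cw using w(1)
      by (induction w rule: word_inv.induct) (auto simp: gen)
    finally show ?thesis .
  qed
  moreover have "\<alpha> \<in> extensional (carrier (free_group n))" using \<alpha> by (simp add: auto_def Bij_def)
  ultimately show ?thesis
    by (intro extensionalityI[of _ "carrier (free_group n)"]) (auto simp: AutoGroup_def BijGroup_def)
qed

lemma mult_cremona_group:
  "f \<in> cremona_auts r \<Longrightarrow> g \<in> cremona_auts r \<Longrightarrow> f \<otimes>\<^bsub>cremona_group r\<^esub> g = compose (rat_funs r) f g"
  by (simp add: cremona_group_def BijGroup_def cremona_auts_def)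

theorem cremona_contains_Aut_free_group:
  assumes n: "0 < n" and r: "3 * n - 1 \<le> r"
  shows "contains_group (cremona_group r :: ('k::field_char_0 rat_fun \<Rightarrow> 'k rat_fun) monoid)
    (AutoGroup (free_group n))"
proof -
  let ?C = "cremona_group r :: ('k rat_fun \<Rightarrow> 'k rat_fun) monoid" and ?A = "AutoGroup (free_group n)"
  let ?h = "cremona_action n r :: _ \<Rightarrow> 'k rat_fun \<Rightarrow> 'k rat_fun"
  have "?h \<in> hom ?A ?C"
  proof (rule homI)
    fix \<alpha> assume "\<alpha> \<in> carrier ?A"
    then show "?h \<alpha> \<in> carrier ?C"
      using cremona_action_auts[OF _ n r] by (simp add: cremona_group_def carrier_AutoGroup)
  next
    fix \<alpha> \<beta> assume "\<alpha> \<in> carrier ?A" "\<beta> \<in> carrier ?A"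
    then have *: "\<alpha> \<in> free_auts n" "\<beta> \<in> free_auts n" by (simp_all add: carrier_AutoGroup)
    have "?h (\<alpha> \<otimes>\<^bsub>?A\<^esub> \<beta>) f = compose (rat_funs r) (?h \<alpha>) (?h \<beta>) f" for f
      by (simp add: cremona_action_def compose_def moved_fun_compose[OF * n] moved_fun_rat_funs[OF *(2) n r])
    then show "?h (\<alpha> \<otimes>\<^bsub>?A\<^esub> \<beta>) = ?h \<alpha> \<otimes>\<^bsub>?C\<^esub> ?h \<beta>"
      using * by (simp add: fun_eq_iff mult_cremona_group cremona_action_auts[OF _ n r])
  qed
  moreover have "\<alpha> = \<one>\<^bsub>?A\<^esub>" if "\<alpha> \<in> carrier ?A" "?h \<alpha> = \<one>\<^bsub>?C\<^esub>" for \<alpha>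
  proof (rule cremona_action_faithful[OF _ n r])
    show "\<alpha> \<in> free_auts n" using that by (simp add: carrier_AutoGroup)
    fix f :: "'k rat_fun" assume "f \<in> rat_funs r"
    then show "moved_fun n \<alpha> f = f"
      using fun_cong[OF that(2), of f] by (simp add: cremona_action_def cremona_group_def BijGroup_def)
  qed
  ultimately have "?h \<in> mon ?A ?C"
    using mon_iff_hom_one[OF group_AutoGroup_free group_cremona_group] by blast
  then show ?thesis unfolding contains_group_def by blast
qed

section \<open>A normal form in the braid group\<close>

context group
begin

lemma inv_mult_cancel: "x \<in> carrier G \<Longrightarrow> y \<in> carrier G \<Longrightarrow> inv x \<otimes> (x \<otimes> y) = y"
  by (simp flip: m_assoc)

lemma mult_inv_cancel: "x \<in> carrier G \<Longrightarrow> y \<in> carrier G \<Longrightarrow> x \<otimes> (inv x \<otimes> y) = y"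
  by (simp flip: m_assoc)

lemma generate_word_val:
  assumes f: "f \<in> X \<rightarrow> carrier G" and x: "x \<in> generate G (f ` X)"
  shows "\<exists>u \<in> words X. x = word_val G f u"
  using x
proof (induction rule: generate.induct)
  case one
  then show ?case by (intro bexI[of _ "[]"]) (simp_all add: words_Nil)
next
  case (incl h)
  then obtain i where "i \<in> X" "h = f i" by blast
  then show ?case using f by (intro bexI[of _ "[(i, True)]"]) (auto simp: words_Nil Pi_iff)
next
  case (inv h)
  then obtain i where "i \<in> X" "h = f i" by blast
  then show ?case using f by (intro bexI[of _ "[(i, False)]"]) (auto simp: words_Nil Pi_iff)
next
  case (eng h1 h2)
  then obtain u v where "u \<in> words X" "v \<in> words X" "h1 = word_val G f u" "h2 = word_val G f v" by blast
  then show ?case using f by (intro bexI[of _ "u @ v"]) (auto simp: word_val_append[of _ X] words_append)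
qed

text \<open>
  If \<open>x\<close> can be moved from the left to the right of each generator at the cost of changing the
  generator into an element of the generated subgroup, then the same holds for the whole subgroup.
\<close>

lemma generate_pass:
  assumes S: "S \<subseteq> carrier G" and x: "x \<in> carrier G"
    and gen: "\<And>h. h \<in> S \<Longrightarrow> \<exists>h' \<in> generate G S. x \<otimes> h = h' \<otimes> x"
    and h: "h \<in> generate G S"
  shows "\<exists>h' \<in> generate G S. x \<otimes> h = h' \<otimes> x"
  using h
proof (induction rule: generate.induct)
  case one
  then show ?case using x by (intro bexI[of _ \<one>] generate.one) simp
next
  case (incl h)
  then show ?case by (rule gen)
next
  case (inv h)
  then obtain h' where h': "h' \<in> generate G S" "x \<otimes> h = h' \<otimes> x" using gen by blast
  have c: "h \<in> carrier G" "h' \<in> carrier G" using inv S h'(1) generate_in_carrier[OF S] by auto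
  have "x = h' \<otimes> (x \<otimes> inv h)"
    using h'(2) c x by (metis inv_closed m_assoc m_closed r_inv r_one)
  then have "x \<otimes> inv h = inv h' \<otimes> x" using c x by (metis inv_closed inv_mult_cancel m_closed)
  then show ?case using generate_m_inv_closed[OF S h'(1)] by blast
next
  case (eng h1 h2)
  then obtain k1 k2 where k: "k1 \<in> generate G S" "x \<otimes> h1 = k1 \<otimes> x" "k2 \<in> generate G S" "x \<otimes> h2 = k2 \<otimes> x"
    by blast
  have c: "h1 \<in> carrier G" "h2 \<in> carrier G" "k1 \<in> carrier G" "k2 \<in> carrier G"
    using eng k generate_in_carrier[OF S] by auto
  have "x \<otimes> (h1 \<otimes> h2) = (k1 \<otimes> k2) \<otimes> x"
    using c x k by (metis m_assoc m_closed)
  then show ?case using generate.eng[OF k(1,3)] by blast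
qed

end

text \<open>
  Elements \<open>\<sigma>\<^sub>0, \<dots>, \<sigma>\<^sub>N\<close> satisfying the braid relations on \<open>N + 2\<close> strands, with
  \<open>s\<^sub>j = \<sigma>\<^sub>N \<sigma>\<^sub>N\<^sub>-\<^sub>1 \<dots> \<sigma>\<^sub>j\<close>, which moves the last strand to place \<open>j\<close>, and
  \<open>a\<^sub>j = s\<^sub>j\<^sub>+\<^sub>1 \<sigma>\<^sub>j\<^sup>2 s\<^sub>j\<^sub>+\<^sub>1\<inverse>\<close>, which takes the last strand once around strand \<open>j\<close>.  The recursion for
  \<open>a\<^sub>j\<close> is an equivalent description (\<open>a_pass_s\<close>) that is convenient both for induction and for
  computing the Hurwitz action.
\<close>

locale braid_elements = group G for G (structure) +
  fixes N :: nat and \<sigma> s a :: "nat \<Rightarrow> 'a"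
  assumes \<sigma>_closed: "i \<le> N \<Longrightarrow> \<sigma> i \<in> carrier G"
    and \<sigma>_comm: "Suc i < j \<Longrightarrow> j \<le> N \<Longrightarrow> \<sigma> i \<otimes> \<sigma> j = \<sigma> j \<otimes> \<sigma> i"
    and \<sigma>_braid: "Suc i \<le> N \<Longrightarrow> \<sigma> i \<otimes> (\<sigma> (Suc i) \<otimes> \<sigma> i) = \<sigma> (Suc i) \<otimes> (\<sigma> i \<otimes> \<sigma> (Suc i))"
    and s_last: "s (Suc N) = \<one>"
    and s_step: "j \<le> N \<Longrightarrow> s j = s (Suc j) \<otimes> \<sigma> j"
    and a_last: "a N = \<sigma> N \<otimes> \<sigma> N"
    and a_step: "j < N \<Longrightarrow> a j = inv (\<sigma> j) \<otimes> (a (Suc j) \<otimes> \<sigma> j)"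
begin

lemma s_closed: "j \<le> Suc N \<Longrightarrow> s j \<in> carrier G"
  by (induction rule: inc_induct) (auto simp: s_last s_step \<sigma>_closed)

lemma a_closed: "j \<le> N \<Longrightarrow> a j \<in> carrier G"
  by (induction rule: inc_induct) (auto simp: a_last a_step \<sigma>_closed)

lemma replace2:
  "x \<otimes> y = u \<otimes> v \<Longrightarrow> x \<in> carrier G \<Longrightarrow> y \<in> carrier G \<Longrightarrow> u \<in> carrier G \<Longrightarrow> v \<in> carrier G \<Longrightarrow>
    z \<in> carrier G \<Longrightarrow> x \<otimes> (y \<otimes> z) = u \<otimes> (v \<otimes> z)"
  by (metis m_assoc)

lemma \<sigma>_comm': "Suc i < j \<Longrightarrow> j \<le> N \<Longrightarrow> z \<in> carrier G \<Longrightarrow> \<sigma> i \<otimes> (\<sigma> j \<otimes> z) = \<sigma> j \<otimes> (\<sigma> i \<otimes> z)"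
  by (rule replace2) (auto intro: \<sigma>_comm \<sigma>_closed)

lemma \<sigma>_braid': "Suc i \<le> N \<Longrightarrow> z \<in> carrier G \<Longrightarrow>
    \<sigma> i \<otimes> (\<sigma> (Suc i) \<otimes> (\<sigma> i \<otimes> z)) = \<sigma> (Suc i) \<otimes> (\<sigma> i \<otimes> (\<sigma> (Suc i) \<otimes> z))"
  using \<sigma>_braid[of i] by (metis \<sigma>_closed Suc_leD m_assoc m_closed)

lemma s_pass_low: "Suc i < j \<Longrightarrow> j \<le> Suc N \<Longrightarrow> s j \<otimes> \<sigma> i = \<sigma> i \<otimes> s j"
  unfolding atomize_imp
proof (rule impI, rule impI)
  assume i: "Suc i < j" and "j \<le> Suc N"
  from this(2,1) show "s j \<otimes> \<sigma> i = \<sigma> i \<otimes> s j"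
  proof (induction rule: inc_induct)
    case base
    then show ?case by (simp add: s_last \<sigma>_closed)
  next
    case (step j)
    have "s j \<otimes> \<sigma> i = s (Suc j) \<otimes> (\<sigma> i \<otimes> \<sigma> j)"
      using step by (simp add: s_step s_closed \<sigma>_closed m_assoc \<sigma>_comm[of i j])
    also have "\<dots> = \<sigma> i \<otimes> s j"
      using step by (simp add: s_step s_closed \<sigma>_closed flip: m_assoc)
    finally show ?case .
  qed
qed

lemma s_pass_high:
  assumes "j \<le> k" "k < N"
  shows "s j \<otimes> \<sigma> (Suc k) = \<sigma> k \<otimes> s j"
  using assms(1)
proof (induction rule: inc_induct)
  case base
  have c: "\<sigma> k \<in> carrier G" "\<sigma> (Suc k) \<in> carrier G" "s (Suc (Suc k)) \<in> carrier G"
    using assms(2) by (auto simp: \<sigma>_closed s_closed)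
  have "s k \<otimes> \<sigma> (Suc k) = s (Suc (Suc k)) \<otimes> (\<sigma> k \<otimes> (\<sigma> (Suc k) \<otimes> \<sigma> k))"
    using assms(2) c by (simp add: s_step m_assoc \<sigma>_braid)
  also have "\<dots> = \<sigma> k \<otimes> (s (Suc (Suc k)) \<otimes> (\<sigma> (Suc k) \<otimes> \<sigma> k))"
    using assms(2) c by (intro replace2 s_pass_low) auto
  also have "\<dots> = \<sigma> k \<otimes> s k"
    using assms(2) c by (simp add: s_step m_assoc)
  finally show ?case .
next
  case (step j)
  have c: "\<sigma> k \<in> carrier G" "\<sigma> (Suc k) \<in> carrier G" "s (Suc j) \<in> carrier G" "\<sigma> j \<in> carrier G"
    using assms(2) step by (auto simp: \<sigma>_closed s_closed)
  have "s j \<otimes> \<sigma> (Suc k) = s (Suc j) \<otimes> (\<sigma> (Suc k) \<otimes> \<sigma> j)"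
    using assms(2) step c by (simp add: s_step m_assoc \<sigma>_comm[of j "Suc k"])
  also have "\<dots> = \<sigma> k \<otimes> (s (Suc j) \<otimes> \<sigma> j)"
    using c step.IH by (intro replace2) auto
  finally show ?case using assms(2) step by (simp add: s_step)
qed

lemma a_pass_s: "j \<le> N \<Longrightarrow> a j \<otimes> s (Suc j) = s (Suc j) \<otimes> (\<sigma> j \<otimes> \<sigma> j)"
proof (induction rule: inc_induct)
  case base
  then show ?case by (simp add: a_last s_last \<sigma>_closed)
next
  case (step j)
  let ?S = "s (Suc (Suc j))"
  have c: "\<sigma> j \<in> carrier G" "\<sigma> (Suc j) \<in> carrier G" "?S \<in> carrier G" "a (Suc j) \<in> carrier G"
    using step by (auto simp: \<sigma>_closed s_closed a_closed)
  have "\<sigma> j \<otimes> (a j \<otimes> s (Suc j)) = a (Suc j) \<otimes> (\<sigma> j \<otimes> (?S \<otimes> \<sigma> (Suc j)))"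
    using step c by (simp add: a_step s_step m_assoc mult_inv_cancel)
  also have "\<sigma> j \<otimes> (?S \<otimes> \<sigma> (Suc j)) = ?S \<otimes> (\<sigma> j \<otimes> \<sigma> (Suc j))"
    using step c s_pass_low[of j "Suc (Suc j)"] by (intro replace2) auto
  also have "a (Suc j) \<otimes> (?S \<otimes> (\<sigma> j \<otimes> \<sigma> (Suc j)))
      = ?S \<otimes> (\<sigma> (Suc j) \<otimes> (\<sigma> (Suc j) \<otimes> (\<sigma> j \<otimes> \<sigma> (Suc j))))"
    using replace2[OF step.IH] c by (simp add: m_assoc)
  also have "\<dots> = ?S \<otimes> (\<sigma> j \<otimes> (\<sigma> (Suc j) \<otimes> (\<sigma> j \<otimes> \<sigma> j)))"
    using step c by (simp add: \<sigma>_braid[symmetric] \<sigma>_braid')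
  also have "\<dots> = \<sigma> j \<otimes> (?S \<otimes> (\<sigma> (Suc j) \<otimes> (\<sigma> j \<otimes> \<sigma> j)))"
    using step c s_pass_low[of j "Suc (Suc j)"] by (intro replace2) auto
  also have "\<dots> = \<sigma> j \<otimes> (s (Suc j) \<otimes> (\<sigma> j \<otimes> \<sigma> j))"
    using step c by (simp add: s_step m_assoc)
  finally show ?case
    using c step s_closed[of "Suc j"] a_closed[of j] by simp
qed

lemma \<sigma>_pass_a_same: "j < N \<Longrightarrow> \<sigma> j \<otimes> a j = a (Suc j) \<otimes> \<sigma> j"
  by (simp add: a_step mult_inv_cancel \<sigma>_closed a_closed)

lemma \<sigma>_pass_a_high: "Suc i < j \<Longrightarrow> j \<le> N \<Longrightarrow> \<sigma> i \<otimes> a j = a j \<otimes> \<sigma> i"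
  unfolding atomize_imp
proof (rule impI, rule impI)
  assume i: "Suc i < j" and "j \<le> N"
  from this(2,1) show "\<sigma> i \<otimes> a j = a j \<otimes> \<sigma> i"
  proof (induction rule: inc_induct)
    case base
    then show ?case by (simp add: a_last \<sigma>_closed m_assoc \<sigma>_comm \<sigma>_comm')
  next
    case (step j)
    have c: "\<sigma> j \<in> carrier G" "\<sigma> i \<in> carrier G" "a (Suc j) \<in> carrier G"
      using step by (auto simp: \<sigma>_closed a_closed)
    have "\<sigma> j \<otimes> (\<sigma> i \<otimes> a j) = \<sigma> i \<otimes> (\<sigma> j \<otimes> a j)"
      using step by (intro \<sigma>_comm'[symmetric]) (auto simp: a_closed)
    also have "\<dots> = \<sigma> i \<otimes> (a (Suc j) \<otimes> \<sigma> j)" using step by (simp add: \<sigma>_pass_a_same)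
    also have "\<dots> = a (Suc j) \<otimes> (\<sigma> i \<otimes> \<sigma> j)" using step c by (intro replace2) auto
    also have "\<dots> = (a (Suc j) \<otimes> \<sigma> j) \<otimes> \<sigma> i" using step c by (simp add: \<sigma>_comm[of i j] m_assoc)
    also have "\<dots> = \<sigma> j \<otimes> (a j \<otimes> \<sigma> i)" using step c by (simp add: m_assoc a_closed flip: \<sigma>_pass_a_same)
    finally show ?case using c step a_closed[of j] by simp
  qed
qed

lemma \<sigma>_pass_a_low:
  assumes "j < i" "i < N"
  shows "\<sigma> i \<otimes> a j = a j \<otimes> \<sigma> i"
proof -
  let ?S = "s (Suc j)"
  have c: "\<sigma> j \<in> carrier G" "\<sigma> i \<in> carrier G" "\<sigma> (Suc i) \<in> carrier G" "a j \<in> carrier G" "?S \<in> carrier G"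
    using assms by (auto simp: \<sigma>_closed a_closed s_closed)
  have h: "?S \<otimes> \<sigma> (Suc i) = \<sigma> i \<otimes> ?S" using assms by (intro s_pass_high) auto
  have "(\<sigma> i \<otimes> a j) \<otimes> ?S = \<sigma> i \<otimes> (?S \<otimes> (\<sigma> j \<otimes> \<sigma> j))"
    using assms c by (simp add: m_assoc a_pass_s)
  also have "\<dots> = ?S \<otimes> (\<sigma> (Suc i) \<otimes> (\<sigma> j \<otimes> \<sigma> j))"
    using c h by (intro replace2) auto
  also have "\<dots> = ?S \<otimes> (\<sigma> j \<otimes> (\<sigma> j \<otimes> \<sigma> (Suc i)))"
    using assms c by (simp add: \<sigma>_comm[of j "Suc i"] \<sigma>_comm'[of j "Suc i"])
  also have "\<dots> = a j \<otimes> (?S \<otimes> \<sigma> (Suc i))"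
    using assms c replace2[OF a_pass_s[of j], of "\<sigma> (Suc i)"] by (simp add: m_assoc)
  also have "\<dots> = (a j \<otimes> \<sigma> i) \<otimes> ?S" using c h by (simp add: m_assoc)
  finally show ?thesis using c by simp
qed

text \<open>
  This is the least obvious of the relations between the \<open>\<sigma>\<^sub>j\<close> and the \<open>a\<^sub>j\<close>.  After multiplication by
  \<open>s\<^sub>j\<^sub>+\<^sub>2\<close>, which commutes with \<open>\<sigma>\<^sub>j\<close> and turns \<open>a\<^sub>j\<^sub>+\<^sub>1\<close> into \<open>\<sigma>\<^sub>j\<^sub>+\<^sub>1\<^sup>2\<close>, it becomes
  \<open>x y\<^sup>2 x y\<^sup>2 = y\<^sup>2 x y\<^sup>2 x\<close> for \<open>x y x = y x y\<close>.
\<close>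

lemma \<sigma>_a_relation:
  assumes "j < N"
  shows "\<sigma> j \<otimes> (a (Suc j) \<otimes> (\<sigma> j \<otimes> a (Suc j))) = a (Suc j) \<otimes> (\<sigma> j \<otimes> (a (Suc j) \<otimes> \<sigma> j))"
proof -
  let ?S = "s (Suc (Suc j))" and ?x = "\<sigma> j" and ?y = "\<sigma> (Suc j)" and ?a = "a (Suc j)"
  have c: "?x \<in> carrier G" "?y \<in> carrier G" "?a \<in> carrier G" "?S \<in> carrier G"
    using assms by (auto simp: \<sigma>_closed a_closed s_closed)
  have x: "?x \<otimes> (?S \<otimes> z) = ?S \<otimes> (?x \<otimes> z)" if "z \<in> carrier G" for z
    using assms c that s_pass_low[of j "Suc (Suc j)"] by (intro replace2) auto
  have y: "?a \<otimes> (?S \<otimes> z) = ?S \<otimes> (?y \<otimes> (?y \<otimes> z))" if "z \<in> carrier G" for z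
    using replace2[OF a_pass_s[of "Suc j"]] assms c that by (simp add: m_assoc)
  have xyx: "?x \<otimes> (?y \<otimes> (?x \<otimes> z)) = ?y \<otimes> (?x \<otimes> (?y \<otimes> z))" if "z \<in> carrier G" for z
    using assms that by (intro \<sigma>_braid') auto
  have "(?x \<otimes> (?a \<otimes> (?x \<otimes> ?a))) \<otimes> ?S = ?x \<otimes> (?a \<otimes> (?x \<otimes> (?a \<otimes> (?S \<otimes> \<one>))))"
    using c by (simp add: m_assoc)
  also have "\<dots> = ?S \<otimes> (?x \<otimes> (?y \<otimes> (?y \<otimes> (?x \<otimes> (?y \<otimes> (?y \<otimes> \<one>))))))"
    using c by (simp only: x y m_closed one_closed)
  also have "\<dots> = ?S \<otimes> (?x \<otimes> (?y \<otimes> (?x \<otimes> (?y \<otimes> (?x \<otimes> (?y \<otimes> \<one>))))))"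
    using c by (simp only: xyx[symmetric] m_closed one_closed)
  also have "\<dots> = ?S \<otimes> (?y \<otimes> (?x \<otimes> (?y \<otimes> (?y \<otimes> (?x \<otimes> (?y \<otimes> \<one>))))))"
    using c by (simp only: xyx[of "?y \<otimes> (?x \<otimes> (?y \<otimes> \<one>))"] m_closed one_closed)
  also have "\<dots> = ?S \<otimes> (?y \<otimes> (?x \<otimes> (?y \<otimes> (?x \<otimes> (?y \<otimes> (?x \<otimes> \<one>))))))"
    using c by (simp only: xyx[of \<one>] m_closed one_closed)
  also have "\<dots> = ?S \<otimes> (?y \<otimes> (?y \<otimes> (?x \<otimes> (?y \<otimes> (?y \<otimes> (?x \<otimes> \<one>))))))"
    using c by (simp only: xyx[of "?y \<otimes> (?x \<otimes> \<one>)"] m_closed one_closed)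
  also have "\<dots> = ?a \<otimes> (?x \<otimes> (?a \<otimes> (?x \<otimes> (?S \<otimes> \<one>))))"
    using c by (simp only: x y m_closed one_closed)
  also have "\<dots> = (?a \<otimes> (?x \<otimes> (?a \<otimes> ?x))) \<otimes> ?S"
    using c by (simp add: m_assoc)
  finally show ?thesis using c by simp
qed

abbreviation "A \<equiv> generate G (a ` {..N})"
abbreviation "B \<equiv> generate G (\<sigma> ` {..<N})"

lemma a_image: "a ` {..N} \<subseteq> carrier G"
  by (auto simp: a_closed)

lemma \<sigma>_image: "\<sigma> ` {..<N} \<subseteq> carrier G"
  by (auto simp: \<sigma>_closed)

lemma A_carrier: "h \<in> A \<Longrightarrow> h \<in> carrier G"
  using generate_in_carrier[OF a_image] .

lemma B_carrier: "y \<in> B \<Longrightarrow> y \<in> carrier G"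
  using generate_in_carrier[OF \<sigma>_image] .

lemma a_in_A: "j \<le> N \<Longrightarrow> a j \<in> A"
  by (auto intro: generate.incl)

lemma inv_a_in_A: "j \<le> N \<Longrightarrow> inv (a j) \<in> A"
  by (auto intro: generate.inv)

text \<open>
  The subgroup \<open>A\<close> generated by the \<open>a\<^sub>j\<close> is normalised by the braids on the first \<open>N + 1\<close> strands,
  because conjugation by any \<open>\<sigma>\<^sub>i\<close> or its inverse takes the generators of \<open>A\<close> into \<open>A\<close>.
\<close>

lemma \<sigma>_pass_A:
  assumes i: "i < N" and h: "h \<in> A"
  shows "\<exists>h' \<in> A. \<sigma> i \<otimes> h = h' \<otimes> \<sigma> i"
proof (rule generate_pass[OF a_image _ _ h])
  show "\<sigma> i \<in> carrier G" using i by (simp add: \<sigma>_closed)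
  fix g assume "g \<in> a ` {..N}"
  then obtain k where k: "k \<le> N" "g = a k" by auto
  have c: "\<sigma> i \<in> carrier G" "a (Suc i) \<in> carrier G" "a i \<in> carrier G"
    using i by (auto simp: \<sigma>_closed a_closed)
  consider "k < i" | "k = i" | "k = Suc i" | "Suc i < k" by linarith
  then show "\<exists>h' \<in> A. \<sigma> i \<otimes> g = h' \<otimes> \<sigma> i"
  proof cases
    case 1
    then show ?thesis using \<sigma>_pass_a_low[OF _ i] k a_in_A by auto
  next
    case 2
    then show ?thesis using \<sigma>_pass_a_same[OF i] k i a_in_A[of "Suc i"] by auto
  next
    case 3
    \<comment> \<open>Here \<open>\<sigma>\<^sub>i a\<^sub>i\<^sub>+\<^sub>1 \<sigma>\<^sub>i\<inverse> = a\<^sub>i\<^sub>+\<^sub>1\<inverse> a\<^sub>i a\<^sub>i\<^sub>+\<^sub>1\<close>, a form of the relation above.\<close>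
    let ?h = "inv (a (Suc i)) \<otimes> (a i \<otimes> a (Suc i))"
    have "?h \<otimes> \<sigma> i = inv (a (Suc i)) \<otimes> (inv (\<sigma> i) \<otimes> (a (Suc i) \<otimes> (\<sigma> i \<otimes> (a (Suc i) \<otimes> \<sigma> i))))"
      using c i by (simp add: a_step[of i] m_assoc)
    also have "\<dots> = \<sigma> i \<otimes> a (Suc i)"
      using c by (simp add: inv_mult_cancel flip: \<sigma>_a_relation[OF i])
    finally have "\<sigma> i \<otimes> g = ?h \<otimes> \<sigma> i" using 3 k by simp
    moreover have "?h \<in> A" using i by (intro generate.eng a_in_A inv_a_in_A) auto
    ultimately show ?thesis by blast
  next
    case 4
    then show ?thesis using \<sigma>_pass_a_high[of i k] k a_in_A by auto
  qed
qed

lemma inv_\<sigma>_pass_A: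
  assumes i: "i < N" and h: "h \<in> A"
  shows "\<exists>h' \<in> A. inv (\<sigma> i) \<otimes> h = h' \<otimes> inv (\<sigma> i)"
proof (rule generate_pass[OF a_image _ _ h])
  show "inv (\<sigma> i) \<in> carrier G" using i by (simp add: \<sigma>_closed)
  fix g assume "g \<in> a ` {..N}"
  then obtain k where k: "k \<le> N" "g = a k" by auto
  have c: "\<sigma> i \<in> carrier G" "a (Suc i) \<in> carrier G" "a i \<in> carrier G" "a k \<in> carrier G"
    using i k by (auto simp: \<sigma>_closed a_closed)
  \<comment> \<open>It suffices to find \<open>h'\<close> with \<open>g \<sigma>\<^sub>i = \<sigma>\<^sub>i h'\<close>.\<close>
  have *: "\<exists>h' \<in> A. inv (\<sigma> i) \<otimes> g = h' \<otimes> inv (\<sigma> i)" if "h' \<in> A" "a k \<otimes> \<sigma> i = \<sigma> i \<otimes> h'" for h'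
  proof -
    have "h' \<in> carrier G" using that(1) by (rule A_carrier)
    then have "inv (\<sigma> i) \<otimes> a k = h' \<otimes> inv (\<sigma> i)"
      using that(2) c by (metis inv_closed inv_mult_cancel m_assoc m_closed r_inv r_one)
    then show ?thesis using that(1) k by blast
  qed
  consider "k < i" | "k = i" | "k = Suc i" | "Suc i < k" by linarith
  then show "\<exists>h' \<in> A. inv (\<sigma> i) \<otimes> g = h' \<otimes> inv (\<sigma> i)"
  proof cases
    case 1
    then show ?thesis using *[OF a_in_A[OF k(1)]] \<sigma>_pass_a_low[OF _ i] by auto
  next
    case 2
    \<comment> \<open>Here \<open>\<sigma>\<^sub>i\<inverse> a\<^sub>i \<sigma>\<^sub>i = a\<^sub>i a\<^sub>i\<^sub>+\<^sub>1 a\<^sub>i\<inverse>\<close>, again from the relation between \<open>\<sigma>\<^sub>i\<close> and \<open>a\<^sub>i\<^sub>+\<^sub>1\<close>.\<close>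
    let ?h = "a i \<otimes> (a (Suc i) \<otimes> inv (a i))"
    have "\<sigma> i \<otimes> ?h = a (Suc i) \<otimes> (\<sigma> i \<otimes> (a (Suc i) \<otimes> inv (a i)))"
      using replace2[OF \<sigma>_pass_a_same[OF i]] c by simp
    also have "\<dots> = a i \<otimes> \<sigma> i"
    proof -
      have "inv (\<sigma> i) \<otimes> (a (Suc i) \<otimes> (\<sigma> i \<otimes> (a (Suc i) \<otimes> \<sigma> i))) = a (Suc i) \<otimes> (\<sigma> i \<otimes> a (Suc i))"
        using c by (simp add: inv_mult_cancel flip: \<sigma>_a_relation[OF i])
      then have "a i \<otimes> (a (Suc i) \<otimes> \<sigma> i) = a (Suc i) \<otimes> (\<sigma> i \<otimes> a (Suc i))"
        using c i by (simp add: a_step[of i] m_assoc)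
      then have e: "a i \<otimes> (\<sigma> i \<otimes> a i) = a (Suc i) \<otimes> (\<sigma> i \<otimes> a (Suc i))"
        using \<sigma>_pass_a_same[OF i] by simp
      have "a (Suc i) \<otimes> (\<sigma> i \<otimes> (a (Suc i) \<otimes> inv (a i))) = (a i \<otimes> (\<sigma> i \<otimes> a i)) \<otimes> inv (a i)"
        unfolding e using c by (simp add: m_assoc)
      then show ?thesis using c by (simp add: m_assoc)
    qed
    finally have "a k \<otimes> \<sigma> i = \<sigma> i \<otimes> ?h" using 2 by simp
    moreover have "?h \<in> A" using i by (intro generate.eng a_in_A inv_a_in_A) auto
    ultimately show ?thesis using * by blast
  next
    case 3
    then show ?thesis using *[OF a_in_A[of i]] \<sigma>_pass_a_same[OF i] i by auto
  next
    case 4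
    then show ?thesis using *[OF a_in_A[OF k(1)]] \<sigma>_pass_a_high[of i k] k by auto
  qed
qed

lemma B_pass_A:
  assumes "y \<in> B" "h \<in> A"
  shows "\<exists>h' \<in> A. y \<otimes> h = h' \<otimes> y"
  using assms
proof (induction arbitrary: h rule: generate.induct)
  case one
  then show ?case using A_carrier by auto
next
  case (incl y)
  then show ?case using \<sigma>_pass_A by auto
next
  case (inv y)
  then show ?case using inv_\<sigma>_pass_A by auto
next
  case (eng y1 y2)
  obtain h2 where h2: "h2 \<in> A" "y2 \<otimes> h = h2 \<otimes> y2" using eng by blast
  obtain h1 where h1: "h1 \<in> A" "y1 \<otimes> h2 = h1 \<otimes> y1" using eng h2 by blast
  have c: "y1 \<in> carrier G" "y2 \<in> carrier G" "h \<in> carrier G" "h1 \<in> carrier G" "h2 \<in> carrier G"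
    using eng h1 h2 A_carrier B_carrier by auto
  have "(y1 \<otimes> y2) \<otimes> h = h1 \<otimes> (y1 \<otimes> y2)" using c h1 h2 by (metis m_assoc)
  then show ?case using h1 by blast
qed

text \<open>
  The elements \<open>s\<^sub>j\<close> represent the cosets of the stabiliser of the last strand; right multiplication
  by a generator permutes them up to a factor in \<open>A\<close> or in \<open>B\<close>.
\<close>

lemma s_times_generator:
  assumes j: "j \<le> Suc N" and i: "i \<le> N"
  shows "\<exists>h \<in> A. \<exists>y \<in> B. \<exists>j' \<le> Suc N. s j \<otimes> (if b then \<sigma> i else inv (\<sigma> i)) = h \<otimes> (y \<otimes> s j')"
proof -
  have c: "\<sigma> i \<in> carrier G" "s j \<in> carrier G" using i j by (auto simp: \<sigma>_closed s_closed)
  have one: "\<one> \<in> A" "\<one> \<in> B" by (auto intro: generate.one)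
  have pass: ?thesis if k: "k < N" "s j \<otimes> \<sigma> i = \<sigma> k \<otimes> s j" for k
  proof -
    have ck: "\<sigma> k \<in> carrier G" using k by (simp add: \<sigma>_closed)
    have "s j \<otimes> inv (\<sigma> i) = inv (\<sigma> k) \<otimes> s j"
      using c ck k(2) by (metis inv_closed inv_mult_cancel m_assoc m_closed r_inv r_one)
    then have "s j \<otimes> (if b then \<sigma> i else inv (\<sigma> i)) = \<one> \<otimes> ((if b then \<sigma> k else inv (\<sigma> k)) \<otimes> s j)"
      using c ck k(2) by simp
    moreover have "(if b then \<sigma> k else inv (\<sigma> k)) \<in> B"
      using k(1) by (auto intro: generate.incl generate.inv)
    ultimately show ?thesis using one(1) j by blast
  qed
  consider "Suc i < j" | "j = Suc i" | "j = i" | "j < i" by linarith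
  then show ?thesis
  proof cases
    case 1
    show ?thesis using 1 j by (intro pass[of i] s_pass_low) auto
  next
    case 2
    have ca: "a i \<in> carrier G" "s i \<in> carrier G" using i by (auto simp: a_closed s_closed)
    have "s j \<otimes> \<sigma> i = \<one> \<otimes> (\<one> \<otimes> s i)" using 2 i c ca by (simp add: s_step[of i])
    moreover have "s j \<otimes> inv (\<sigma> i) = inv (a i) \<otimes> (\<one> \<otimes> s i)"
    proof -
      have "a i \<otimes> (s j \<otimes> inv (\<sigma> i)) = s i"
        using replace2[OF a_pass_s[OF i], of "inv (\<sigma> i)"] c ca 2 i by (simp add: m_assoc s_step[of i])
      then show ?thesis using c ca by (metis inv_closed inv_mult_cancel l_one m_closed)
    qed
    moreover have "i \<le> Suc N" using i by simp
    ultimately show ?thesis using one inv_a_in_A[OF i]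
      by (cases b) (simp_all only: if_True if_False, blast+)
  next
    case 3
    have cs: "s (Suc i) \<in> carrier G" "a i \<in> carrier G" using i by (auto simp: s_closed a_closed)
    have "s j \<otimes> \<sigma> i = a i \<otimes> (\<one> \<otimes> s (Suc i))"
      using 3 i c cs by (simp add: s_step[of i] a_pass_s m_assoc)
    moreover have "s j \<otimes> inv (\<sigma> i) = \<one> \<otimes> (\<one> \<otimes> s (Suc i))"
      using 3 i c cs by (simp add: s_step[of i] m_assoc)
    moreover have "Suc i \<le> Suc N" using i by simp
    ultimately show ?thesis using one a_in_A[OF i]
      by (cases b) (simp_all only: if_True if_False, blast+)
  next
    case 4
    then obtain k where k: "i = Suc k" by (cases i) auto
    then show ?thesis using 4 i by (intro pass[of k]) (auto intro: s_pass_high)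
  qed
qed

theorem normal_form:
  assumes "w \<in> words {..N}"
  shows "\<exists>u \<in> words {..N}. \<exists>v \<in> words {..<N}. \<exists>j \<le> Suc N.
    word_val G \<sigma> w = word_val G a u \<otimes> (word_val G \<sigma> v \<otimes> s j)"
proof -
  have \<sigma>: "\<sigma> \<in> {..N} \<rightarrow> carrier G" "\<sigma> \<in> {..<N} \<rightarrow> carrier G" and a: "a \<in> {..N} \<rightarrow> carrier G"
    by (auto simp: \<sigma>_closed a_closed)
  have "\<exists>h \<in> A. \<exists>y \<in> B. \<exists>j \<le> Suc N. word_val G \<sigma> w = h \<otimes> (y \<otimes> s j)"
    using assms
  proof (induction w rule: rev_induct)
    case Nil
    then show ?case
      by (intro bexI[of _ \<one>] exI[of _ "Suc N"]) (auto intro: generate.one simp: s_last)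
  next
    case (snoc l w)
    obtain i b where l: "l = (i, b)" by (cases l)
    have i: "i \<le> N" and w: "w \<in> words {..N}" using snoc.prems by (auto simp: l words_append_iff)
    obtain h y j where h: "h \<in> A" "y \<in> B" "j \<le> Suc N" "word_val G \<sigma> w = h \<otimes> (y \<otimes> s j)"
      using snoc.IH[OF w] by blast
    obtain h' y' j' where h': "h' \<in> A" "y' \<in> B" "j' \<le> Suc N"
      "s j \<otimes> (if b then \<sigma> i else inv (\<sigma> i)) = h' \<otimes> (y' \<otimes> s j')"
      using s_times_generator[OF h(3) i] by blast
    obtain h'' where h'': "h'' \<in> A" "y \<otimes> h' = h'' \<otimes> y" using B_pass_A[OF h(2) h'(1)] by blast
    have c: "h \<in> carrier G" "y \<in> carrier G" "s j \<in> carrier G" "h' \<in> carrier G" "y' \<in> carrier G"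
      "s j' \<in> carrier G" "h'' \<in> carrier G" "\<sigma> i \<in> carrier G"
      using h h' h'' i by (auto simp: A_carrier B_carrier s_closed \<sigma>_closed)
    have "word_val G \<sigma> (w @ [l]) = h \<otimes> (y \<otimes> (s j \<otimes> (if b then \<sigma> i else inv (\<sigma> i))))"
      using c w i h(4) by (simp add: l word_val_append[OF w _ \<sigma>(1)] words_Nil m_assoc)
    also have "\<dots> = h \<otimes> (y \<otimes> (h' \<otimes> (y' \<otimes> s j')))" unfolding h'(4) ..
    also have "\<dots> = (h \<otimes> h'') \<otimes> ((y \<otimes> y') \<otimes> s j')"
      using replace2[OF h''(2), of "y' \<otimes> s j'"] c by (simp add: m_assoc)
    finally show ?case
      using generate.eng[OF h(1) h''(1)] generate.eng[OF h(2) h'(2)] h'(3) by blast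
  qed
  then show ?thesis using generate_word_val[OF a] generate_word_val[OF \<sigma>(2)] by metis
qed

end

section \<open>The Hurwitz action\<close>

text \<open>
  A word acts on the right, letter by letter, so that for the tuple of free generators the braid
  product corresponds to composition of automorphisms in the same order.
\<close>

definition hurwitz_step :: "('g, 'm) monoid_scheme \<Rightarrow> nat \<times> bool \<Rightarrow> (nat \<Rightarrow> 'g) \<Rightarrow> nat \<Rightarrow> 'g"
  where "hurwitz_step G l g = (case l of (k, b) \<Rightarrow>
    if b then g(k := g (Suc k), Suc k := inv\<^bsub>G\<^esub> g (Suc k) \<otimes>\<^bsub>G\<^esub> (g k \<otimes>\<^bsub>G\<^esub> g (Suc k)))
    else g(k := g k \<otimes>\<^bsub>G\<^esub> (g (Suc k) \<otimes>\<^bsub>G\<^esub> inv\<^bsub>G\<^esub> g k), Suc k := g k))"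

fun hurwitz :: "('g, 'm) monoid_scheme \<Rightarrow> (nat \<Rightarrow> 'g) \<Rightarrow> nat word \<Rightarrow> nat \<Rightarrow> 'g"
  where
    "hurwitz G g [] = g"
  | "hurwitz G g (l # w) = hurwitz G (hurwitz_step G l g) w"

lemma hurwitz_append: "hurwitz G g (u @ v) = hurwitz G (hurwitz G g u) v"
  by (induction u arbitrary: g) auto

lemma hurwitz_cong:
  assumes "w \<in> words {..<m}" "\<And>i. i \<le> m \<Longrightarrow> g i = g' i" "i \<le> m"
  shows "hurwitz G g w i = hurwitz G g' w i"
  using assms(1,2)
proof (induction w arbitrary: g g')
  case (Cons l w)
  obtain k b where l: "l = (k, b)" by (cases l)
  have k: "k < m" and w: "w \<in> words {..<m}" using Cons.prems(1) by (auto simp: l)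
  show ?case unfolding hurwitz.simps
    using k Cons.prems(2) by (intro Cons.IH[OF w]) (auto simp: hurwitz_step_def l)
qed (use assms(3) in auto)

lemma hurwitz_beyond: "w \<in> words {..<m} \<Longrightarrow> m < i \<Longrightarrow> hurwitz G g w i = g i"
proof (induction w arbitrary: g)
  case (Cons l w)
  then show ?case by (cases l) (auto simp: hurwitz_step_def)
qed simp

context group
begin

lemma hurwitz_step_closed:
  "g \<in> UNIV \<rightarrow> carrier G \<Longrightarrow> hurwitz_step G l g \<in> UNIV \<rightarrow> carrier G"
  by (auto simp: hurwitz_step_def Pi_iff split: prod.splits)

lemma hurwitz_closed: "g \<in> UNIV \<rightarrow> carrier G \<Longrightarrow> hurwitz G g w \<in> UNIV \<rightarrow> carrier G"
  by (induction w arbitrary: g) (simp_all add: hurwitz_step_closed)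

lemma hurwitz_step_cancel:
  assumes "g \<in> UNIV \<rightarrow> carrier G"
  shows "hurwitz_step G (k, \<not> b) (hurwitz_step G (k, b) g) = g"
proof -
  have "g k \<in> carrier G" "g (Suc k) \<in> carrier G" using assms by auto
  then show ?thesis
    by (cases b) (auto simp: hurwitz_step_def fun_eq_iff m_assoc inv_mult_cancel mult_inv_cancel
        inv_mult_group)
qed

lemma hurwitz_braid_relation:
  assumes g: "g \<in> UNIV \<rightarrow> carrier G" and uv: "(u, v) \<in> braid_relations n"
  shows "hurwitz G g u = hurwitz G g v"
proof -
  have c: "g i \<in> carrier G" for i using g by auto
  consider i j where "u = [(i, True), (j, True)]" "v = [(j, True), (i, True)]" "i + 2 \<le> j"
    | i where "u = [(i, True), (i + 1, True), (i, True)]" "v = [(i + 1, True), (i, True), (i + 1, True)]"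
    using uv unfolding braid_relations_def by blast
  then show ?thesis
  proof cases
    case 1
    then show ?thesis by (auto simp: hurwitz_step_def fun_eq_iff)
  next
    case 2
    then show ?thesis using c
      by (auto simp: hurwitz_step_def fun_eq_iff m_assoc inv_mult_group inv_mult_cancel mult_inv_cancel)
  qed
qed

lemma hurwitz_rel:
  assumes "(u, v) \<in> word_rel X (braid_relations n)" "g \<in> UNIV \<rightarrow> carrier G"
  shows "hurwitz G g u = hurwitz G g v"
  using assms
proof (induction arbitrary: g rule: word_rel.induct)
  case (append u v u' v')
  then show ?case using hurwitz_closed by (simp add: hurwitz_append)
next
  case (cancel x b)
  then show ?case by (simp add: hurwitz_step_cancel)
next
  case (relator u v)
  then show ?case using hurwitz_braid_relation by blast
qed auto

lemma hurwitz_word_inv: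
  assumes "g \<in> UNIV \<rightarrow> carrier G"
  shows "hurwitz G (hurwitz G g w) (word_inv w) = g"
proof -
  have "w \<in> words UNIV" by (auto simp: words_def)
  from hurwitz_rel[OF word_inv_cancel[OF this] assms] show ?thesis by (simp add: hurwitz_append)
qed

end

text \<open>
  Naturality reduces the action on all tuples to that on the universal tuple of free generators.
\<close>

lemma hurwitz_natural:
  assumes "group_hom G H h" "g \<in> UNIV \<rightarrow> carrier G"
  shows "h \<circ> hurwitz G g w = hurwitz H (h \<circ> g) w"
proof -
  interpret group_hom G H h by fact
  show ?thesis using assms(2)
  proof (induction w arbitrary: g)
    case (Cons l w)
    obtain k b where l: "l = (k, b)" by (cases l)
    have c: "g i \<in> carrier G" for i using Cons.prems by auto
    have "h \<circ> hurwitz_step G l g = hurwitz_step H l (h \<circ> g)"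
      using c by (auto simp: hurwitz_step_def l fun_eq_iff)
    then show ?case
      using Cons.IH[OF G.hurwitz_step_closed[OF Cons.prems]] by (simp only: hurwitz.simps)
  qed simp
qed

section \<open>Faithfulness of the Hurwitz action\<close>

text \<open>
  Words for the elements \<open>s\<^sub>j\<close> and \<open>a\<^sub>j\<close> of the normal form.
\<close>

definition shift_word :: "nat \<Rightarrow> nat \<Rightarrow> nat word"
  where "shift_word N j = map (\<lambda>i. (i, True)) (rev [j..<Suc N])"

definition push_word :: "nat \<Rightarrow> nat \<Rightarrow> nat word"
  where "push_word N j = map (\<lambda>i. (i, False)) [j..<N] @ [(N, True), (N, True)] @
    map (\<lambda>i. (i, True)) (rev [j..<N])"

lemma shift_word_last: "shift_word N (Suc N) = []"
  by (simp add: shift_word_def)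

lemma shift_word_step: "j \<le> N \<Longrightarrow> shift_word N j = shift_word N (Suc j) @ [(j, True)]"
  by (simp add: shift_word_def upt_conv_Cons del: upt_Suc)

lemma push_word_last: "push_word N N = [(N, True), (N, True)]"
  by (simp add: push_word_def)

lemma push_word_step: "j < N \<Longrightarrow> push_word N j = (j, False) # push_word N (Suc j) @ [(j, True)]"
  by (simp add: push_word_def upt_conv_Cons)

lemma shift_word_words: "shift_word N j \<in> words {..<Suc N}"
  by (auto simp: shift_word_def words_def in_lists_conv_set)

lemma push_word_words: "j \<le> N \<Longrightarrow> push_word N j \<in> words {..<Suc N}"
  by (auto simp: push_word_def words_def in_lists_conv_set)

lemma braid_group_elements:
  "braid_elements (braid_group (Suc (Suc N))) N
    (\<lambda>i. word_rel {..<Suc N} (braid_relations (Suc (Suc N))) `` {[(i, True)]})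
    (\<lambda>j. word_rel {..<Suc N} (braid_relations (Suc (Suc N))) `` {shift_word N j})
    (\<lambda>j. word_rel {..<Suc N} (braid_relations (Suc (Suc N))) `` {push_word N j})"
proof -
  define R where "R = braid_relations (Suc (Suc N))"
  define X where "X = {..<Suc N}"
  interpret P: group "presented_group X R" by (rule group_presented_group)
  have B: "braid_group (Suc (Suc N)) = presented_group X R" by (simp add: braid_group_def R_def X_def)
  have sw: "shift_word N j \<in> words X" for j using shift_word_words by (simp add: X_def)
  have pw: "push_word N j \<in> words X" if "j \<le> N" for j using push_word_words[OF that] by (simp add: X_def)
  have l: "[(i, b)] \<in> words X" if "i \<le> N" for i b using that by (simp add: X_def words_Nil)
  show ?thesis unfolding B R_def[symmetric] X_def[symmetric]
  proof (unfold_locales, goal_cases)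
    case (1 i)
    then show ?case by (intro class_in_carrier l)
  next
    case (2 i j)
    then have "([(i, True), (j, True)], [(j, True), (i, True)]) \<in> word_rel X R"
      by (intro word_rel.relator) (auto simp: R_def braid_relations_def X_def words_Nil)
    then show ?case using 2 l by (simp add: presented_group_mult class_eq_iff words_Nil X_def)
  next
    case (3 i)
    then have "([(i, True), (i + 1, True), (i, True)], [(i + 1, True), (i, True), (i + 1, True)]) \<in> word_rel X R"
      by (intro word_rel.relator) (auto simp: R_def braid_relations_def X_def words_Nil)
    then show ?case using 3 l by (simp add: presented_group_mult class_eq_iff words_Nil X_def)
  next
    case 4
    show ?case by (simp add: shift_word_last one_presented_group)
  next
    case (5 j)
    then show ?case by (simp add: presented_group_mult[OF sw l] shift_word_step)
  next
    case 6
    show ?case using presented_group_mult[OF l[of N True] l[of N True], of R] by (simp add: push_word_last)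
  next
    case (7 j)
    have "word_rel X R `` {[(j, False)]} = inv\<^bsub>presented_group X R\<^esub> (word_rel X R `` {[(j, True)]})"
      using class_word_inv[OF l[of j True], of R] 7 by simp
    moreover have "push_word N (Suc j) @ [(j, True)] \<in> words X"
      using 7 by (intro words_append pw l) auto
    ultimately show ?case using 7
      by (simp add: presented_group_mult[OF pw l] presented_group_mult[OF l] push_word_step
        flip: \<open>word_rel X R `` {[(j, False)]} = _\<close>)
  qed
qed

text \<open>
  The normal form in terms of words; \<open>u\<close> can be taken reduced because freely equal words have equal
  values.
\<close>

lemma braid_normal_form:
  assumes w: "w \<in> words {..<Suc N}"
  obtains u v j where "u \<in> words {..<Suc N}" "reduced u" "v \<in> words {..<N}" "j \<le> Suc N"
    "(w, word_subst (push_word N) u @ v @ shift_word N j) \<in>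
      word_rel {..<Suc N} (braid_relations (Suc (Suc N)))"
proof -
  define R where "R = braid_relations (Suc (Suc N))"
  define X where "X = {..<Suc N}"
  have B: "braid_group (Suc (Suc N)) = presented_group X R" by (simp add: braid_group_def R_def X_def)
  interpret braid_elements "presented_group X R" N "\<lambda>i. word_rel X R `` {[(i, True)]}"
    "\<lambda>j. word_rel X R `` {shift_word N j}" "\<lambda>j. word_rel X R `` {push_word N j}"
    using braid_group_elements[of N] unfolding B R_def[symmetric] X_def[symmetric] .
  have X: "{..N} = X" by (simp add: X_def lessThan_Suc_atMost)
  obtain u v j where *: "u \<in> words X" "v \<in> words {..<N}" "j \<le> Suc N"
    "word_val (presented_group X R) (\<lambda>i. word_rel X R `` {[(i, True)]}) w =
      word_val (presented_group X R) (\<lambda>j. word_rel X R `` {push_word N j}) u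
      \<otimes>\<^bsub>presented_group X R\<^esub>
      (word_val (presented_group X R) (\<lambda>i. word_rel X R `` {[(i, True)]}) v
      \<otimes>\<^bsub>presented_group X R\<^esub> word_rel X R `` {shift_word N j})"
    using normal_form[of w] w unfolding X X_def[symmetric] by blast
  obtain u' where u': "u' \<in> words X" "word_rel X {} `` {u} = word_rel X {} `` {u'}" "reduced u'"
    by (rule free_class_reduced[OF class_in_carrier[OF *(1), of "{}"]])
  have a: "(\<lambda>j. word_rel X R `` {push_word N j}) \<in> X \<rightarrow> carrier (presented_group X R)"
    using a_closed by (simp add: X_def Pi_iff)
  have "(u, u') \<in> word_rel X {}" using u'(1,2) *(1) by (simp only: class_eq_iff)
  then have "word_val (presented_group X R) (\<lambda>j. word_rel X R `` {push_word N j}) u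
      = word_val (presented_group X R) (\<lambda>j. word_rel X R `` {push_word N j}) u'"
    by (rule word_val_rel[OF a, rotated]) simp
  also have "\<dots> = word_rel X R `` {word_subst (push_word N) u'}"
    using u'(1) by (rule word_val_class) (use push_word_words in \<open>simp add: X_def\<close>)
  finally have e: "word_val (presented_group X R) (\<lambda>j. word_rel X R `` {push_word N j}) u
      = word_rel X R `` {word_subst (push_word N) u'}" .
  have v: "v \<in> words X" using *(2) by (rule words_mono[rotated]) (auto simp: X_def)
  have su: "word_subst (push_word N) u' \<in> words X"
    using u'(1) by (rule word_subst_words) (use push_word_words in \<open>simp add: X_def\<close>)
  have sj: "shift_word N j \<in> words X" using shift_word_words by (simp add: X_def)
  have wX: "w \<in> words X" using w by (simp add: X_def)
  have "word_rel X R `` {w} = word_rel X R `` {word_subst (push_word N) u' @ v @ shift_word N j}"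
    using *(4) unfolding e word_val_generators[OF wX] word_val_generators[OF v]
    by (simp add: presented_group_mult su v sj words_append)
  then have "(w, word_subst (push_word N) u' @ v @ shift_word N j) \<in> word_rel X R"
    using wX su v sj by (simp add: class_eq_iff words_append)
  then show ?thesis using that u' *(2,3) unfolding X_def R_def by blast
qed

text \<open>
  A strand labelled \<open>1\<close> acts trivially on the strands that it passes and is not changed by them.
\<close>

lemma (in group) hurwitz_push_trivial:
  assumes "j \<le> N" "g \<in> UNIV \<rightarrow> carrier G" "g (Suc N) = \<one>"
  shows "hurwitz G g (push_word N j) = g"
  using assms
proof (induction arbitrary: g rule: inc_induct)
  case base
  then have "g N \<in> carrier G" by auto
  then show ?case using base by (auto simp: push_word_last hurwitz_step_def fun_eq_iff)
next
  case (step j)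
  let ?g = "hurwitz_step G (j, False) g"
  have "?g (Suc N) = \<one>" using step by (simp add: hurwitz_step_def)
  then have "hurwitz G ?g (push_word N (Suc j)) = ?g"
    using step hurwitz_step_closed by blast
  then show ?case using step hurwitz_step_cancel[of g j False]
    by (simp add: push_word_step hurwitz_append)
qed

lemma (in group) hurwitz_push_subst_trivial:
  assumes "u \<in> words {..<Suc N}" "g \<in> UNIV \<rightarrow> carrier G" "g (Suc N) = \<one>"
  shows "hurwitz G g (word_subst (push_word N) u) = g"
  using assms(1)
proof (induction u rule: word_inv.induct)
  case (2 j b u)
  then have "hurwitz G g (push_word N j) = g" using assms by (intro hurwitz_push_trivial) auto
  moreover from this have "hurwitz G g (word_inv (push_word N j)) = g"
    using hurwitz_word_inv[OF assms(2), of "push_word N j"] by simp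
  ultimately show ?case using 2 by (simp add: hurwitz_append)
qed simp

lemma hurwitz_shift: "j \<le> Suc N \<Longrightarrow> hurwitz G g (shift_word N j) j = g (Suc N)"
proof (induction rule: inc_induct)
  case (step j)
  then show ?case by (simp add: shift_word_step hurwitz_append hurwitz_step_def)
qed (simp add: shift_word_last)

text \<open>
  The semidirect product \<open>\<int>\<^sup>2 \<rtimes> SL\<^sub>2(\<int>)\<close> of affine maps, with elements \<open>(M, x, y)\<close> of linear part \<open>M\<close>
  and translation part \<open>(x, y)\<close>.
\<close>

definition affine_SL2 :: "(int mat2 \<times> int \<times> int) monoid"
  where "affine_SL2 = \<lparr>carrier = {(M, x, y). mat2_det M = 1},
    monoid.mult = (\<lambda>(M, x, y) (N, u, v).
      (mat2_mult M N, x + (e11 M * u + e12 M * v), y + (e21 M * u + e22 M * v))),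
    one = (Mat2 1 0 0 1, 0, 0)\<rparr>"

lemma affine_SL2_simps [simp]:
  "p \<in> carrier affine_SL2 \<longleftrightarrow> mat2_det (fst p) = 1"
  "(M, x, y) \<otimes>\<^bsub>affine_SL2\<^esub> (N, u, v) =
    (mat2_mult M N, x + (e11 M * u + e12 M * v), y + (e21 M * u + e22 M * v))"
  "\<one>\<^bsub>affine_SL2\<^esub> = (Mat2 1 0 0 1, 0, 0)"
  by (auto simp: affine_SL2_def split: prod.splits)

lemma group_affine_SL2: "group affine_SL2"
proof (rule groupI)
  fix p q r assume "p \<in> carrier affine_SL2" "q \<in> carrier affine_SL2" "r \<in> carrier affine_SL2"
  then show "p \<otimes>\<^bsub>affine_SL2\<^esub> q \<in> carrier affine_SL2"
    by (cases p, cases q) (auto simp: mat2_det_mult)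
  show "p \<otimes>\<^bsub>affine_SL2\<^esub> q \<otimes>\<^bsub>affine_SL2\<^esub> r = p \<otimes>\<^bsub>affine_SL2\<^esub> (q \<otimes>\<^bsub>affine_SL2\<^esub> r)"
    by (cases p, cases q, cases r) (auto simp: mat2_mult_def algebra_simps)
next
  show "\<one>\<^bsub>affine_SL2\<^esub> \<in> carrier affine_SL2" by (simp add: mat2_det_def)
  fix p assume p: "p \<in> carrier affine_SL2"
  then show "\<one>\<^bsub>affine_SL2\<^esub> \<otimes>\<^bsub>affine_SL2\<^esub> p = p" by (cases p) (auto simp: mat2_mult_def)
  obtain M x y where M: "p = (M, x, y)" by (cases p) auto
  let ?N = "mat2_adj M"
  show "\<exists>q \<in> carrier affine_SL2. q \<otimes>\<^bsub>affine_SL2\<^esub> p = \<one>\<^bsub>affine_SL2\<^esub>"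
    using p by (intro bexI[of _ "(?N, - (e11 ?N * x + e12 ?N * y), - (e21 ?N * x + e22 ?N * y))"])
      (auto simp: M mat2_adj_mult mat2_det_adj)
qed

interpretation affine_SL2: group affine_SL2 by (rule group_affine_SL2)

lemma fst_affine_SL2: "group_hom affine_SL2 SL2 fst"
  by (auto simp: group_hom_def group_hom_axioms_def group_affine_SL2 group_SL2 hom_def)

lemma translations_commute:
  "fst p = Mat2 1 0 0 1 \<Longrightarrow> fst q = Mat2 1 0 0 1 \<Longrightarrow> p \<otimes>\<^bsub>affine_SL2\<^esub> q = q \<otimes>\<^bsub>affine_SL2\<^esub> p"
  by (cases p, cases q) auto

text \<open>
  Conjugation acts on translations through the linear part alone.
\<close>

lemma conjugate_translation:
  assumes "mat2_det (fst p) = 1" "q = (Mat2 1 0 0 1, x, y)"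
  shows "p \<otimes>\<^bsub>affine_SL2\<^esub> (q \<otimes>\<^bsub>affine_SL2\<^esub> inv\<^bsub>affine_SL2\<^esub> p) =
    (Mat2 1 0 0 1, e11 (fst p) * x + e12 (fst p) * y, e21 (fst p) * x + e22 (fst p) * y)"
    (is "_ = ?r")
proof -
  have c: "p \<in> carrier affine_SL2" "q \<in> carrier affine_SL2" "?r \<in> carrier affine_SL2"
    using assms by (auto simp: mat2_det_def)
  have "p \<otimes>\<^bsub>affine_SL2\<^esub> q = ?r \<otimes>\<^bsub>affine_SL2\<^esub> p"
    by (cases p) (auto simp: assms mat2_mult_def)
  then have "(p \<otimes>\<^bsub>affine_SL2\<^esub> q) \<otimes>\<^bsub>affine_SL2\<^esub> inv\<^bsub>affine_SL2\<^esub> p = ?r"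
    using c by (simp only: affine_SL2.m_assoc affine_SL2.r_inv affine_SL2.inv_closed affine_SL2.r_one)
  then show ?thesis using c by (simp only: affine_SL2.m_assoc affine_SL2.inv_closed)
qed

text \<open>
  For \<open>j = N\<close> and entries \<open>p, q\<close> at the last two places the result is \<open>q\<inverse> r q\<close> with
  \<open>r = p\<inverse> q p\<close>; both \<open>q\<close> and \<open>r\<close> are translations, so this is \<open>r\<close>.  For smaller \<open>j\<close> the
  letter that precedes \<open>a\<^sub>j\<^sub>+\<^sub>1\<close> in \<open>a\<^sub>j\<close> puts \<open>g\<^sub>j\<close> at place \<open>j + 1\<close>.
\<close>

lemma hurwitz_push_last:
  assumes "j \<le> N" "g \<in> UNIV \<rightarrow> carrier affine_SL2" "fst (g (Suc N)) = Mat2 1 0 0 1"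
  shows "hurwitz affine_SL2 g (push_word N j) (Suc N) =
    inv\<^bsub>affine_SL2\<^esub> g j \<otimes>\<^bsub>affine_SL2\<^esub> (g (Suc N) \<otimes>\<^bsub>affine_SL2\<^esub> g j)"
  using assms
proof (induction arbitrary: g rule: inc_induct)
  case base
  interpret group_hom affine_SL2 SL2 fst by (rule fst_affine_SL2)
  let ?m = "monoid.mult affine_SL2" and ?i = "m_inv affine_SL2"
  define p q r where "p = g N" and "q = g (Suc N)" and "r = ?m (?i p) (?m q p)"
  have c: "p \<in> carrier affine_SL2" "q \<in> carrier affine_SL2" "r \<in> carrier affine_SL2"
    using base(1) by (auto simp: p_def q_def r_def simp del: affine_SL2_simps)
  have q1: "fst q = \<one>\<^bsub>SL2\<^esub>" using base(2) by (simp add: q_def)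
  have "fst p \<in> carrier SL2" using c by simp
  then have "fst r = \<one>\<^bsub>SL2\<^esub>"
    unfolding r_def using c q1 by (simp only: hom_mult hom_inv affine_SL2.m_closed affine_SL2.inv_closed SL2.l_one SL2.l_inv)
  then have rq: "?m r q = ?m q r" using q1 by (intro translations_commute) simp_all
  have "hurwitz affine_SL2 g (push_word N N) (Suc N)
      = ?m (?i (?m (?i q) (?m p q))) (?m q (?m (?i q) (?m p q)))"
    by (simp add: push_word_last hurwitz_step_def p_def q_def)
  also have "\<dots> = ?m (?i q) (?m r q)"
    using c by (simp only: r_def affine_SL2.inv_mult_group affine_SL2.inv_inv affine_SL2.m_assoc affine_SL2.mult_inv_cancel affine_SL2.inv_mult_cancel
        affine_SL2.m_closed affine_SL2.inv_closed)
  also have "\<dots> = r" using c by (simp only: rq affine_SL2.inv_mult_cancel)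
  finally show ?case by (simp only: r_def p_def q_def)
next
  case (step j)
  let ?g = "hurwitz_step affine_SL2 (j, False) g"
  have "?g (Suc N) = g (Suc N)" "?g (Suc j) = g j" using step by (simp_all add: hurwitz_step_def)
  moreover have "?g \<in> UNIV \<rightarrow> carrier affine_SL2" using step by (intro affine_SL2.hurwitz_step_closed)
  ultimately have "hurwitz affine_SL2 ?g (push_word N (Suc j)) (Suc N) =
      inv\<^bsub>affine_SL2\<^esub> g j \<otimes>\<^bsub>affine_SL2\<^esub> (g (Suc N) \<otimes>\<^bsub>affine_SL2\<^esub> g j)"
    using step by metis
  then show ?case using step by (simp add: push_word_step hurwitz_append hurwitz_step_def[of _ "(j, True)"])
qed

text \<open>
  Modulo translations the last entry is trivial, so none of the \<open>a\<^sub>j\<close> changes the linear parts of the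
  entries.  The successive conjugations of the last entry therefore multiply to the word \<open>u\<close> in the
  linear parts of the original tuple.
\<close>

lemma hurwitz_push_subst_last:
  assumes "u \<in> words {..<Suc N}" "g \<in> UNIV \<rightarrow> carrier affine_SL2"
    and "g (Suc N) = (Mat2 1 0 0 1, x, y)"
    and "hurwitz affine_SL2 g (word_subst (push_word N) u) (Suc N) = (M, x', y')"
  defines "P \<equiv> word_val SL2 (fst \<circ> g) u"
  shows "x = e11 P * x' + e12 P * y' \<and> y = e21 P * x' + e22 P * y'"
  using assms(1-4) unfolding P_def
proof (induction u arbitrary: g x y rule: word_inv.induct)
  case 1
  then show ?case by auto
next
  case (2 j b u)
  interpret group_hom affine_SL2 SL2 fst by (rule fst_affine_SL2)
  let ?m = "monoid.mult affine_SL2" and ?i = "m_inv affine_SL2"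
  let ?w = "if b then push_word N j else word_inv (push_word N j)"
  define g1 where "g1 = hurwitz affine_SL2 g ?w"
  have j: "j \<le> N" and u: "u \<in> words {..<Suc N}" using 2(2) by auto
  have g1c: "g1 \<in> UNIV \<rightarrow> carrier affine_SL2" unfolding g1_def using 2(3) by (rule affine_SL2.hurwitz_closed)
  have fg1: "fst \<circ> g1 = fst \<circ> g"
  proof -
    have fg: "fst \<circ> g \<in> UNIV \<rightarrow> carrier SL2" using 2(3) by (auto simp: Pi_iff)
    then have t: "hurwitz SL2 (fst \<circ> g) (push_word N j) = fst \<circ> g"
      using j 2(4) by (intro SL2.hurwitz_push_trivial) auto
    then show ?thesis
      using SL2.hurwitz_word_inv[OF fg, of "push_word N j"]
      by (simp add: g1_def hurwitz_natural[OF fst_affine_SL2 2(3)])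
  qed
  have f: "fst (g1 i) = fst (g i)" for i using fun_cong[OF fg1, of i] by simp
  have d: "mat2_det (fst (g i)) = 1" "mat2_det (fst (g1 i)) = 1" for i using 2(3) g1c by (auto simp: Pi_iff)
  have c: "g i \<in> carrier affine_SL2" "g1 i \<in> carrier affine_SL2" for i using d by simp_all
  have l1: "fst (g1 (Suc N)) = Mat2 1 0 0 1" using f[of "Suc N"] 2(4) by simp
  then obtain x1 y1 where g1l: "g1 (Suc N) = (Mat2 1 0 0 1, x1, y1)" by (cases "g1 (Suc N)") auto
  let ?M = "fst (g j)"
  let ?L = "if b then ?M else mat2_adj ?M"
  have xy: "x = e11 ?L * x1 + e12 ?L * y1 \<and> y = e21 ?L * x1 + e22 ?L * y1"
  proof (cases b)
    case True
    have "g1 (Suc N) = ?m (?i (g j)) (?m (g (Suc N)) (g j))"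
      using hurwitz_push_last[OF j 2(3)] 2(4) True by (simp add: g1_def)
    then have "?m (g j) (?m (g1 (Suc N)) (?i (g j))) = g (Suc N)"
      using c by (simp only: affine_SL2.m_assoc affine_SL2.mult_inv_cancel affine_SL2.r_inv affine_SL2.r_one affine_SL2.m_closed affine_SL2.inv_closed)
    then show ?thesis using conjugate_translation[OF d(1)[of j] g1l] 2(4) True by simp
  next
    case False
    have "hurwitz affine_SL2 g1 (push_word N j) = g"
      using affine_SL2.hurwitz_word_inv[OF 2(3), of "word_inv (push_word N j)"] False
      by (simp add: g1_def word_inv_inv)
    then have "g (Suc N) = ?m (?i (g1 j)) (?m (g1 (Suc N)) (g1 j))"
      using hurwitz_push_last[OF j g1c l1] by simp
    then have "?m (g1 j) (?m (g (Suc N)) (?i (g1 j))) = g1 (Suc N)"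
      using c by (simp only: affine_SL2.m_assoc affine_SL2.mult_inv_cancel affine_SL2.r_inv affine_SL2.r_one affine_SL2.m_closed affine_SL2.inv_closed)
    then have "x1 = e11 ?M * x + e12 ?M * y" "y1 = e21 ?M * x + e22 ?M * y"
      using conjugate_translation[OF d(2)[of j] 2(4)] g1l by (simp_all add: f)
    then have "e22 ?M * x1 - e12 ?M * y1 = mat2_det ?M * x" "e11 ?M * y1 - e21 ?M * x1 = mat2_det ?M * y"
      by (simp_all add: mat2_det_def algebra_simps)
    then show ?thesis using d(1)[of j] False by (simp add: mat2_adj_def)
  qed
  have "hurwitz affine_SL2 g1 (word_subst (push_word N) u) (Suc N) = (M, x', y')"
    using 2(5) by (simp add: hurwitz_append g1_def)
  from 2(1)[OF u g1c g1l this]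
  have "x1 = e11 (word_val SL2 (fst \<circ> g) u) * x' + e12 (word_val SL2 (fst \<circ> g) u) * y' \<and>
    y1 = e21 (word_val SL2 (fst \<circ> g) u) * x' + e22 (word_val SL2 (fst \<circ> g) u) * y'"
    unfolding fg1 .
  moreover have wv: "word_val SL2 (fst \<circ> g) ((j, b) # u) = mat2_mult ?L (word_val SL2 (fst \<circ> g) u)"
    using d(1)[of j] by (cases b) (simp_all add: inv_SL2)
  ultimately show ?case using xy unfolding wv
    by (simp add: mat2_mult_def algebra_simps split del: if_split)
qed

lemma word_rel_mono:
  assumes "X \<subseteq> Y" "R \<subseteq> S" "(u, v) \<in> word_rel X R"
  shows "(u, v) \<in> word_rel Y S"
  using assms(3)
proof (induction rule: word_rel.induct)
  case (relator u v)
  then show ?case using assms(1,2) words_mono by (intro word_rel.relator) blast+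
next
  case (trans u v w)
  then show ?case using word_rel.trans by blast
qed (use assms(1) words_mono in \<open>blast intro: word_rel.refl word_rel.sym word_rel.append word_rel.cancel\<close>)+

lemma (in group) hurwitz_constant:
  assumes "w \<in> words {..<m}" "z \<in> carrier G" "\<And>i. i \<le> m \<Longrightarrow> g i = z"
  shows "hurwitz G g w = g"
  using assms(1)
proof (induction w)
  case (Cons l w)
  obtain k b where l: "l = (k, b)" by (cases l)
  have "k < m" "w \<in> words {..<m}" using Cons.prems by (auto simp: l)
  moreover from this have "g k = z" "g (Suc k) = z" using assms(3) by auto
  then have "hurwitz_step G l g = g"
    using assms(2) by (auto simp: l hurwitz_step_def fun_eq_iff inv_mult_cancel)
  ultimately show ?case using Cons.IH by simp
qed simp

text \<open>
  Tuples in the single group \<open>\<int>\<^sup>2 \<rtimes> SL\<^sub>2(\<int>)\<close> detect every nontrivial braid.  The three steps of the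
  induction eliminate the factors \<open>s\<^sub>j\<close>, \<open>v\<close> and \<open>u\<close> of the normal form, in this order.
\<close>

theorem hurwitz_faithful:
  assumes "w \<in> words {..<m}"
    and "\<And>g i. g \<in> UNIV \<rightarrow> carrier affine_SL2 \<Longrightarrow> i \<le> m \<Longrightarrow> hurwitz affine_SL2 g w i = g i"
  shows "(w, []) \<in> word_rel {..<m} (braid_relations (Suc m))"
  using assms
proof (induction m arbitrary: w)
  case 0
  then have "w = []" by (auto simp: words_def)
  then show ?case by (auto intro: word_rel.refl simp: words_Nil)
next
  case (Suc N)
  define R where "R = braid_relations (Suc (Suc N))"
  let ?T = "UNIV \<rightarrow> carrier affine_SL2"
  let ?h = "hurwitz affine_SL2"
  obtain u v j where uvj: "u \<in> words {..<Suc N}" "reduced u" "v \<in> words {..<N}" "j \<le> Suc N"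
    and eq: "(w, word_subst (push_word N) u @ v @ shift_word N j) \<in> word_rel {..<Suc N} R"
    using braid_normal_form[OF Suc.prems(1)] unfolding R_def by metis
  have act: "?h (?h (?h g (word_subst (push_word N) u)) v) (shift_word N j) i = g i"
    if g: "g \<in> ?T" and i: "i \<le> Suc N" for g i
    using Suc.prems(2)[OF g i] affine_SL2.hurwitz_rel[OF eq[unfolded R_def] g]
    by (simp add: hurwitz_append)
  have jN: "j = Suc N"
  proof (rule ccontr)
    assume "j \<noteq> Suc N"
    \<comment> \<open>The entry \<open>1\<close> can be followed among equal entries \<open>z\<close>: only \<open>s\<^sub>j\<close> moves it.\<close>
    define z :: "int mat2 \<times> int \<times> int" where "z = (Mat2 1 0 0 1, 1, 0)"
    define g where "g = (\<lambda>i. if i = Suc N then \<one>\<^bsub>affine_SL2\<^esub> else z)"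
    have z: "z \<in> carrier affine_SL2" "z \<noteq> \<one>\<^bsub>affine_SL2\<^esub>" by (auto simp: z_def mat2_det_def)
    have g: "g \<in> ?T" using z(1) by (auto simp: g_def mat2_det_def)
    have "?h g (word_subst (push_word N) u) = g"
      using uvj(1) g by (rule affine_SL2.hurwitz_push_subst_trivial) (simp add: g_def)
    moreover have "?h g v = g"
      using uvj(3) z(1) by (rule affine_SL2.hurwitz_constant) (simp add: g_def)
    ultimately have "g (Suc N) = g j"
      using act[OF g uvj(4)] hurwitz_shift[OF uvj(4), of affine_SL2 g] by simp
    then show False using z(2) \<open>j \<noteq> Suc N\<close> by (simp add: g_def)
  qed
  then have act: "?h (?h g (word_subst (push_word N) u)) v i = g i"
    if "g \<in> ?T" "i \<le> Suc N" for g i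
    using act[OF that] by (simp add: shift_word_last)
  have "(v, []) \<in> word_rel {..<N} (braid_relations (Suc N))"
  proof (rule Suc.IH[OF uvj(3)])
    fix g :: "nat \<Rightarrow> int mat2 \<times> int \<times> int" and i
    assume g: "g \<in> ?T" and i: "i \<le> N"
    \<comment> \<open>The action of \<open>v\<close> does not involve the last entry, so that entry may be set to \<open>1\<close>.\<close>
    define g' where "g' = g(Suc N := \<one>\<^bsub>affine_SL2\<^esub>)"
    have g': "g' \<in> ?T" using g by (auto simp: g'_def Pi_iff mat2_det_def)
    have "?h g' (word_subst (push_word N) u) = g'"
      using uvj(1) g' by (rule affine_SL2.hurwitz_push_subst_trivial) (simp add: g'_def)
    then have "?h g' v i = g' i" using act[OF g', of i] i by simp
    moreover have "?h g v i = ?h g' v i"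
      using uvj(3) _ i by (rule hurwitz_cong) (simp add: g'_def)
    ultimately show "?h g v i = g i" using i by (simp add: g'_def)
  qed
  then have v: "(v, []) \<in> word_rel {..<Suc N} R"
    by (rule word_rel_mono[rotated 2]) (auto simp: R_def braid_relations_def)
  have "u = []"
  proof (rule ccontr)
    assume "u \<noteq> []"
    \<comment> \<open>The last entry is the translation by the first basis vector \<open>e\<close>.  Being fixed, it forces the matrix of \<open>u\<close> to fix \<open>e\<close>, so the lower left entry vanishes.\<close>
    define g :: "nat \<Rightarrow> int mat2 \<times> int \<times> int"
      where "g i = (if i = Suc N then (Mat2 1 0 0 1, 1, 0) else (ping_pong i, 0, 0))" for i
    have g: "g \<in> ?T" using det_ping_pong by (auto simp: g_def mat2_det_def)
    have "?h (?h g (word_subst (push_word N) u)) v (Suc N) = ?h g (word_subst (push_word N) u) (Suc N)"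
      using uvj(3) by (rule hurwitz_beyond) simp
    then have "?h g (word_subst (push_word N) u) (Suc N) = (Mat2 1 0 0 1, 1, 0)"
      using act[OF g, of "Suc N"] by (simp add: g_def)
    from hurwitz_push_subst_last[OF uvj(1) g _ this, of 1 0]
    have "e21 (word_val SL2 (fst \<circ> g) u) = 0" by (simp add: g_def)
    moreover have "word_val SL2 (fst \<circ> g) u = word_val SL2 ping_pong u"
      using uvj(1) by (induction u rule: word_inv.induct) (auto simp: g_def)
    ultimately show False using ping_pong_entry[OF uvj(2) \<open>u \<noteq> []\<close>] by simp
  qed
  then show ?case using word_rel.trans[OF eq] v jN by (simp add: R_def shift_word_last)
qed

section \<open>The Artin representation\<close>

text \<open>
  The Hurwitz action is defined on infinite tuples, hence the neutral entries beyond the generators;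
  braids on \<open>n\<close> strands do not touch them.
\<close>

definition free_tuple :: "nat \<Rightarrow> nat \<Rightarrow> nat word set"
  where "free_tuple n i = (if i < n then free_gen n i else \<one>\<^bsub>free_group n\<^esub>)"

definition artin :: "nat \<Rightarrow> nat word \<Rightarrow> nat word set \<Rightarrow> nat word set"
  where "artin n w = restrict (lift_val (free_group n) (hurwitz (free_group n) (free_tuple n) w))
    (carrier (free_group n))"

context
  fixes m n :: nat
  assumes n: "n = Suc m"
begin

interpretation F: group "free_group n" by (rule group_free_group)

lemma free_tuple_closed: "free_tuple n \<in> UNIV \<rightarrow> carrier (free_group n)"
  by (auto simp: free_tuple_def free_gen_carrier)

lemma artin_hom: "artin n w \<in> hom (free_group n) (free_group n)"
proof -
  have "hurwitz (free_group n) (free_tuple n) w \<in> {..<n} \<rightarrow> carrier (free_group n)"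
    using F.hurwitz_closed[OF free_tuple_closed, of w] by auto
  then have "lift_val (free_group n) (hurwitz (free_group n) (free_tuple n) w)
      \<in> hom (free_group n) (free_group n)"
    using F.lift_val_hom[of _ "{..<n}" "{}"] by (simp flip: free_group_def)
  then show ?thesis by (auto simp: artin_def hom_def)
qed

lemma artin_class:
  assumes "x \<in> words {..<n}"
  shows "artin n w (free_class n x) = word_val (free_group n) (hurwitz (free_group n) (free_tuple n) w) x"
proof -
  have "hurwitz (free_group n) (free_tuple n) w \<in> {..<n} \<rightarrow> carrier (free_group n)"
    using F.hurwitz_closed[OF free_tuple_closed, of w] by auto
  then have "lift_val (free_group n) (hurwitz (free_group n) (free_tuple n) w) (free_class n x) =
      word_val (free_group n) (hurwitz (free_group n) (free_tuple n) w) x"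
    by (intro F.lift_val_class assms) auto
  then show ?thesis using assms by (simp add: artin_def free_group_def class_in_carrier)
qed

lemma artin_gen: "i < n \<Longrightarrow> artin n w (free_gen n i) = hurwitz (free_group n) (free_tuple n) w i"
  using artin_class[of "[(i, True)]" w] F.hurwitz_closed[OF free_tuple_closed, of w]
  by (simp add: words_Nil Pi_iff)

text \<open>
  The automorphism of \<open>v\<close> maps the free generators to their image under \<open>v\<close>, so by naturality it
  takes the image of the generators under \<open>w\<close> to their image under \<open>vw\<close>.
\<close>

lemma artin_tuple:
  assumes "v \<in> words {..<m}"
  shows "artin n v \<circ> hurwitz (free_group n) (free_tuple n) w = hurwitz (free_group n) (free_tuple n) (v @ w)"
proof -
  interpret h: group_hom "free_group n" "free_group n" "artin n v"
    using artin_hom by (simp add: group_hom_def group_hom_axioms_def group_free_group)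
  have "(artin n v \<circ> free_tuple n) i = hurwitz (free_group n) (free_tuple n) v i" for i
  proof (cases "i < n")
    case False
    then have "m < i" by (simp add: n)
    then show ?thesis using False by (simp add: hurwitz_beyond[OF assms] free_tuple_def)
  qed (simp add: free_tuple_def artin_gen)
  then have "artin n v \<circ> free_tuple n = hurwitz (free_group n) (free_tuple n) v" by (rule ext)
  then show ?thesis
    using hurwitz_natural[OF h.group_hom_axioms free_tuple_closed, of w] by (simp add: hurwitz_append)
qed

lemma artin_append:
  assumes v: "v \<in> words {..<m}"
  shows "compose (carrier (free_group n)) (artin n v) (artin n w) = artin n (v @ w)"
proof (rule extensionalityI[of _ "carrier (free_group n)"])
  fix C assume "C \<in> carrier (free_group n)"
  then obtain x where x: "x \<in> words {..<n}" "C = free_class n x"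
    unfolding free_group_def by (rule presented_groupE)
  have f: "hurwitz (free_group n) (free_tuple n) w \<in> {..<n} \<rightarrow> carrier (free_group n)"
    using F.hurwitz_closed[OF free_tuple_closed, of w] by auto
  have "artin n v (artin n w C) =
      word_val (free_group n) (\<lambda>i. artin n v (hurwitz (free_group n) (free_tuple n) w i)) x"
    unfolding x(2) artin_class[OF x(1)]
    using word_val_hom[OF group_free_group group_free_group artin_hom f x(1)] by simp
  also have "\<dots> = artin n (v @ w) C"
    unfolding x(2) artin_class[OF x(1)] artin_tuple[OF v, symmetric] comp_def ..
  finally show "compose (carrier (free_group n)) (artin n v) (artin n w) C = artin n (v @ w) C"
    using \<open>C \<in> _\<close> by (simp add: compose_eq)
qed (simp_all add: artin_def)

lemma artin_Nil: "artin n [] = \<one>\<^bsub>AutoGroup (free_group n)\<^esub>"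
proof (rule extensionalityI[of _ "carrier (free_group n)"])
  fix C assume "C \<in> carrier (free_group n)"
  then obtain x where x: "x \<in> words {..<n}" "C = free_class n x"
    unfolding free_group_def by (rule presented_groupE)
  have "word_val (free_group n) (free_tuple n) x = word_val (free_group n) (free_gen n) x"
    using x(1) by (induction x rule: word_inv.induct) (auto simp: free_tuple_def)
  also have "\<dots> = C" unfolding x(2) free_group_def by (rule word_val_generators[OF x(1)])
  finally show "artin n [] C = \<one>\<^bsub>AutoGroup (free_group n)\<^esub> C"
    using artin_class[OF x(1), of "[]"] x(2) \<open>C \<in> _\<close> by (simp add: AutoGroup_def BijGroup_def)
qed (simp_all add: artin_def AutoGroup_def BijGroup_def)

lemma artin_rel:
  assumes "(u, v) \<in> word_rel {..<m} (braid_relations n)"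
  shows "artin n u = artin n v"
  using F.hurwitz_rel[OF assms free_tuple_closed] by (simp add: artin_def)

lemma artin_inverse:
  assumes "w \<in> words {..<m}"
  shows "compose (carrier (free_group n)) (artin n w) (artin n (word_inv w)) = \<one>\<^bsub>AutoGroup (free_group n)\<^esub>"
    "compose (carrier (free_group n)) (artin n (word_inv w)) (artin n w) = \<one>\<^bsub>AutoGroup (free_group n)\<^esub>"
  using artin_append[OF assms, of "word_inv w"] artin_append[OF word_inv_words[OF assms], of w]
    artin_rel[OF word_inv_cancel[OF assms]] artin_rel[OF word_inv_cancel[OF word_inv_words[OF assms]]]
  by (simp_all add: artin_Nil word_inv_inv)

lemma artin_auto:
  assumes w: "w \<in> words {..<m}"
  shows "artin n w \<in> auto (free_group n)"
proof -
  have "artin n w C \<in> carrier (free_group n)" if "C \<in> carrier (free_group n)" for C w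
    using artin_hom[of w] that by (auto simp: hom_def)
  then have "bij_betw (artin n w) (carrier (free_group n)) (carrier (free_group n))"
    using artin_inverse[OF w] by (intro bij_betw_byWitness[of _ "artin n (word_inv w)"])
      (auto simp: compose_def fun_eq_iff AutoGroup_def BijGroup_def split: if_splits)
  then show ?thesis using artin_hom[of w] by (simp add: auto_def Bij_def artin_def)
qed

lemma artin_mult:
  "v \<in> words {..<m} \<Longrightarrow> w \<in> words {..<m} \<Longrightarrow>
    artin n v \<otimes>\<^bsub>AutoGroup (free_group n)\<^esub> artin n w = artin n (v @ w)"
  by (simp add: mult_AutoGroup artin_auto artin_append)

lemma artin_faithful:
  assumes w: "w \<in> words {..<m}" and id: "artin n w = \<one>\<^bsub>AutoGroup (free_group n)\<^esub>"
  shows "(w, []) \<in> word_rel {..<m} (braid_relations n)"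
  unfolding n
proof (rule hurwitz_faithful[OF w])
  fix g :: "nat \<Rightarrow> int mat2 \<times> int \<times> int" and i
  assume g: "g \<in> UNIV \<rightarrow> carrier affine_SL2" and i: "i \<le> m"
  have i': "i < n" using i by (simp add: n)
  define h where "h = lift_val affine_SL2 g"
  have gn: "g \<in> {..<n} \<rightarrow> carrier affine_SL2" using g by auto
  have "h \<in> hom (free_group n) affine_SL2"
    unfolding h_def free_group_def by (rule affine_SL2.lift_val_hom[OF gn]) simp
  then interpret h: group_hom "free_group n" affine_SL2 h
    by (simp add: group_hom_def group_hom_axioms_def group_free_group group_affine_SL2)
  have hg: "h (free_gen n k) = g k" if "k \<le> m" for k
  proof -
    have "h (free_gen n k) = word_val affine_SL2 g [(k, True)]"
      unfolding h_def using that n by (intro affine_SL2.lift_val_class[OF gn]) (auto simp: words_Nil)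
    moreover have "g k \<in> carrier affine_SL2" using g by auto
    ultimately show ?thesis by (simp only: word_val.simps if_True affine_SL2.r_one)
  qed
  have "hurwitz affine_SL2 g w i = hurwitz affine_SL2 (h \<circ> free_tuple n) w i"
    using w _ i
  proof (rule hurwitz_cong)
    show "g k = (h \<circ> free_tuple n) k" if "k \<le> m" for k
      using hg[OF that] that by (simp add: free_tuple_def n less_Suc_eq_le)
  qed
  also have "\<dots> = h (hurwitz (free_group n) (free_tuple n) w i)"
    using fun_cong[OF hurwitz_natural[OF h.group_hom_axioms free_tuple_closed, of w], of i] by simp
  also have "hurwitz (free_group n) (free_tuple n) w i = free_gen n i"
    using artin_gen[OF i', of w] free_gen_carrier[OF i'] by (simp add: id AutoGroup_def BijGroup_def)
  also have "h (free_gen n i) = g i" using i by (rule hg)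
  finally show "hurwitz affine_SL2 g w i = g i" .
qed

lemma artin_word_val:
  assumes "w \<in> words {..<m}"
  shows "word_val (AutoGroup (free_group n)) (\<lambda>i. artin n [(i, True)]) w = artin n w"
  using assms
proof (induction w rule: word_inv.induct)
  case 1
  show ?case by (simp add: artin_Nil)
next
  case (2 i b w)
  interpret A: group "AutoGroup (free_group n)" by (rule group_AutoGroup_free)
  have l: "[(i, c)] \<in> words {..<m}" for c using 2(2) by (simp add: words_Nil)
  have "inv\<^bsub>AutoGroup (free_group n)\<^esub> artin n [(i, True)] = artin n [(i, False)]"
    using artin_inverse(2)[OF l[of True]] artin_auto[OF l]
    by (intro A.inv_equality) (simp_all add: carrier_AutoGroup mult_AutoGroup)
  then show ?case using 2 l[of b] by (cases b) (simp_all add: artin_mult)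
qed

theorem Aut_free_group_contains_braid_group:
  "contains_group (AutoGroup (free_group n)) (braid_group n)"
proof -
  interpret A: group "AutoGroup (free_group n)" by (rule group_AutoGroup_free)
  define h where "h = lift_val (AutoGroup (free_group n)) (\<lambda>i. artin n [(i, True)])"
  have B: "braid_group n = presented_group {..<m} (braid_relations n)"
    by (simp add: braid_group_def n)
  have f: "(\<lambda>i. artin n [(i, True)]) \<in> {..<m} \<rightarrow> carrier (AutoGroup (free_group n))"
    using artin_auto by (auto simp: carrier_AutoGroup words_Nil)
  have R: "word_val (AutoGroup (free_group n)) (\<lambda>i. artin n [(i, True)]) u =
      word_val (AutoGroup (free_group n)) (\<lambda>i. artin n [(i, True)]) v"
    if "(u, v) \<in> braid_relations n" "u \<in> words {..<m}" "v \<in> words {..<m}" for u v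
    using artin_rel[OF word_rel.relator[OF that]] that by (simp add: artin_word_val)
  have hom: "h \<in> hom (braid_group n) (AutoGroup (free_group n))"
    unfolding h_def B by (rule A.lift_val_hom[OF f R])
  have ker: "C = \<one>\<^bsub>braid_group n\<^esub>"
    if C: "C \<in> carrier (braid_group n)" and one: "h C = \<one>\<^bsub>AutoGroup (free_group n)\<^esub>" for C
  proof -
    obtain w where w: "w \<in> words {..<m}" "C = word_rel {..<m} (braid_relations n) `` {w}"
      using C unfolding B by (rule presented_groupE)
    have "h C = artin n w"
      unfolding h_def w(2) using A.lift_val_class[OF f R w(1)] artin_word_val[OF w(1)] by simp
    then have "(w, []) \<in> word_rel {..<m} (braid_relations n)"
      using artin_faithful[OF w(1)] one by simp
    then show ?thesis unfolding B one_presented_group w(2) using w(1)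
      by (simp add: class_eq_iff words_Nil)
  qed
  have "group (braid_group n)" unfolding B by (rule group_presented_group)
  from mon_iff_hom_one[OF this group_AutoGroup_free, THEN iffD2]
  have "h \<in> mon (braid_group n) (AutoGroup (free_group n))" using hom ker by simp
  then show ?thesis unfolding contains_group_def by blast
qed

end

lemma contains_group_trans:
  assumes "contains_group A B" "contains_group B C"
  shows "contains_group A C"
proof -
  obtain f g where "f \<in> mon B A" "g \<in> mon C B"
    using assms unfolding contains_group_def by blast
  then have "f \<circ> g \<in> mon C A" by (auto simp: mon_def hom_def inj_on_def Pi_iff)
  then show ?thesis unfolding contains_group_def by blast
qed

theorem theorem1p4:
  fixes n r :: nat
  assumes "n \<ge> 1" and "r \<ge> 3 * n - 1"
  shows "contains_group
      (cremona_group r :: ('k::{alg_closed_field, field_char_0} rat_fun \<Rightarrow> 'k rat_fun) monoid)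
      (AutoGroup (free_group n)) \<and>
    (n \<ge> 3 \<longrightarrow> contains_group
      (cremona_group r :: ('k rat_fun \<Rightarrow> 'k rat_fun) monoid)
      (braid_group n))"
proof -
  have "contains_group (cremona_group r :: ('k rat_fun \<Rightarrow> 'k rat_fun) monoid) (AutoGroup (free_group n))"
    using assms by (intro cremona_contains_Aut_free_group) auto
  moreover have "contains_group (AutoGroup (free_group n)) (braid_group n)"
    using assms(1) by (intro Aut_free_group_contains_braid_group[of n "n - 1"]) simp
  ultimately show ?thesis using contains_group_trans by blast
qed

end
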